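(* Let $\beta\in(0,1/2)$ and let $\eta$ be a finite signed measure on $[0,\infty)$ with $\int_{[0,\infty)}u\,|\eta|(du)<\infty$. Set $h(z)=(-z)^{1-\beta}-\int_{[0,\infty)}e^{zu}\,\eta(du)$ for $\mathrm{Re}(z)\le0$, and suppose that $h(z)\ne0$ for every $z\in\mathbb{C}$ with $\mathrm{Re}(z)\le0$. Let $g:\mathbb{R}\to\mathbb{R}$ be the function in $L^2$, vanishing on $(-\infty,0)$, with $\mathcal{F}[g](y)=(-iy)^{-\beta}/h(iy)$, and set $$\gamma_X(t)=\int_{\mathbb{R}}g(t+u)g(u)\,du,\quad t\in\mathbb{R},\qquad f_X(y)=|\mathcal{F}[g](y)|^2=\frac{1}{|h(iy)|^2}|y|^{-2\beta},\quad y\in\mathbb{R}.$$ Then it holds that $$\gamma_X(t)\sim\frac{\Gamma(1-2\beta)}{\Gamma(\beta)\Gamma(1-\beta)\,\eta([0,\infty))^2}\,t^{2\beta-1}\quad\text{and}\quad f_X(y)\sim\frac{1}{\eta([0,\infty))^2}\,|y|^{-2\beta}$$ as $t\to\infty$ and $y\to0$, respectively. In particular, $\int_{\mathbb{R}}|\gamma_X(t)|\,dt=\infty$.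
   Context: Complex powers: $z^\gamma=r^\gamma e^{i\gamma\theta}$ for $z=re^{i\theta}$, $r>0$, $\theta\in(-\pi,\pi]$ (principal branch). The Fourier transform is $\mathcal{F}[f](y)=\int_{\mathbb{R}}e^{iyu}f(u)\,du$ for $f\in L^1$ and is extended to $L^2$ by Plancherel's theorem. Under the stated condition on $h$ such a real-valued $g$ exists and is unique in $L^2$. The notation $a(t)\sim b(t)$ means $a(t)/b(t)\to1$ in the indicated limit. Interpretation: if $(L_t)_{t\in\mathbb{R}}$ is a two-sided Lévy process with $\mathbb{E}[L_1]=0$ and $\mathbb{E}[L_1^2]=1$, then $X_t=\int_{-\infty}^tg(t-u)\,dL_u$ is the unique purely non-deterministic stationary solution of the equation $X_t-X_s=\int_{-\infty}^t\frac{1}{\Gamma(1-\beta)}\big[(t-u)_+^{-\beta}-(s-u)_+^{-\beta}\big]\int_{[0,\infty)}X_{u-v}\,\eta(dv)\,du+L_t-L_s$ ($s<t$), $\gamma_X(t)=\mathbb{E}[X_0X_t]$ is its autocovariance function, and $f_X$ is its spectral density (up to the normalizing constant of the Fourier transform). *)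

theory Defs
  imports "HOL-Analysis.Analysis" "HOL-Library.Landau_Symbols"
begin

section \<open>Finite signed measures\<close>

text \<open>
  A finite signed measure is a countably additive real-valued set function on the
  \<open>\<sigma>\<close>-algebra of \<open>M\<close>; only \<open>space M\<close> and \<open>sets M\<close> matter, not the measure carried by \<open>M\<close>.
  The series converges absolutely, because the union does not depend on the
  enumeration of the sets.
\<close>

definition finite_signed_measure :: "'a measure \<Rightarrow> ('a set \<Rightarrow> real) \<Rightarrow> bool" where
  "finite_signed_measure M \<eta> \<longleftrightarrow>
     \<eta> {} = 0 \<and>
     (\<forall>A :: nat \<Rightarrow> 'a set. range A \<subseteq> sets M \<longrightarrow> disjoint_family A \<longrightarrow>
        (\<lambda>n. \<eta> (A n)) sums \<eta> (\<Union>n. A n))"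

text \<open>
  The Jordan decomposition \<open>\<eta>\<^sup>+(A) = sup {\<eta>(B) | B \<subseteq> A}\<close> and \<open>\<eta>\<^sup>- = (-\<eta>)\<^sup>+\<close>. Negative
  values are truncated to \<open>0\<close> by \<open>ennreal\<close>, which does not change the supremum
  since \<open>B = {}\<close> is admitted.
\<close>

definition pos_variation :: "'a measure \<Rightarrow> ('a set \<Rightarrow> real) \<Rightarrow> 'a measure" where
  "pos_variation M \<eta> =
     measure_of (space M) (sets M) (\<lambda>A. SUP B\<in>{B \<in> sets M. B \<subseteq> A}. ennreal (\<eta> B))"

definition neg_variation :: "'a measure \<Rightarrow> ('a set \<Rightarrow> real) \<Rightarrow> 'a measure" where
  "neg_variation M \<eta> = pos_variation M (\<lambda>A. - \<eta> A)"

definition total_variation :: "'a measure \<Rightarrow> ('a set \<Rightarrow> real) \<Rightarrow> 'a measure" where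
  "total_variation M \<eta> =
     measure_of (space M) (sets M)
       (\<lambda>A. emeasure (pos_variation M \<eta>) A + emeasure (neg_variation M \<eta>) A)"

definition signed_integral ::
    "'a measure \<Rightarrow> ('a set \<Rightarrow> real) \<Rightarrow> ('a \<Rightarrow> 'b::{banach, second_countable_topology}) \<Rightarrow> 'b" where
  "signed_integral M \<eta> f =
     integral\<^sup>L (pos_variation M \<eta>) f - integral\<^sup>L (neg_variation M \<eta>) f"

text \<open>
  \<^const>\<open>measure_of\<close> yields the null measure when the given set function is not a measure.
  The following facts show that this does not happen above.
\<close>

lemma sets_pos_variation [simp, measurable_cong]: "sets (pos_variation M \<eta>) = sets M"
  and space_pos_variation [simp]: "space (pos_variation M \<eta>) = space M"
  by (simp_all add: pos_variation_def sets.sets_measure_of_eq sets.space_measure_of_eq)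

lemma sets_neg_variation [simp, measurable_cong]: "sets (neg_variation M \<eta>) = sets M"
  and space_neg_variation [simp]: "space (neg_variation M \<eta>) = space M"
  by (simp_all add: neg_variation_def)

lemma sets_total_variation [simp, measurable_cong]: "sets (total_variation M \<eta>) = sets M"
  and space_total_variation [simp]: "space (total_variation M \<eta>) = space M"
  by (simp_all add: total_variation_def sets.sets_measure_of_eq sets.space_measure_of_eq)

lemma finite_signed_measure_empty: "finite_signed_measure M \<eta> \<Longrightarrow> \<eta> {} = 0"
  by (simp add: finite_signed_measure_def)

lemma finite_signed_measure_sums:
  assumes "finite_signed_measure M \<eta>" "\<And>n. A n \<in> sets M" "disjoint_family A"
  shows "(\<lambda>n. \<eta> (A n)) sums \<eta> (\<Union>n. A n)"
proof -
  have "range A \<subseteq> sets M" using assms(2) by blast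
  then show ?thesis using assms(1,3) unfolding finite_signed_measure_def by blast
qed

lemma finite_signed_measure_uminus:
  "finite_signed_measure M \<eta> \<Longrightarrow> finite_signed_measure M (\<lambda>A. - \<eta> A)"
  by (auto simp: finite_signed_measure_def intro!: sums_minus)

lemma finite_signed_measure_Un:
  assumes \<eta>: "finite_signed_measure M \<eta>" and AB: "A \<in> sets M" "B \<in> sets M" "A \<inter> B = {}"
  shows "\<eta> (A \<union> B) = \<eta> A + \<eta> B"
proof -
  have eq: "(\<lambda>n. \<eta> (binaryset A B n)) = (\<lambda>n. if n = 0 then \<eta> A else if n = 1 then \<eta> B else 0)"
    unfolding binaryset_def by (rule ext) (simp add: finite_signed_measure_empty[OF \<eta>])
  have dis: "disjoint_family (binaryset A B)"
    using AB(3) by (auto simp: disjoint_family_on_def binaryset_def)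
  have "(\<lambda>n. \<eta> (binaryset A B n)) sums \<eta> (\<Union>n. binaryset A B n)"
    by (rule finite_signed_measure_sums[OF \<eta> _ dis]) (use AB in \<open>auto simp: binaryset_def\<close>)
  then have 1: "(\<lambda>n. \<eta> (binaryset A B n)) sums \<eta> (A \<union> B)"
    by (simp add: UN_binaryset_eq)
  have "(\<lambda>n. \<eta> (binaryset A B n)) sums (\<Sum>n\<in>{0,1}. \<eta> (binaryset A B n))"
    by (rule sums_finite) (use fun_cong[OF eq] in auto)
  then have "(\<lambda>n. \<eta> (binaryset A B n)) sums (\<eta> A + \<eta> B)"
    using fun_cong[OF eq] by simp
  with 1 show ?thesis by (rule sums_unique2)
qed

lemma emeasure_pos_variation:
  assumes \<eta>: "finite_signed_measure M \<eta>" and X: "X \<in> sets M"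
  shows "emeasure (pos_variation M \<eta>) X = (SUP B\<in>{B \<in> sets M. B \<subseteq> X}. ennreal (\<eta> B))"
proof -
  define \<mu> where "\<mu> = (\<lambda>A. SUP B\<in>{B \<in> sets M. B \<subseteq> A}. ennreal (\<eta> B))"
  have upper: "ennreal (\<eta> B) \<le> \<mu> A" if "B \<in> sets M" "B \<subseteq> A" for A B
    unfolding \<mu>_def using that by (intro SUP_upper) auto
  have mono: "\<mu> A \<le> \<mu> B" if "A \<subseteq> B" for A B
    unfolding \<mu>_def using that by (intro SUP_subset_mono) auto
  have witness: "\<exists>C'\<in>sets M. C' \<subseteq> C \<and> \<eta> C' \<ge> 0 \<and> ennreal (\<eta> C) = ennreal (\<eta> C')"
    if "C \<in> sets M" for C
  proof (cases "\<eta> C \<ge> 0")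
    case False
    then show ?thesis
      using finite_signed_measure_empty[OF \<eta>] by (intro bexI[of _ "{}"]) (auto simp: ennreal_neg)
  qed (use that in auto)
  have super: "\<mu> A + \<mu> B \<le> \<mu> (A \<union> B)" if AB: "A \<inter> B = {}" for A B
  proof -
    have *: "ennreal (\<eta> C) + ennreal (\<eta> D) \<le> \<mu> (A \<union> B)"
      if CD: "C \<in> sets M" "C \<subseteq> A" "D \<in> sets M" "D \<subseteq> B" for C D
    proof -
      obtain C' where C': "C' \<in> sets M" "C' \<subseteq> C" "\<eta> C' \<ge> 0" "ennreal (\<eta> C) = ennreal (\<eta> C')"
        using witness[OF CD(1)] by blast
      obtain D' where D': "D' \<in> sets M" "D' \<subseteq> D" "\<eta> D' \<ge> 0" "ennreal (\<eta> D) = ennreal (\<eta> D')"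
        using witness[OF CD(3)] by blast
      have "\<eta> (C' \<union> D') = \<eta> C' + \<eta> D'"
        by (rule finite_signed_measure_Un[OF \<eta>]) (use C' D' CD AB in \<open>blast+\<close>)
      then have "ennreal (\<eta> C) + ennreal (\<eta> D) = ennreal (\<eta> (C' \<union> D'))"
        using C' D' by (simp add: ennreal_plus)
      also have "\<dots> \<le> \<mu> (A \<union> B)"
        by (rule upper) (use C' D' CD in auto)
      finally show ?thesis .
    qed
    have ne: "{B \<in> sets M. B \<subseteq> A} \<noteq> {}" for A by (auto intro!: exI[of _ "{}"])
    have "ennreal (\<eta> C) + \<mu> B \<le> \<mu> (A \<union> B)" if "C \<in> sets M" "C \<subseteq> A" for C
    proof -
      have "ennreal (\<eta> C) + \<mu> B = (SUP D\<in>{D \<in> sets M. D \<subseteq> B}. ennreal (\<eta> C) + ennreal (\<eta> D))"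
        unfolding \<mu>_def using ne by (simp add: ennreal_SUP_add_right)
      also have "\<dots> \<le> \<mu> (A \<union> B)"
        by (rule SUP_least) (use * that in auto)
      finally show ?thesis .
    qed
    moreover have "\<mu> A + \<mu> B = (SUP C\<in>{C \<in> sets M. C \<subseteq> A}. ennreal (\<eta> C) + \<mu> B)"
      unfolding \<mu>_def[of ] using ne by (simp add: ennreal_SUP_add_left)
    ultimately show ?thesis
      by (auto intro!: SUP_least)
  qed
  have empty: "\<mu> {} = 0"
  proof -
    have "{B \<in> sets M. B \<subseteq> {}} = {{}}" by auto
    then show ?thesis by (simp add: \<mu>_def finite_signed_measure_empty[OF \<eta>])
  qed
  have ca: "countably_additive (sets M) \<mu>"
  proof (rule countably_additiveI)
    fix A :: "nat \<Rightarrow> 'a set"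
    assume A: "range A \<subseteq> sets M" "disjoint_family A"
    show "(\<Sum>i. \<mu> (A i)) = \<mu> (\<Union>i. A i)"
    proof (rule antisym)
      have part: "(\<Sum>i<n. \<mu> (A i)) \<le> \<mu> (\<Union>i<n. A i)" for n
      proof (induction n)
        case (Suc n)
        have "(\<Union>i<n. A i) \<inter> A n = {}"
          proof -
          have "A i \<inter> A n = {}" if "i < n" for i
            by (rule disjoint_family_onD[OF A(2)]) (use that in auto)
          then show ?thesis by blast
        qed
        then have "\<mu> (\<Union>i<n. A i) + \<mu> (A n) \<le> \<mu> ((\<Union>i<n. A i) \<union> A n)"
          by (rule super)
        moreover have "(\<Union>i<n. A i) \<union> A n = (\<Union>i<Suc n. A i)"
          by (auto simp: less_Suc_eq)
        ultimately show ?case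
          using order_trans[OF add_right_mono[OF Suc, of "\<mu> (A n)"]] by simp
      qed (simp add: empty)
      show "(\<Sum>i. \<mu> (A i)) \<le> \<mu> (\<Union>i. A i)"
      proof (rule suminf_le_const)
        show "(\<Sum>i<n. \<mu> (A i)) \<le> \<mu> (\<Union>i. A i)" for n
          by (rule order_trans[OF part mono]) blast
      qed simp
    next
      have "ennreal (\<eta> B) \<le> (\<Sum>i. \<mu> (A i))" if B: "B \<in> sets M" "B \<subseteq> (\<Union>i. A i)" for B
      proof (rule LIMSEQ_le_const2)
        have "(\<lambda>i. \<eta> (B \<inter> A i)) sums \<eta> (\<Union>i. B \<inter> A i)"
          by (rule finite_signed_measure_sums[OF \<eta>])
             (use A B in \<open>auto simp: disjoint_family_on_def\<close>)
        also have "(\<Union>i. B \<inter> A i) = B" using B by auto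
        finally show "(\<lambda>n. ennreal (\<Sum>i<n. \<eta> (B \<inter> A i))) \<longlonglongrightarrow> ennreal (\<eta> B)"
          unfolding sums_def by (rule tendsto_ennrealI)
        have "ennreal (\<Sum>i<n. \<eta> (B \<inter> A i)) \<le> (\<Sum>i. \<mu> (A i))" for n
        proof -
          have "ennreal (\<Sum>i<n. \<eta> (B \<inter> A i)) \<le> ennreal (\<Sum>i<n. max 0 (\<eta> (B \<inter> A i)))"
            by (intro ennreal_leI sum_mono) auto
          also have "\<dots> = (\<Sum>i<n. ennreal (max 0 (\<eta> (B \<inter> A i))))"
            by (simp add: sum_ennreal)
          also have "\<dots> = (\<Sum>i<n. ennreal (\<eta> (B \<inter> A i)))"
            by (simp add: ennreal_max_0)
          also have "\<dots> \<le> (\<Sum>i<n. \<mu> (A i))"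
            by (intro sum_mono upper) (use A B in auto)
          also have "\<dots> \<le> (\<Sum>i. \<mu> (A i))"
            by (rule sum_le_suminf) auto
          finally show ?thesis .
        qed
        then show "\<exists>N. \<forall>n\<ge>N. ennreal (\<Sum>i<n. \<eta> (B \<inter> A i)) \<le> (\<Sum>i. \<mu> (A i))" by blast
      qed
      then show "\<mu> (\<Union>i. A i) \<le> (\<Sum>i. \<mu> (A i))"
        unfolding \<mu>_def by (intro SUP_least) auto
    qed
  qed
  have "emeasure (pos_variation M \<eta>) X = \<mu> X"
    by (rule emeasure_measure_of[of _ "space M" "sets M"])
       (use X ca empty sets.space_closed in
         \<open>auto simp: pos_variation_def \<mu>_def positive_def sets.sets_measure_of_eq\<close>)
  then show ?thesis by (simp add: \<mu>_def)
qed

lemma emeasure_total_variation: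
  assumes "X \<in> sets M"
  shows "emeasure (total_variation M \<eta>) X =
    emeasure (pos_variation M \<eta>) X + emeasure (neg_variation M \<eta>) X"
proof (rule emeasure_measure_of[OF total_variation_def])
  show "countably_additive (sets (total_variation M \<eta>))
     (\<lambda>A. emeasure (pos_variation M \<eta>) A + emeasure (neg_variation M \<eta>) A)"
  proof (rule countably_additiveI)
    fix A :: "nat \<Rightarrow> 'a set"
    assume A: "range A \<subseteq> sets (total_variation M \<eta>)" "disjoint_family A"
    then have "(\<Sum>i. emeasure (pos_variation M \<eta>) (A i)) = emeasure (pos_variation M \<eta>) (\<Union>i. A i)"
      "(\<Sum>i. emeasure (neg_variation M \<eta>) (A i)) = emeasure (neg_variation M \<eta>) (\<Union>i. A i)"
      by (auto intro!: suminf_emeasure)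
    then show "(\<Sum>i. emeasure (pos_variation M \<eta>) (A i) + emeasure (neg_variation M \<eta>) (A i)) =
      emeasure (pos_variation M \<eta>) (\<Union>i. A i) + emeasure (neg_variation M \<eta>) (\<Union>i. A i)"
      by (simp add: suminf_add[symmetric, OF summableI summableI])
  qed
qed (use assms sets.space_closed in \<open>auto simp: positive_def\<close>)


section \<open>The Fourier transform on \<open>L\<^sup>1\<close> and \<open>L\<^sup>2\<close>\<close>

definition square_integrable ::
    "(real \<Rightarrow> 'a::{real_normed_vector, second_countable_topology}) \<Rightarrow> bool" where
  "square_integrable f \<longleftrightarrow>
     f \<in> borel_measurable lborel \<and> integrable lborel (\<lambda>x. (norm (f x))\<^sup>2)"

definition L2_tendsto :: "(nat \<Rightarrow> real \<Rightarrow> complex) \<Rightarrow> (real \<Rightarrow> complex) \<Rightarrow> bool" where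
  "L2_tendsto F f \<longleftrightarrow>
     (\<lambda>n. \<integral>\<^sup>+x. ennreal ((norm (F n x - f x))\<^sup>2) \<partial>lborel) \<longlonglongrightarrow> 0"

definition fourier :: "(real \<Rightarrow> complex) \<Rightarrow> real \<Rightarrow> complex" where
  "fourier f y = (LBINT u. exp (\<i> * of_real (y * u)) * f u)"

text \<open>
  \<open>has_L2_fourier f \<phi>\<close>: the function \<open>\<phi>\<close> represents the \<open>L\<^sup>2\<close> class of the Fourier transform of
  \<open>f\<close>, where the transform is the extension by continuity from \<open>L\<^sup>1 \<inter> L\<^sup>2\<close> to \<open>L\<^sup>2\<close>. By Plancherel's
  theorem the choice of the approximating sequence is irrelevant and \<open>\<phi>\<close> is unique almost
  everywhere.
\<close>

definition has_L2_fourier :: "(real \<Rightarrow> complex) \<Rightarrow> (real \<Rightarrow> complex) \<Rightarrow> bool" where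
  "has_L2_fourier f \<phi> \<longleftrightarrow>
     square_integrable f \<and> square_integrable \<phi> \<and>
     (\<exists>F. (\<forall>n. integrable lborel (F n) \<and> square_integrable (F n)) \<and>
          L2_tendsto F f \<and> L2_tendsto (\<lambda>n. fourier (F n)) \<phi>)"


section \<open>The model\<close>

abbreviation nonneg_borel :: "real measure" where
  "nonneg_borel \<equiv> restrict_space borel {0..}"

text \<open>\<open>powr\<close> on \<^typ>\<open>complex\<close> is the principal branch (arguments in \<open>(-\<pi>, \<pi>]\<close>), with \<open>0 powr a = 0\<close>.\<close>

definition h_fun :: "real \<Rightarrow> (real set \<Rightarrow> real) \<Rightarrow> complex \<Rightarrow> complex" where
  "h_fun \<beta> \<eta> z =
     (- z) powr of_real (1 - \<beta>) - signed_integral nonneg_borel \<eta> (\<lambda>u. exp (z * of_real u))"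

definition autocov :: "(real \<Rightarrow> real) \<Rightarrow> real \<Rightarrow> real" where
  "autocov g t = (LBINT u. g (t + u) * g u)"

definition spectral_density :: "(real \<Rightarrow> complex) \<Rightarrow> real \<Rightarrow> real" where
  "spectral_density g_hat y = (cmod (g_hat y))\<^sup>2"

end

theory Submission
  imports Defs "HOL-Probability.Probability"
begin

text \<open>
  Write \<open>f(y) = \<bar>g_hat y\<bar>\<^sup>2\<close> for the spectral density. Plancherel's theorem turns the autocovariance
  into an honest Fourier integral, \<open>2 \<pi> \<gamma>(t) = \<integral> exp(-iyt) f(y) dy\<close>, which converges absolutely because
  \<open>g_hat\<close> is square integrable; since \<open>f\<close> is even, \<open>\<pi> \<gamma>(t)\<close> is the cosine transform of \<open>f\<close> on the
  half line. There \<open>f(y) = y\<^bsup>-2\<beta>\<^esup> / \<bar>h(iy)\<bar>\<^sup>2\<close>, and \<open>h(iy)\<close> tends to \<open>h(0) = -\<eta>[0,\<infinity>)\<close>, which is nonzero, so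
  the only singularity of \<open>f\<close> is the factor \<open>y\<^bsup>-2\<beta>\<^esup>\<close> at the origin. This is the claim about \<open>f\<close>, and it
  dictates the decay of \<open>\<gamma>\<close>.

  The passage from \<open>f\<close> to \<open>\<gamma>\<close> needs regularity of \<open>f\<close>, not only its size. The first moment of \<open>\<eta>\<close>
  makes the Fourier transform of \<open>\<eta>\<close> continuously differentiable with bounded derivative, whence
  \<open>\<bar>f'(y)\<bar> \<le> C y\<^bsup>-2\<beta>-1\<^esup>\<close> on the whole half line and \<open>y\<^bsup>2\<beta>+1\<^esup> f'(y) \<rightarrow> -2\<beta> / \<eta>[0,\<infinity>)\<^sup>2\<close> at \<open>0\<close>
  (\<open>singular_spectrum_derivative\<close>). One integration by parts and the substitution \<open>y = x/t\<close> give
    \<open>t\<^bsup>1-2\<beta>\<^esup> \<integral>\<^sub>0\<^sup>\<infinity> cos(ty) f(y) dy = - \<integral>\<^sub>0\<^sup>\<infinity> sin x x\<^bsup>-2\<beta>-1\<^esup> [(x/t)\<^bsup>2\<beta>+1\<^esup> f'(x/t)] dx\<close>.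
  The bracket is bounded and converges, and \<open>sin x x\<^bsup>-2\<beta>-1\<^esup>\<close> is absolutely integrable for
  \<open>0 < 2\<beta> < 1\<close>, so dominated convergence yields the limit (\<open>cos_transform_asymptotics\<close>). The
  remaining integral is evaluated with Gamma and Beta functions and the reflection formula (\<open>sin_powr_integral\<close>).

  The Fourier formula for \<open>\<gamma>\<close> is \<open>autocov_spectral_representation\<close>. For approximants in \<open>L\<^sup>1\<close> it holds
  after Gaussian smoothing by Fubini's theorem; both sides of the smoothed identity are continuous
  in the \<open>L\<^sup>2\<close> norm; and the smoothing is removed by dominated convergence on the spectral side and
  by continuity of \<open>\<gamma>\<close> on the other. Non-integrability of \<open>\<gamma>\<close> is immediate from its decay rate, as
  \<open>2\<beta> - 1 > -1\<close>.
\<close>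

section \<open>Jordan decomposition of a finite signed measure\<close>

text \<open>
  If \<open>\<eta>\<close> is unbounded on \<open>E\<close>, choose \<open>A \<subseteq> E\<close> with \<open>\<bar>\<eta> A\<bar> > 1 + \<bar>\<eta> E\<bar>\<close>: then \<open>A\<close> and \<open>E - A\<close> both carry
  mass larger than \<open>1\<close>, and \<open>\<eta>\<close> is unbounded on at least one of them. Keeping that one allows the
  splitting to be repeated.
\<close>

lemma signed_measure_unbounded_split:
  fixes \<eta> :: "'a set \<Rightarrow> real"
  defines "unbdd \<equiv> \<lambda>M E. \<forall>C. \<exists>A\<in>sets M. A \<subseteq> E \<and> C < \<bar>\<eta> A\<bar>"
  assumes \<eta>: "finite_signed_measure M \<eta>" and E: "E \<in> sets M" "unbdd M E"
  shows "\<exists>A\<in>sets M. A \<subseteq> E \<and> unbdd M A \<and> 1 < \<bar>\<eta> (E - A)\<bar>"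
proof -
  obtain A where A: "A \<in> sets M" "A \<subseteq> E" "1 + \<bar>\<eta> E\<bar> < \<bar>\<eta> A\<bar>"
    using E(2) unfolding unbdd_def by blast
  have "\<eta> (A \<union> (E - A)) = \<eta> A + \<eta> (E - A)"
    by (rule finite_signed_measure_Un[OF \<eta>]) (use A E in auto)
  moreover have "A \<union> (E - A) = E" using A by blast
  ultimately have big: "1 < \<bar>\<eta> (E - A)\<bar>" "1 < \<bar>\<eta> A\<bar>"
    using A(3) by auto
  have "unbdd M A \<or> unbdd M (E - A)"
  proof (rule ccontr)
    assume "\<not> (unbdd M A \<or> unbdd M (E - A))"
    then obtain C D where C: "\<And>X. X \<in> sets M \<Longrightarrow> X \<subseteq> A \<Longrightarrow> \<bar>\<eta> X\<bar> \<le> C"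
      and D: "\<And>X. X \<in> sets M \<Longrightarrow> X \<subseteq> E - A \<Longrightarrow> \<bar>\<eta> X\<bar> \<le> D"
      unfolding unbdd_def by (meson not_le)
    obtain X where X: "X \<in> sets M" "X \<subseteq> E" "C + D < \<bar>\<eta> X\<bar>"
      using E(2) unfolding unbdd_def by blast
    have "\<eta> ((X \<inter> A) \<union> (X - A)) = \<eta> (X \<inter> A) + \<eta> (X - A)"
      by (rule finite_signed_measure_Un[OF \<eta>]) (use X A in auto)
    moreover have "(X \<inter> A) \<union> (X - A) = X" by blast
    moreover have "\<bar>\<eta> (X \<inter> A)\<bar> \<le> C" "\<bar>\<eta> (X - A)\<bar> \<le> D"
      using X A by (auto intro!: C D)
    ultimately show False using X(3) by auto
  qed
  then show ?thesis
  proof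
    assume "unbdd M A"
    then show ?thesis using A big by blast
  next
    assume "unbdd M (E - A)"
    moreover have "E - (E - A) = A" using A by blast
    ultimately show ?thesis using A E big by (intro bexI[of _ "E - A"]) auto
  qed
qed

text \<open>
  Otherwise the repeated splitting peels off infinitely many disjoint sets whose measures exceed
  \<open>1\<close> in absolute value, and the series of their measures could not converge.
\<close>

lemma finite_signed_measure_bounded:
  assumes \<eta>: "finite_signed_measure M \<eta>"
  obtains C where "\<And>A. A \<in> sets M \<Longrightarrow> \<bar>\<eta> A\<bar> \<le> C"
proof -
  define unbdd where "unbdd E \<longleftrightarrow> (\<forall>C. \<exists>A\<in>sets M. A \<subseteq> E \<and> C < \<bar>\<eta> A\<bar>)" for E
  have "\<not> unbdd (space M)"
  proof
    assume unb: "unbdd (space M)"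
    have "\<exists>E. \<forall>n. (E n \<in> sets M \<and> unbdd (E n)) \<and> (E (Suc n) \<subseteq> E n \<and> 1 < \<bar>\<eta> (E n - E (Suc n))\<bar>)"
    proof (rule dependent_nat_choice)
      show "\<exists>E. E \<in> sets M \<and> unbdd E" using unb by (intro exI[of _ "space M"]) simp
      fix E n assume E: "E \<in> sets M \<and> unbdd E"
      show "\<exists>F. (F \<in> sets M \<and> unbdd F) \<and> F \<subseteq> E \<and> 1 < \<bar>\<eta> (E - F)\<bar>"
        using signed_measure_unbounded_split[OF \<eta>, of E] E unfolding unbdd_def by blast
    qed
    then obtain E where E: "\<And>n. E n \<in> sets M" "\<And>n. E (Suc n) \<subseteq> E n"
      "\<And>n. 1 < \<bar>\<eta> (E n - E (Suc n))\<bar>" by blast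
    have dec: "E n \<subseteq> E m" if "m \<le> n" for m n
      using that by (rule lift_Suc_antimono_le[of E, rotated]) (rule E(2))
    have "disjoint_family (\<lambda>n. E n - E (Suc n))"
      unfolding disjoint_family_on_def
    proof safe
      fix m n x assume "m \<noteq> n" and x: "x \<in> E m" "x \<notin> E (Suc m)" "x \<in> E n" "x \<notin> E (Suc n)"
      then consider "Suc m \<le> n" | "Suc n \<le> m" by linarith
      then have False using dec x by cases blast+
      then show "x \<in> {}" ..
    qed
    then have "(\<lambda>n. \<eta> (E n - E (Suc n))) sums \<eta> (\<Union>n. E n - E (Suc n))"
      by (intro finite_signed_measure_sums[OF \<eta>]) (use E in auto)
    then have "(\<lambda>n. \<eta> (E n - E (Suc n))) \<longlonglongrightarrow> 0"
      by (intro summable_LIMSEQ_zero) (rule sums_summable)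
    then have "\<forall>\<^sub>F n in sequentially. dist (\<eta> (E n - E (Suc n))) 0 < 1"
      by (rule tendstoD) simp
    then obtain n where "dist (\<eta> (E n - E (Suc n))) 0 < 1"
      by (auto simp: eventually_sequentially)
    then show False using E(3)[of n] by (simp add: dist_real_def)
  qed
  then obtain C where C: "\<And>A. A \<in> sets M \<Longrightarrow> A \<subseteq> space M \<Longrightarrow> \<bar>\<eta> A\<bar> \<le> C"
    unfolding unbdd_def by (meson not_le)
  show ?thesis by (rule that[of C]) (intro C sets.sets_into_space; assumption)
qed

lemma emeasure_neg_variation:
  assumes "finite_signed_measure M \<eta>" "X \<in> sets M"
  shows "emeasure (neg_variation M \<eta>) X = (SUP B\<in>{B \<in> sets M. B \<subseteq> X}. ennreal (- \<eta> B))"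
  unfolding neg_variation_def
  by (rule emeasure_pos_variation[OF finite_signed_measure_uminus]) fact+

lemma finite_pos_variation:
  assumes \<eta>: "finite_signed_measure M \<eta>"
  shows "finite_measure (pos_variation M \<eta>)"
proof
  obtain C where C: "\<And>A. A \<in> sets M \<Longrightarrow> \<bar>\<eta> A\<bar> \<le> C"
    using finite_signed_measure_bounded[OF \<eta>] by blast
  have "emeasure (pos_variation M \<eta>) (space M) \<le> ennreal C"
    unfolding emeasure_pos_variation[OF \<eta> sets.top]
    by (rule SUP_least) (use C in \<open>force intro!: ennreal_leI\<close>)
  then show "emeasure (pos_variation M \<eta>) (space (pos_variation M \<eta>)) \<noteq> \<infinity>"
    by (auto simp: top_unique)
qed

lemma finite_neg_variation:
  "finite_signed_measure M \<eta> \<Longrightarrow> finite_measure (neg_variation M \<eta>)"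
  unfolding neg_variation_def by (intro finite_pos_variation finite_signed_measure_uminus)

text \<open>
  For \<open>B \<subseteq> X\<close> one has \<open>\<eta> B = \<eta> X - \<eta> (X - B)\<close>, and \<open>- \<eta> (X - B)\<close> is at most the negative variation of
  \<open>X\<close>. Applied to \<open>\<eta>\<close> and to \<open>-\<eta>\<close> this gives both inequalities of the Jordan decomposition; the
  finiteness of the variations is what permits the subtraction.
\<close>

lemma pos_variation_le:
  assumes \<eta>: "finite_signed_measure M \<eta>" and X: "X \<in> sets M"
  shows "measure (pos_variation M \<eta>) X \<le> \<eta> X + measure (neg_variation M \<eta>) X"
proof -
  interpret p: finite_measure "pos_variation M \<eta>" by (rule finite_pos_variation[OF \<eta>])
  interpret n: finite_measure "neg_variation M \<eta>" by (rule finite_neg_variation[OF \<eta>])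
  let ?n = "measure (neg_variation M \<eta>) X"
  have neg: "- \<eta> B \<le> ?n" if B: "B \<in> sets M" "B \<subseteq> X" for B
  proof -
    have "ennreal (- \<eta> B) \<le> emeasure (neg_variation M \<eta>) X"
      unfolding emeasure_neg_variation[OF \<eta> X] using B by (intro SUP_upper) auto
    then show ?thesis by (simp add: n.emeasure_eq_measure)
  qed
  have le: "\<eta> B \<le> \<eta> X + ?n" if B: "B \<in> sets M" "B \<subseteq> X" for B
  proof -
    have "\<eta> (B \<union> (X - B)) = \<eta> B + \<eta> (X - B)"
      by (rule finite_signed_measure_Un[OF \<eta>]) (use B X in auto)
    moreover have "B \<union> (X - B) = X" using B by blast
    ultimately show ?thesis using neg[of "X - B"] B X by auto
  qed
  have "0 \<le> \<eta> X + ?n"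
    using le[of "{}"] finite_signed_measure_empty[OF \<eta>] by auto
  moreover have "emeasure (pos_variation M \<eta>) X \<le> ennreal (\<eta> X + ?n)"
    unfolding emeasure_pos_variation[OF \<eta> X] by (rule SUP_least) (use le in \<open>auto intro!: ennreal_leI\<close>)
  ultimately show ?thesis by (simp add: p.emeasure_eq_measure)
qed

lemma Jordan_decomposition:
  assumes \<eta>: "finite_signed_measure M \<eta>" and X: "X \<in> sets M"
  shows "\<eta> X = measure (pos_variation M \<eta>) X - measure (neg_variation M \<eta>) X"
  using pos_variation_le[OF \<eta> X] pos_variation_le[OF finite_signed_measure_uminus[OF \<eta>] X]
  by (simp add: neg_variation_def)

lemma variation_first_moment:
  assumes "(\<integral>\<^sup>+u. ennreal u \<partial>total_variation nonneg_borel \<eta>) < \<infinity>"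
  shows "integrable (pos_variation nonneg_borel \<eta>) (\<lambda>u. u)"
    and "integrable (neg_variation nonneg_borel \<eta>) (\<lambda>u. u)"
proof -
  let ?p = "pos_variation nonneg_borel \<eta>" and ?n = "neg_variation nonneg_borel \<eta>"
    and ?t = "total_variation nonneg_borel \<eta>"
  have meas: "(\<lambda>u. u) \<in> borel_measurable N" if "sets N = sets nonneg_borel" for N :: "real measure"
    using that by (subst measurable_cong_sets[OF that refl]) (intro measurable_restrict_space1 measurable_ident_sets refl)
  have *: "integrable N (\<lambda>u. u)" if N: "sets N = sets nonneg_borel" and le: "\<And>X. X \<in> sets N \<Longrightarrow> emeasure N X \<le> emeasure ?t X"
    for N :: "real measure"
  proof (rule integrableI_bounded)
    show "(\<lambda>u. u) \<in> borel_measurable N" by (rule meas[OF N])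
    have sp: "space N = {0..}" using sets_eq_imp_space_eq[OF N] by (simp add: space_restrict_space)
    have "(\<integral>\<^sup>+u. ennreal (norm u) \<partial>N) = (\<integral>\<^sup>+u. ennreal u \<partial>N)"
      by (intro nn_integral_cong) (simp add: sp)
    also have "\<dots> \<le> (\<integral>\<^sup>+u. ennreal u \<partial>?t)"
    proof (rule nn_integral_mono_measure)
      show "N \<le> ?t"
        using N le by (subst le_measure) auto
    qed (use N in auto)
    also have "\<dots> < \<infinity>" by fact
    finally show "(\<integral>\<^sup>+u. ennreal (norm u) \<partial>N) < \<infinity>" .
  qed
  show "integrable ?p (\<lambda>u. u)" "integrable ?n (\<lambda>u. u)"
    by (rule *; simp add: emeasure_total_variation)+
qed

section \<open>The function \<open>h\<close> on the imaginary axis\<close>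

text \<open>
  Differentiation under the integral sign: the difference quotients of \<open>y \<mapsto> \<psi> (y u)\<close> are dominated by
  \<open>\<bar>u\<bar>\<close> because \<open>\<psi>\<close> is Lipschitz with constant \<open>1\<close>. With \<open>\<psi>\<close> the cosine and the sine this covers the
  real and imaginary part of the Fourier transform of \<open>N\<close>.
\<close>

lemma oscillatory_integral_deriv:
  fixes N :: "real measure" and \<psi> \<psi>' :: "real \<Rightarrow> real"
  assumes N: "finite_measure N" "sets N = sets nonneg_borel" and mom: "integrable N (\<lambda>u. u)"
    and der: "\<And>x. (\<psi> has_real_derivative \<psi>' x) (at x)" and cont: "\<And>x. isCont \<psi>' x"
    and bd: "\<And>x. \<bar>\<psi> x\<bar> \<le> 1" "\<And>x. \<bar>\<psi>' x\<bar> \<le> 1"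
  shows "((\<lambda>y. \<integral>u. \<psi> (y * u) \<partial>N) has_real_derivative (\<integral>u. u * \<psi>' (y * u) \<partial>N)) (at y)"
    and "isCont (\<lambda>y. \<integral>u. u * \<psi>' (y * u) \<partial>N) y"
    and "\<bar>\<integral>u. \<psi> (y * u) \<partial>N\<bar> \<le> measure N (space N)"
    and "\<bar>\<integral>u. u * \<psi>' (y * u) \<partial>N\<bar> \<le> (\<integral>u. \<bar>u\<bar> \<partial>N)"
proof -
  interpret finite_measure N by fact
  have [measurable]: "(\<lambda>u. u) \<in> borel_measurable N" using mom by (rule borel_measurable_integrable)
  have [measurable]: "\<psi> \<in> borel_measurable borel"
    by (intro borel_measurable_continuous_onI continuous_at_imp_continuous_on)
      (auto intro: DERIV_isCont der)
  have [measurable]: "\<psi>' \<in> borel_measurable borel"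
    by (intro borel_measurable_continuous_onI continuous_at_imp_continuous_on) (auto intro: cont)
  have i0: "integrable N (\<lambda>u. \<psi> (y * u))" for y
    by (rule integrable_const_bound[where B = 1]) (auto simp: bd)
  have i1: "integrable N (\<lambda>u. u * \<psi>' (y * u))" for y
    by (rule Bochner_Integration.integrable_bound[OF mom])
      (auto simp: abs_mult bd mult_left_le)
  have lip: "\<bar>\<psi> a - \<psi> b\<bar> \<le> \<bar>a - b\<bar>" for a b
    using field_differentiable_bound[of UNIV \<psi> \<psi>' 1 a b] der bd by auto
  have "\<bar>\<integral>u. \<psi> (y * u) \<partial>N\<bar> \<le> (\<integral>u. \<bar>\<psi> (y * u)\<bar> \<partial>N)" by (rule integral_abs_bound)
  also have "\<dots> \<le> (\<integral>u. 1 \<partial>N)"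
    using i0 by (intro integral_mono) (auto simp: bd)
  finally show "\<bar>\<integral>u. \<psi> (y * u) \<partial>N\<bar> \<le> measure N (space N)" by simp
  have "\<bar>\<integral>u. u * \<psi>' (y * u) \<partial>N\<bar> \<le> (\<integral>u. \<bar>u * \<psi>' (y * u)\<bar> \<partial>N)" by (rule integral_abs_bound)
  also have "\<dots> \<le> (\<integral>u. \<bar>u\<bar> \<partial>N)"
  proof (intro integral_mono)
    show "integrable N (\<lambda>u. \<bar>u * \<psi>' (y * u)\<bar>)" by (intro integrable_abs i1)
    show "integrable N (\<lambda>u. \<bar>u\<bar>)" by (intro integrable_abs mom)
  qed (simp add: abs_mult bd mult_left_le)
  finally show "\<bar>\<integral>u. u * \<psi>' (y * u) \<partial>N\<bar> \<le> (\<integral>u. \<bar>u\<bar> \<partial>N)" .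
  show "isCont (\<lambda>y. \<integral>u. u * \<psi>' (y * u) \<partial>N) y"
    unfolding isCont_def tendsto_at_iff_sequentially comp_def
  proof safe
    fix X :: "nat \<Rightarrow> real" assume X: "X \<longlonglongrightarrow> y"
    show "(\<lambda>n. \<integral>u. u * \<psi>' (X n * u) \<partial>N) \<longlonglongrightarrow> (\<integral>u. u * \<psi>' (y * u) \<partial>N)"
    proof (rule integral_dominated_convergence[where w = "\<lambda>u. \<bar>u\<bar>"])
      show "AE u in N. (\<lambda>n. u * \<psi>' (X n * u)) \<longlonglongrightarrow> u * \<psi>' (y * u)"
        by (intro AE_I2 tendsto_mult tendsto_const isCont_tendsto_compose[OF cont] X)
      show "AE u in N. norm (u * \<psi>' (X n * u)) \<le> \<bar>u\<bar>" for n
        by (intro AE_I2) (simp add: abs_mult bd mult_left_le)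
      show "integrable N (\<lambda>u. \<bar>u\<bar>)" by (intro integrable_abs mom)
    qed measurable
  qed
  show "((\<lambda>y. \<integral>u. \<psi> (y * u) \<partial>N) has_real_derivative (\<integral>u. u * \<psi>' (y * u) \<partial>N)) (at y)"
    unfolding DERIV_def tendsto_at_iff_sequentially comp_def
  proof safe
    fix X :: "nat \<Rightarrow> real" assume X0: "\<forall>i. X i \<in> UNIV - {0}" and X: "X \<longlonglongrightarrow> 0"
    have "(\<lambda>n. \<integral>u. (\<psi> ((y + X n) * u) - \<psi> (y * u)) / X n \<partial>N) \<longlonglongrightarrow> (\<integral>u. u * \<psi>' (y * u) \<partial>N)"
    proof (rule integral_dominated_convergence[where w = "\<lambda>u. \<bar>u\<bar>"])
      show "AE u in N. (\<lambda>n. (\<psi> ((y + X n) * u) - \<psi> (y * u)) / X n) \<longlonglongrightarrow> u * \<psi>' (y * u)"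
      proof (rule AE_I2)
        fix u
        have "((\<lambda>y. \<psi> (y * u)) has_real_derivative \<psi>' (y * u) * u) (at y)"
          by (rule DERIV_chain'[OF _ der]) (auto intro!: derivative_eq_intros)
        then show "(\<lambda>n. (\<psi> ((y + X n) * u) - \<psi> (y * u)) / X n) \<longlonglongrightarrow> u * \<psi>' (y * u)"
          unfolding DERIV_def tendsto_at_iff_sequentially comp_def using X0 X by (simp add: mult.commute)
      qed
      show "AE u in N. norm ((\<psi> ((y + X n) * u) - \<psi> (y * u)) / X n) \<le> \<bar>u\<bar>" for n
      proof (rule AE_I2)
        fix u
        have "\<bar>\<psi> ((y + X n) * u) - \<psi> (y * u)\<bar> \<le> \<bar>(y + X n) * u - y * u\<bar>" by (rule lip)
        also have "\<dots> = \<bar>X n\<bar> * \<bar>u\<bar>" by (simp add: algebra_simps abs_mult)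
        finally show "norm ((\<psi> ((y + X n) * u) - \<psi> (y * u)) / X n) \<le> \<bar>u\<bar>"
          using X0[rule_format, of n] by (simp add: field_simps)
      qed
      show "integrable N (\<lambda>u. \<bar>u\<bar>)" by (intro integrable_abs mom)
    qed measurable
    moreover have "(\<integral>u. (\<psi> ((y + X n) * u) - \<psi> (y * u)) / X n \<partial>N) =
      ((\<integral>u. \<psi> ((y + X n) * u) \<partial>N) - (\<integral>u. \<psi> (y * u) \<partial>N)) / X n" for n
      using i0 by simp
    ultimately show "(\<lambda>n. ((\<integral>u. \<psi> ((y + X n) * u) \<partial>N) - (\<integral>u. \<psi> (y * u) \<partial>N)) / X n)
      \<longlonglongrightarrow> (\<integral>u. u * \<psi>' (y * u) \<partial>N)" by (simp only:)
  qed
qed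

lemma signed_oscillatory_integral:
  fixes \<psi> \<psi>' :: "real \<Rightarrow> real"
  assumes \<eta>: "finite_signed_measure nonneg_borel \<eta>"
    and mom: "(\<integral>\<^sup>+u. ennreal u \<partial>total_variation nonneg_borel \<eta>) < \<infinity>"
    and \<psi>: "\<And>x. (\<psi> has_real_derivative \<psi>' x) (at x)" "\<And>x. isCont \<psi>' x"
      "\<And>x. \<bar>\<psi> x\<bar> \<le> 1" "\<And>x. \<bar>\<psi>' x\<bar> \<le> 1"
  defines "p \<equiv> pos_variation nonneg_borel \<eta>" and "n \<equiv> neg_variation nonneg_borel \<eta>"
  shows "((\<lambda>y. signed_integral nonneg_borel \<eta> (\<lambda>u. \<psi> (y * u))) has_real_derivative
      signed_integral nonneg_borel \<eta> (\<lambda>u. u * \<psi>' (y * u))) (at y)"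
    and "isCont (\<lambda>y. signed_integral nonneg_borel \<eta> (\<lambda>u. u * \<psi>' (y * u))) y"
    and "\<bar>signed_integral nonneg_borel \<eta> (\<lambda>u. \<psi> (y * u))\<bar> \<le> measure p (space p) + measure n (space n)"
    and "\<bar>signed_integral nonneg_borel \<eta> (\<lambda>u. u * \<psi>' (y * u))\<bar> \<le> (\<integral>u. \<bar>u\<bar> \<partial>p) + (\<integral>u. \<bar>u\<bar> \<partial>n)"
proof -
  have p: "finite_measure p" "sets p = sets nonneg_borel" "integrable p (\<lambda>u. u)"
    and n: "finite_measure n" "sets n = sets nonneg_borel" "integrable n (\<lambda>u. u)"
    unfolding p_def n_def
    by (simp_all add: finite_pos_variation finite_neg_variation \<eta> variation_first_moment[OF mom])
  note P = oscillatory_integral_deriv[OF p \<psi>] and N = oscillatory_integral_deriv[OF n \<psi>]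
  show "((\<lambda>y. signed_integral nonneg_borel \<eta> (\<lambda>u. \<psi> (y * u))) has_real_derivative
      signed_integral nonneg_borel \<eta> (\<lambda>u. u * \<psi>' (y * u))) (at y)"
    unfolding signed_integral_def p_def[symmetric] n_def[symmetric] by (intro DERIV_diff P N)
  show "isCont (\<lambda>y. signed_integral nonneg_borel \<eta> (\<lambda>u. u * \<psi>' (y * u))) y"
    unfolding signed_integral_def p_def[symmetric] n_def[symmetric] by (intro continuous_diff P N)
  show "\<bar>signed_integral nonneg_borel \<eta> (\<lambda>u. \<psi> (y * u))\<bar> \<le> measure p (space p) + measure n (space n)"
    unfolding signed_integral_def p_def[symmetric] n_def[symmetric]
    using P(3)[of y] N(3)[of y] by linarith
  show "\<bar>signed_integral nonneg_borel \<eta> (\<lambda>u. u * \<psi>' (y * u))\<bar> \<le> (\<integral>u. \<bar>u\<bar> \<partial>p) + (\<integral>u. \<bar>u\<bar> \<partial>n)"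
    unfolding signed_integral_def p_def[symmetric] n_def[symmetric]
    using P(4)[of y] N(4)[of y] by linarith
qed

lemma signed_integral_const:
  fixes c :: "'b :: {banach, second_countable_topology}"
  assumes \<eta>: "finite_signed_measure M \<eta>"
  shows "signed_integral M \<eta> (\<lambda>_. c) = \<eta> (space M) *\<^sub>R c"
proof -
  interpret p: finite_measure "pos_variation M \<eta>" by (rule finite_pos_variation[OF \<eta>])
  interpret n: finite_measure "neg_variation M \<eta>" by (rule finite_neg_variation[OF \<eta>])
  show ?thesis
    unfolding signed_integral_def Jordan_decomposition[OF \<eta> sets.top]
    by (simp add: scaleR_diff_left)
qed

lemma signed_integral_cis:
  assumes \<eta>: "finite_signed_measure nonneg_borel \<eta>"
  shows "signed_integral nonneg_borel \<eta> (\<lambda>u. exp (\<i> * of_real y * of_real u)) =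
    Complex (signed_integral nonneg_borel \<eta> (\<lambda>u. cos (y * u))) (signed_integral nonneg_borel \<eta> (\<lambda>u. sin (y * u)))"
proof -
  have *: "integral\<^sup>L N (\<lambda>u. exp (\<i> * of_real y * of_real u)) = Complex (\<integral>u. cos (y * u) \<partial>N) (\<integral>u. sin (y * u) \<partial>N)"
    if N: "finite_measure N" "sets N = sets nonneg_borel" for N :: "real measure"
  proof -
    interpret finite_measure N by fact
    have cis: "exp (\<i> * of_real y * of_real u) = cis (y * u)" for u
      by (simp add: cis_conv_exp mult.assoc)
    have "(\<lambda>u. cis (y * u)) \<in> borel_measurable borel"
      unfolding cis_conv_exp by measurable
    then have "(\<lambda>u. cis (y * u)) \<in> borel_measurable N"
      by (subst measurable_cong_sets[OF N(2) refl]) (rule measurable_restrict_space1)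
    then have i: "integrable N (\<lambda>u. cis (y * u))"
      by (intro integrable_const_bound[where B = 1]) auto
    have "Re (\<integral>u. cis (y * u) \<partial>N) = (\<integral>u. cos (y * u) \<partial>N)" "Im (\<integral>u. cis (y * u) \<partial>N) = (\<integral>u. sin (y * u) \<partial>N)"
      using integral_Re[OF i] integral_Im[OF i] by simp_all
    then show ?thesis unfolding cis by (simp add: complex_eq_iff)
  qed
  show ?thesis
    unfolding signed_integral_def
    by (simp add: * finite_pos_variation finite_neg_variation \<eta> complex_eq_iff)
qed

lemma polar_powr_of_real:
  fixes r \<theta> a :: real
  assumes r: "r > 0" and \<theta>: "- pi < \<theta>" "\<theta> \<le> pi"
  shows "(of_real r * cis \<theta>) powr of_real a = of_real (r powr a) * cis (\<theta> * a)"
proof -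
  have polar: "of_real s * cis \<phi> = exp (Complex (ln s) \<phi>)" if "s > 0" for s \<phi>
    using that by (simp add: exp_eq_polar complex_eq_iff)
  have Ln: "Ln (of_real r * cis \<theta>) = Complex (ln r) \<theta>"
    unfolding polar[OF r] by (rule Ln_exp) (use \<theta> in simp_all)
  have "(of_real r * cis \<theta>) powr of_real a = exp (of_real a * Complex (ln r) \<theta>)"
    unfolding powr_def Ln using r by simp
  also have "of_real a * Complex (ln r) \<theta> = Complex (ln (r powr a)) (\<theta> * a)"
    using r by (simp add: complex_eq_iff ln_powr mult.commute)
  also have "exp \<dots> = of_real (r powr a) * cis (\<theta> * a)"
    using r by (intro polar[symmetric]) simp
  finally show ?thesis .
qed

lemma neg_imaginary_powr:
  fixes y a :: real
  shows "(- (\<i> * of_real y)) powr of_real a =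
    of_real (\<bar>y\<bar> powr a) * cis (- (sgn y * a * pi / 2))"
proof (cases "y = 0")
  case False
  define \<theta> where "\<theta> = - (sgn y * pi / 2)"
  have eq: "- (\<i> * of_real y) = of_real \<bar>y\<bar> * cis \<theta>"
    unfolding \<theta>_def using False by (cases "y > 0") (auto simp: complex_eq_iff)
  have "\<theta> = pi / 2 \<or> \<theta> = - (pi / 2)" using False by (auto simp: \<theta>_def sgn_if)
  then have "- pi < \<theta>" "\<theta> \<le> pi" using pi_gt_zero by (elim disjE; linarith)+
  then have "(- (\<i> * of_real y)) powr of_real a = of_real (\<bar>y\<bar> powr a) * cis (\<theta> * a)"
    unfolding eq using False by (intro polar_powr_of_real) auto
  also have "\<theta> * a = - (sgn y * a * pi / 2)" by (simp add: \<theta>_def)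
  finally show ?thesis .
qed simp

text \<open>
  On the imaginary axis \<open>(-iy)\<^bsup>1-\<beta>\<^esup>\<close> has modulus \<open>\<bar>y\<bar>\<^bsup>1-\<beta>\<^esup>\<close> and constant argument on each half line, and
  \<open>h(-iy)\<close> is the complex conjugate of \<open>h(iy)\<close>. Hence \<open>\<bar>h(iy)\<bar>\<^sup>2\<close> is a function of \<open>\<bar>y\<bar>\<close>, and real
  calculus on the half line suffices from here on.
\<close>

lemma h_fun_imaginary_cmod:
  fixes y \<beta> :: real
  assumes \<eta>: "finite_signed_measure nonneg_borel \<eta>"
  defines "a \<equiv> 1 - \<beta>"
  defines "P \<equiv> \<lambda>y. signed_integral nonneg_borel \<eta> (\<lambda>u. cos (y * u))"
    and "Q \<equiv> \<lambda>y. signed_integral nonneg_borel \<eta> (\<lambda>u. sin (y * u))"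
  shows "(cmod (h_fun \<beta> \<eta> (\<i> * of_real y)))\<^sup>2 =
    (cos (a * pi / 2) * \<bar>y\<bar> powr a - P \<bar>y\<bar>)\<^sup>2 + (- sin (a * pi / 2) * \<bar>y\<bar> powr a - Q \<bar>y\<bar>)\<^sup>2"
proof -
  have h: "h_fun \<beta> \<eta> (\<i> * of_real y) =
    Complex (cos (a * pi / 2) * \<bar>y\<bar> powr a - P y) (- sin (sgn y * a * pi / 2) * \<bar>y\<bar> powr a - Q y)"
  proof -
    have "cos (sgn y * a * pi / 2) * \<bar>y\<bar> powr a = cos (a * pi / 2) * \<bar>y\<bar> powr a"
      by (auto simp: sgn_if)
    then show ?thesis
      unfolding h_fun_def signed_integral_cis[OF \<eta>] a_def[symmetric] neg_imaginary_powr
      by (simp add: complex_eq_iff P_def Q_def mult.commute)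
  qed
  show ?thesis
  proof (cases "y \<ge> 0")
    case True
    then show ?thesis unfolding h by (cases "y = 0") (simp_all add: cmod_def)
  next
    case False
    have "P (- y) = P y" unfolding P_def by simp
    moreover have "Q (- y) = - Q y" unfolding Q_def signed_integral_def by simp
    moreover have "(sin (a * pi / 2) * \<bar>y\<bar> powr a - Q y)\<^sup>2 = (- sin (a * pi / 2) * \<bar>y\<bar> powr a + Q y)\<^sup>2"
      by (simp add: power2_eq_square algebra_simps)
    ultimately show ?thesis using False unfolding h by (simp add: cmod_def)
  qed
qed

section \<open>The spectral density near its singularity\<close>

text \<open>
  In the application the square root is \<open>\<bar>h(iy)\<bar>\<close> and \<open>a = 1 - \<beta>\<close>. For large \<open>y\<close> the term \<open>y\<^sup>a\<close> dominates
  the bounded pair \<open>(P, Q)\<close>; on the remaining compact interval a continuous function without zeros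
  attains a positive minimum.
\<close>

lemma denominator_lower_bound:
  fixes a k1 k2 V :: real and P Q :: "real \<Rightarrow> real"
  assumes a: "a > 0" and k: "k1\<^sup>2 + k2\<^sup>2 = 1"
    and P: "continuous_on {0..} P" "\<And>y. \<bar>P y\<bar> \<le> V"
    and Q: "continuous_on {0..} Q" "\<And>y. \<bar>Q y\<bar> \<le> V"
    and nz: "\<And>y. y \<ge> 0 \<Longrightarrow> (k1 * y powr a - P y)\<^sup>2 + (k2 * y powr a - Q y)\<^sup>2 \<noteq> 0"
  obtains c where "c > 0"
    "\<And>y. y \<ge> 0 \<Longrightarrow> c * (1 + y powr a) \<le> sqrt ((k1 * y powr a - P y)\<^sup>2 + (k2 * y powr a - Q y)\<^sup>2)"
proof -
  define S where "S = (\<lambda>y. sqrt ((k1 * y powr a - P y)\<^sup>2 + (k2 * y powr a - Q y)\<^sup>2))"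
  define \<rho> where "\<rho> = (\<lambda>y. S y / (1 + y powr a))"
  have V0: "V \<ge> 0" using order_trans[OF abs_ge_zero P(2)[of 0]] .
  have den: "1 + y powr a > 0" for y by (simp add: add_pos_nonneg)
  have big: "y powr a - 2 * V \<le> S y" for y
  proof -
    let ?z = "Complex (k1 * y powr a) (k2 * y powr a)" and ?w = "Complex (P y) (Q y)"
    have "cmod ?z = sqrt ((y powr a)\<^sup>2 * (k1\<^sup>2 + k2\<^sup>2))"
      by (simp add: cmod_def power_mult_distrib algebra_simps)
    then have "cmod ?z = y powr a" using k by simp
    moreover have "cmod ?w \<le> \<bar>P y\<bar> + \<bar>Q y\<bar>" using cmod_le[of ?w] by simp
    moreover have "S y = cmod (?z - ?w)" by (simp add: S_def cmod_def)
    ultimately show ?thesis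
      using norm_triangle_ineq2[of ?z ?w] P(2)[of y] Q(2)[of y] by simp
  qed
  \<comment> \<open>Beyond \<open>Y\<close> one has \<open>y\<^sup>a \<ge> 8 V + 1\<close>, so \<open>y\<^sup>a - 2 V\<close> is at least a quarter of \<open>1 + y\<^sup>a\<close>.\<close>
  define Y where "Y = (8 * V + 1) powr (1 / a)"
  have large: "1 / 4 \<le> \<rho> y" if "y \<ge> Y" for y
  proof -
    have "8 * V + 1 = Y powr a" using a V0 by (simp add: Y_def powr_powr)
    also have "\<dots> \<le> y powr a" using that a by (intro powr_mono2) (auto simp: Y_def)
    finally have "1 / 4 * (1 + y powr a) \<le> S y" using big[of y] V0 by simp
    then show ?thesis using den[of y] by (simp add: \<rho>_def field_simps)
  qed
  have "continuous_on {0..Y} \<rho>"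
    unfolding \<rho>_def S_def
    using a by (intro continuous_intros continuous_on_powr' continuous_on_subset[OF P(1)] continuous_on_subset[OF Q(1)])
      (auto simp: less_imp_neq[OF den, symmetric])
  then obtain y0 where y0: "y0 \<in> {0..Y}" "\<And>y. y \<in> {0..Y} \<Longrightarrow> \<rho> y0 \<le> \<rho> y"
    using continuous_attains_inf[of "{0..Y}" \<rho>] by (auto simp: Y_def)
  have "S y0 > 0" using nz[of y0] y0(1) by (simp add: S_def sum_power2_gt_zero_iff sum_power2_eq_zero_iff)
  then have pos: "\<rho> y0 > 0" using den by (simp add: \<rho>_def)
  show ?thesis
  proof (rule that[of "min (\<rho> y0) (1 / 4)"])
    show "min (\<rho> y0) (1 / 4) > 0" using pos by simp
    fix y :: real assume y: "y \<ge> 0"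
    have "min (\<rho> y0) (1 / 4) \<le> \<rho> y"
      using y0(2)[of y] large[of y] y by (cases "y \<le> Y") auto
    then have "min (\<rho> y0) (1 / 4) * (1 + y powr a) \<le> S y"
      using den[of y] by (simp add: \<rho>_def pos_le_divide_eq)
    then show "min (\<rho> y0) (1 / 4) * (1 + y powr a) \<le> sqrt ((k1 * y powr a - P y)\<^sup>2 + (k2 * y powr a - Q y)\<^sup>2)"
      by (simp add: S_def)
  qed
qed

text \<open>
  Here \<open>N\<close> plays the role of \<open>\<bar>h(iy)\<bar>\<^sup>2\<close>. The derivative of \<open>y\<^bsup>-2\<beta>\<^esup> / N\<close> equals \<open>y\<^bsup>-2\<beta>-1\<^esup> (-2\<beta>/N - y N'/N\<^sup>2)\<close>, so
  everything rests on \<open>R = y N'/N\<^sup>2\<close> being bounded and vanishing at \<open>0\<close>. Both summands of \<open>N\<close> are squares of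
  quantities bounded by \<open>\<surd>N\<close>, so \<open>\<bar>N'\<bar>\<close> is at most a multiple of \<open>\<surd>N (y\<^bsup>-\<beta>\<^esup> + W)\<close>, and \<open>\<surd>N\<close> is at
  least a multiple of \<open>1 + y\<^bsup>1-\<beta>\<^esup>\<close>; the cube of the latter beats \<open>y\<^bsup>1-\<beta>\<^esup> + W y\<close> since \<open>3 (1 - \<beta>) > 1\<close>.
\<close>

lemma singular_spectrum_derivative:
  fixes \<beta> k1 k2 V W :: real and P Q P' Q' :: "real \<Rightarrow> real"
  assumes \<beta>: "0 < \<beta>" "\<beta> < 1 / 2" and k: "k1\<^sup>2 + k2\<^sup>2 = 1"
    and P: "\<And>y. (P has_real_derivative P' y) (at y)" "\<And>y. isCont P' y" "\<And>y. \<bar>P y\<bar> \<le> V" "\<And>y. \<bar>P' y\<bar> \<le> W"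
    and Q: "\<And>y. (Q has_real_derivative Q' y) (at y)" "\<And>y. isCont Q' y" "\<And>y. \<bar>Q y\<bar> \<le> V" "\<And>y. \<bar>Q' y\<bar> \<le> W"
    and nz: "\<And>y. y \<ge> 0 \<Longrightarrow> (k1 * y powr (1 - \<beta>) - P y)\<^sup>2 + (k2 * y powr (1 - \<beta>) - Q y)\<^sup>2 \<noteq> 0"
  defines "N \<equiv> \<lambda>y. (k1 * y powr (1 - \<beta>) - P y)\<^sup>2 + (k2 * y powr (1 - \<beta>) - Q y)\<^sup>2"
  shows "\<exists>f' C. (\<forall>y>0. ((\<lambda>y. y powr (- (2 * \<beta>)) / N y) has_real_derivative f' y) (at y) \<and> isCont f' y \<and>
      \<bar>y powr (- (2 * \<beta>)) / N y\<bar> \<le> C * y powr (- (2 * \<beta>)) \<and> \<bar>f' y\<bar> \<le> C * y powr (- (2 * \<beta>) - 1)) \<and>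
      ((\<lambda>y. y powr (2 * \<beta> + 1) * f' y) \<longlongrightarrow> - (2 * \<beta>) / ((P 0)\<^sup>2 + (Q 0)\<^sup>2)) (at_right 0)"
    and "(N \<longlongrightarrow> (P 0)\<^sup>2 + (Q 0)\<^sup>2) (at_right 0)"
proof -
  let ?a = "1 - \<beta>"
  have Pc: "isCont P y" and Qc: "isCont Q y" for y using P(1) Q(1) by (auto intro: DERIV_isCont)
  have contP: "continuous_on {0..} P" and contQ: "continuous_on {0..} Q"
    using Pc Qc by (auto intro: continuous_at_imp_continuous_on)
  have W0: "W \<ge> 0" using order_trans[OF abs_ge_zero P(4)[of 0]] .
  obtain c where c: "c > 0" and lower: "\<And>y. y \<ge> 0 \<Longrightarrow> c * (1 + y powr ?a) \<le> sqrt (N y)"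
    using denominator_lower_bound[of ?a k1 k2 P V Q] \<beta> k contP P(3) contQ Q(3) nz unfolding N_def by auto
  have den1: "1 \<le> 1 + y powr ?a" for y by simp
  have Npos: "N y > 0" if "y \<ge> 0" for y
    using nz[OF that] unfolding N_def by (simp add: sum_power2_gt_zero_iff sum_power2_eq_zero_iff)
  define p where "p y = k1 * y powr ?a - P y" for y
  define q where "q y = k2 * y powr ?a - Q y" for y
  define p' where "p' y = k1 * (?a * y powr (- \<beta>)) - P' y" for y
  define q' where "q' y = k2 * (?a * y powr (- \<beta>)) - Q' y" for y
  define N' where "N' y = 2 * (p y * p' y) + 2 * (q y * q' y)" for y
  define f' where "f' y = - (2 * \<beta>) * y powr (- (2 * \<beta>) - 1) / N y - y powr (- (2 * \<beta>)) * N' y / (N y)\<^sup>2" for y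
  have N_eq: "N y = (p y)\<^sup>2 + (q y)\<^sup>2" for y by (simp add: N_def p_def q_def)
  have pow: "((\<lambda>y. y powr ?a) has_real_derivative ?a * y powr (- \<beta>)) (at y)" if "y > 0" for y
    using has_real_derivative_powr[OF that, of ?a] by simp
  have dp: "(p has_real_derivative p' y) (at y)" and dq: "(q has_real_derivative q' y) (at y)" if "y > 0" for y
    unfolding p_def[abs_def] q_def[abs_def] p'_def q'_def
    by (intro DERIV_diff DERIV_cmult pow that P(1) Q(1))+
  have dN: "(N has_real_derivative N' y) (at y)" if "y > 0" for y
    unfolding N_eq[abs_def] N'_def
    by (auto intro!: derivative_eq_intros dp dq that)
  have df: "((\<lambda>y. y powr (- (2 * \<beta>)) / N y) has_real_derivative f' y) (at y)" if y: "y > 0" for y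
  proof -
    have "((\<lambda>y. y powr (- (2 * \<beta>)) / N y) has_real_derivative
       ((- (2 * \<beta>) * y powr (- (2 * \<beta>) - 1)) * N y - y powr (- (2 * \<beta>)) * N' y) / (N y * N y)) (at y)"
      using Npos[of y] y by (intro DERIV_divide has_real_derivative_powr dN) auto
    also have "((- (2 * \<beta>) * y powr (- (2 * \<beta>) - 1)) * N y - y powr (- (2 * \<beta>)) * N' y) / (N y * N y) = f' y"
      using Npos[of y] y by (simp add: f'_def diff_divide_distrib power2_eq_square)
    finally show ?thesis .
  qed
  have cont': "isCont f' y" if y: "y > 0" for y
  proof -
    have "isCont p y" "isCont q y" "isCont N y" using dp dq dN y by (auto intro: DERIV_isCont)
    moreover have "isCont p' y" "isCont q' y"
      unfolding p'_def[abs_def] q'_def[abs_def] using y by (intro continuous_intros P(2) Q(2); simp)+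
    ultimately show ?thesis unfolding f'_def[abs_def] N'_def[abs_def]
      using y Npos[of y] by (intro continuous_intros) auto
  qed
  have "k1\<^sup>2 \<le> 1" "k2\<^sup>2 \<le> 1"
    using k zero_le_power2[of k1] zero_le_power2[of k2] by linarith+
  then have k1: "\<bar>k1\<bar> \<le> 1" "\<bar>k2\<bar> \<le> 1" by (simp_all only: abs_square_le_1)
  have p'_le: "\<bar>p' y\<bar> \<le> y powr (- \<beta>) + W" and q'_le: "\<bar>q' y\<bar> \<le> y powr (- \<beta>) + W" for y
  proof -
    have *: "\<bar>k * (?a * y powr (- \<beta>))\<bar> \<le> y powr (- \<beta>)" if "\<bar>k\<bar> \<le> 1" for k
    proof -
      have "\<bar>k\<bar> * (?a * y powr (- \<beta>)) \<le> 1 * (1 * y powr (- \<beta>))"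
        using that \<beta> by (intro mult_mono) auto
      then show ?thesis using \<beta> by (simp add: abs_mult)
    qed
    show "\<bar>p' y\<bar> \<le> y powr (- \<beta>) + W" "\<bar>q' y\<bar> \<le> y powr (- \<beta>) + W"
      using *[OF k1(1)] *[OF k1(2)] P(4)[of y] Q(4)[of y] unfolding p'_def q'_def by linarith+
  qed
  have pS: "\<bar>p y\<bar> \<le> sqrt (N y)" and qS: "\<bar>q y\<bar> \<le> sqrt (N y)" for y
    unfolding N_eq by (auto intro!: real_le_rsqrt)
  have N'_le: "\<bar>N' y\<bar> \<le> 4 * (sqrt (N y) * (y powr (- \<beta>) + W))" for y
  proof -
    have "\<bar>p y * p' y\<bar> \<le> sqrt (N y) * (y powr (- \<beta>) + W)" "\<bar>q y * q' y\<bar> \<le> sqrt (N y) * (y powr (- \<beta>) + W)"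
      unfolding abs_mult by (intro mult_mono pS p'_le qS q'_le; simp add: N_eq)+
    then show ?thesis unfolding N'_def by linarith
  qed
  define R where "R y = y * N' y / (N y)\<^sup>2" for y
  have R_le: "\<bar>R y\<bar> \<le> 4 * (y powr ?a + W * y) / (c * (1 + y powr ?a)) ^ 3" if y: "y > 0" for y
  proof -
    have d0: "0 < 1 + y powr ?a" using den1[of y] by linarith
    have S: "sqrt (N y) > 0" using Npos[of y] y by simp
    have N2: "sqrt (N y) * sqrt (N y) ^ 3 = (N y)\<^sup>2"
      using Npos[of y] y by (simp add: power2_eq_square power3_eq_cube)
    have "\<bar>R y\<bar> = y * \<bar>N' y\<bar> / (sqrt (N y) * sqrt (N y) ^ 3)"
      using y unfolding R_def N2 by (simp add: abs_mult)
    also have "\<dots> \<le> y * (4 * (sqrt (N y) * (y powr (- \<beta>) + W))) / (sqrt (N y) * sqrt (N y) ^ 3)"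
      using y S by (intro divide_right_mono mult_left_mono N'_le) auto
    also have "\<dots> = 4 * (y * y powr (- \<beta>) + W * y) / sqrt (N y) ^ 3"
      using S by (simp add: field_simps)
    also have "y * y powr (- \<beta>) = y powr ?a" using y by (simp add: powr_diff powr_minus divide_inverse)
    also have "4 * (y powr ?a + W * y) / sqrt (N y) ^ 3 \<le> 4 * (y powr ?a + W * y) / (c * (1 + y powr ?a)) ^ 3"
      using y W0 c d0 S lower[of y]
      by (intro divide_left_mono power_mono mult_pos_pos zero_less_power) auto
    finally show ?thesis .
  qed
  have R_bd: "\<bar>R y\<bar> \<le> 4 * (1 + W) / c ^ 3" if y: "y > 0" for y
  proof -
    let ?D = "(1 + y powr ?a) ^ 3"
    have D: "?D > 0" by (intro zero_less_power add_pos_nonneg) auto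
    have "y powr ?a \<le> (1 + y powr ?a) ^ 1" by simp
    also have "\<dots> \<le> ?D" by (rule power_increasing) auto
    finally have 1: "y powr ?a \<le> ?D" .
    have 2: "y \<le> ?D"
    proof (cases "y \<le> 1")
      case True
      have "1 \<le> ?D" using den1[of y] by (rule one_le_power)
      with True show ?thesis by (rule order_trans)
    next
      case False
      have "y = y powr 1" using y by simp
      also have "\<dots> \<le> y powr (?a * 3)" using False \<beta> by (intro powr_mono) auto
      also have "\<dots> = (y powr ?a) powr 3" by (rule powr_powr[symmetric])
      also have "\<dots> = (y powr ?a) ^ 3" using y by (intro powr_numeral) simp
      also have "\<dots> \<le> ?D" by (intro power_mono) auto
      finally show ?thesis .
    qed
    have "4 * (y powr ?a + W * y) / (c * (1 + y powr ?a)) ^ 3 \<le> 4 * (?D + W * ?D) / (c * (1 + y powr ?a)) ^ 3"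
      using c 1 2 W0 by (intro divide_right_mono mult_left_mono add_mono) auto
    also have "\<dots> = 4 * (1 + W) * ?D / (c ^ 3 * ?D)" 
    proof -
      have "?D + W * ?D = (1 + W) * ?D" by (simp only: distrib_right mult_1)
      then show ?thesis by (simp only: power_mult_distrib mult.assoc)
    qed
    also have "\<dots> = 4 * (1 + W) / c ^ 3" using D by simp
    finally show ?thesis using R_le[OF y] by simp
  qed
  have f'_eq: "f' y = y powr (- (2 * \<beta>) - 1) * (- (2 * \<beta>) / N y - R y)" if y: "y > 0" for y
  proof -
    have "y powr (- (2 * \<beta>)) = y powr (- (2 * \<beta>) - 1) * y"
      using y by (simp add: powr_diff)
    then show ?thesis unfolding f'_def R_def by (simp add: algebra_simps)
  qed
  have N_low: "1 / N y \<le> 1 / c\<^sup>2" if y: "y > 0" for y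
  proof -
    have "c * 1 \<le> c * (1 + y powr ?a)" using c by (intro mult_left_mono) auto
    also have "\<dots> \<le> sqrt (N y)" using lower[of y] y by simp
    finally have "c\<^sup>2 \<le> (sqrt (N y))\<^sup>2" using c by (intro power_mono) auto
    then have "c\<^sup>2 \<le> N y" using Npos[of y] y by simp
    then show ?thesis using c by (intro divide_left_mono) (auto intro!: mult_pos_pos Npos simp: y less_imp_le)
  qed
  define C where "C = 1 / c\<^sup>2 + 4 * (1 + W) / c ^ 3"
  have bf: "\<bar>y powr (- (2 * \<beta>)) / N y\<bar> \<le> C * y powr (- (2 * \<beta>))" if y: "y > 0" for y
  proof -
    have "0 \<le> 4 * (1 + W) / c ^ 3" using c W0 by simp
    then have "1 / N y \<le> C" using N_low[OF y] by (simp add: C_def)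
    then have "1 / N y * y powr (- (2 * \<beta>)) \<le> C * y powr (- (2 * \<beta>))" by (intro mult_right_mono) auto
    then show ?thesis using Npos[of y] y by simp
  qed
  have bf': "\<bar>f' y\<bar> \<le> C * y powr (- (2 * \<beta>) - 1)" if y: "y > 0" for y
  proof -
    have "2 * \<beta> * (1 / N y) \<le> 1 * (1 / c\<^sup>2)"
      using \<beta> Npos[of y] y by (intro mult_mono N_low) auto
    then have "\<bar>- (2 * \<beta>) / N y - R y\<bar> \<le> C"
      using R_bd[OF y] \<beta> Npos[of y] y abs_triangle_ineq4[of "- (2 * \<beta>) / N y" "R y"] by (simp add: C_def)
    then have "y powr (- (2 * \<beta>) - 1) * \<bar>- (2 * \<beta>) / N y - R y\<bar> \<le> y powr (- (2 * \<beta>) - 1) * C"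
      by (intro mult_left_mono) auto
    then show ?thesis unfolding f'_eq[OF y] by (simp add: abs_mult mult.commute)
  qed
  have pow0: "((\<lambda>y. y powr ?a) \<longlongrightarrow> 0) (at_right 0)"
    using \<beta> by (intro tendsto_zero_powrI[where b = ?a] tendsto_ident_at tendsto_const)
      (auto intro: eventually_at_right_less[THEN eventually_mono])
  have P0: "(P \<longlongrightarrow> P 0) (at_right 0)" and Q0: "(Q \<longlongrightarrow> Q 0) (at_right 0)"
    using Pc[of 0] Qc[of 0] by (auto simp: isCont_def intro: tendsto_mono[OF at_le])
  have "(N \<longlongrightarrow> (k1 * 0 - P 0)\<^sup>2 + (k2 * 0 - Q 0)\<^sup>2) (at_right 0)"
    unfolding N_def by (intro tendsto_intros pow0 P0 Q0)
  then show N0: "(N \<longlongrightarrow> (P 0)\<^sup>2 + (Q 0)\<^sup>2) (at_right 0)" by simp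
  have N0nz: "(P 0)\<^sup>2 + (Q 0)\<^sup>2 \<noteq> 0" using nz[of 0] \<beta> by simp
  have R0: "(R \<longlongrightarrow> 0) (at_right 0)"
  proof (rule Lim_null_comparison)
    have "((\<lambda>y. 4 * (y powr ?a + W * y) / (c * (1 + y powr ?a)) ^ 3) \<longlongrightarrow> 4 * (0 + W * 0) / (c * (1 + 0)) ^ 3) (at_right 0)"
      using c by (intro tendsto_intros pow0) auto
    then show "((\<lambda>y. 4 * (y powr ?a + W * y) / (c * (1 + y powr ?a)) ^ 3) \<longlongrightarrow> 0) (at_right 0)" by simp
    show "\<forall>\<^sub>F y in at_right 0. norm (R y) \<le> 4 * (y powr ?a + W * y) / (c * (1 + y powr ?a)) ^ 3"
      using eventually_at_right_less by eventually_elim (use R_le in simp)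
  qed
  have "((\<lambda>y. - (2 * \<beta>) / N y - R y) \<longlongrightarrow> - (2 * \<beta>) / ((P 0)\<^sup>2 + (Q 0)\<^sup>2) - 0) (at_right 0)"
    by (intro tendsto_intros N0 R0 N0nz)
  moreover have "\<forall>\<^sub>F y in at_right 0. - (2 * \<beta>) / N y - R y = y powr (2 * \<beta> + 1) * f' y"
    using eventually_at_right_less
  proof eventually_elim
    case (elim y)
    have "y powr (2 * \<beta> + 1) * y powr (- (2 * \<beta>) - 1) = 1" using elim by (simp add: powr_add[symmetric])
    then show ?case unfolding f'_eq[OF elim] by (simp add: mult.assoc[symmetric])
  qed
  ultimately have "((\<lambda>y. y powr (2 * \<beta> + 1) * f' y) \<longlongrightarrow> - (2 * \<beta>) / ((P 0)\<^sup>2 + (Q 0)\<^sup>2)) (at_right 0)"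
    by (simp add: Lim_transform_eventually)
  then show "\<exists>f' C. (\<forall>y>0. ((\<lambda>y. y powr (- (2 * \<beta>)) / N y) has_real_derivative f' y) (at y) \<and> isCont f' y \<and>
      \<bar>y powr (- (2 * \<beta>)) / N y\<bar> \<le> C * y powr (- (2 * \<beta>)) \<and> \<bar>f' y\<bar> \<le> C * y powr (- (2 * \<beta>) - 1)) \<and>
      ((\<lambda>y. y powr (2 * \<beta> + 1) * f' y) \<longlongrightarrow> - (2 * \<beta>) / ((P 0)\<^sup>2 + (Q 0)\<^sup>2)) (at_right 0)"
    by (intro exI[of _ f'] exI[of _ C]) (use df cont' bf bf' in blast)
qed

section \<open>Cosine transforms of functions with a power singularity at the origin\<close>

lemma powr_antiderivative:
  fixes p x :: real
  assumes "x > 0" "p \<noteq> -1"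
  shows "((\<lambda>x. x powr (p + 1) / (p + 1)) has_real_derivative x powr p) (at x)"
proof -
  have "((\<lambda>x. x powr (p + 1) / (p + 1)) has_real_derivative (p + 1) * x powr (p + 1 - 1) / (p + 1)) (at x)"
    using assms by (intro DERIV_cdivide has_real_derivative_powr)
  then show ?thesis using assms by (simp add: add_eq_0_iff)
qed

lemma set_integrable_powr_0_1:
  fixes p :: real
  assumes p: "p > -1"
  shows "set_integrable lborel {0<..<1} (\<lambda>x. x powr p)"
proof -
  let ?F = "\<lambda>x::real. x powr (p + 1) / (p + 1)"
  have "set_integrable lborel (einterval (ereal 0) (ereal 1)) (\<lambda>x. x powr p)"
  proof (rule interval_integral_FTC_nonneg)
    show "((?F \<circ> real_of_ereal) \<longlongrightarrow> 0) (at_right (ereal 0))"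
      unfolding ereal_tendsto_simps using p
      by (intro tendsto_divide_zero tendsto_zero_powrI[where b = "p + 1"] tendsto_ident_at tendsto_const) (auto intro: eventually_at_right_less[THEN eventually_mono])
    show "((?F \<circ> real_of_ereal) \<longlongrightarrow> 1 powr (p + 1) / (p + 1)) (at_left (ereal 1))"
      unfolding ereal_tendsto_simps using p by (intro tendsto_intros) auto
  qed (use p in \<open>auto intro!: powr_antiderivative continuous_intros\<close>)
  then show ?thesis by simp
qed

lemma set_integrable_powr_1_infty:
  fixes p :: real
  assumes p: "p < -1"
  shows "set_integrable lborel {1<..} (\<lambda>x. x powr p)"
proof -
  let ?F = "\<lambda>x::real. x powr (p + 1) / (p + 1)"
  have "set_integrable lborel (einterval (ereal 1) \<infinity>) (\<lambda>x. x powr p)"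
  proof (rule interval_integral_FTC_nonneg)
    show "((?F \<circ> real_of_ereal) \<longlongrightarrow> 1 powr (p + 1) / (p + 1)) (at_right (ereal 1))"
      unfolding ereal_tendsto_simps using p by (intro tendsto_intros) auto
    show "((?F \<circ> real_of_ereal) \<longlongrightarrow> 0) (at_left \<infinity>)"
      unfolding ereal_tendsto_simps using p
      by (intro tendsto_divide_zero tendsto_neg_powr filterlim_ident) auto
  qed (use p in \<open>auto intro!: powr_antiderivative continuous_intros\<close>)
  then show ?thesis by simp
qed

text \<open>
  At the origin \<open>\<bar>sin x\<bar> \<le> x\<close> gains one power and leaves \<open>x\<^bsup>-s\<^esup>\<close>, integrable because \<open>s < 1\<close>; at infinity
  \<open>x\<^bsup>-s-1\<^esup>\<close> is integrable because \<open>s > 0\<close>.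
\<close>

lemma set_integrable_sin_powr:
  fixes s :: real
  assumes s: "0 < s" "s < 1"
  shows "set_integrable lborel {0<..} (\<lambda>x. sin x * x powr (- s - 1))"
proof -
  have m: "(\<lambda>x::real. sin x * x powr (- s - 1)) \<in> borel_measurable borel" by measurable
  have 1: "set_integrable lborel {0<..<1} (\<lambda>x. sin x * x powr (- s - 1))"
  proof (rule set_integrable_bound[OF set_integrable_powr_0_1[of "- s"]])
    show "AE x in lborel. x \<in> {0<..<1} \<longrightarrow> norm (sin x * x powr (- s - 1)) \<le> norm (x powr (- s))"
    proof (intro AE_I2 impI)
      fix x :: real assume "x \<in> {0<..<1}"
      then have x: "x > 0" by simp
      have "\<bar>sin x\<bar> * x powr (- s - 1) \<le> x * x powr (- s - 1)"
        using abs_sin_x_le_abs_x[of x] x by (intro mult_right_mono) auto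
      also have "\<dots> = x powr (- s)" using x by (simp add: powr_diff)
      finally show "norm (sin x * x powr (- s - 1)) \<le> norm (x powr (- s))"
        by (simp add: abs_mult)
    qed
  qed (use s m in \<open>auto simp: set_borel_measurable_def\<close>)
  have 2: "set_integrable lborel {1<..} (\<lambda>x. sin x * x powr (- s - 1))"
  proof (rule set_integrable_bound[OF set_integrable_powr_1_infty[of "- s - 1"]])
    show "AE x in lborel. x \<in> {1<..} \<longrightarrow> norm (sin x * x powr (- s - 1)) \<le> norm (x powr (- s - 1))"
      by (intro AE_I2 impI) (simp add: abs_mult mult_left_le_one_le)
  qed (use s m in \<open>auto simp: set_borel_measurable_def\<close>)
  have 3: "set_integrable lborel {1::real} (\<lambda>x. sin x * x powr (- s - 1))"
  proof -
    have "(\<lambda>x. indicator {1::real} x *\<^sub>R (sin x * x powr (- s - 1))) = (\<lambda>x. indicator {1} x *\<^sub>R sin 1)"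
      by (auto simp: indicator_def)
    then show ?thesis by (simp add: set_integrable_def)
  qed
  have "set_integrable lborel ({0<..<1} \<union> {1} \<union> {1<..}) (\<lambda>x::real. sin x * x powr (- s - 1))"
    by (intro set_integrable_Un 1 2 3) auto
  also have "{0<..<1} \<union> {1} \<union> {1<..} = {0::real<..}" by auto
  finally show ?thesis .
qed

text \<open>
  The boundary terms \<open>sin(ty) f(y)\<close> vanish at \<open>0\<close> because \<open>\<bar>sin(ty)\<bar> \<le> ty\<close> compensates the singularity
  \<open>y\<^bsup>-s\<^esup>\<close>, and at infinity because \<open>y\<^bsup>-s\<^esup>\<close> tends to \<open>0\<close>.
\<close>

lemma cos_integral_by_parts:
  fixes f f' :: "real \<Rightarrow> real" and s t :: real
  assumes s: "0 < s" "s < 1" and t: "t > 0"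
    and int: "set_integrable lborel {0<..} f"
    and der: "\<And>y. y > 0 \<Longrightarrow> (f has_real_derivative f' y) (at y)"
    and cont: "\<And>y. y > 0 \<Longrightarrow> isCont f' y"
    and bf: "\<And>y. y > 0 \<Longrightarrow> \<bar>f y\<bar> \<le> C * y powr (- s)"
    and bf': "\<And>y. y > 0 \<Longrightarrow> \<bar>f' y\<bar> \<le> C * y powr (- s - 1)"
  shows "set_integrable lborel {0<..} (\<lambda>y. sin (t * y) * f' y)"
    and "t * (LBINT y:{0<..}. cos (t * y) * f y) = - (LBINT y:{0<..}. sin (t * y) * f' y)"
proof -
  have f'm: "set_borel_measurable lborel {0<..} f'"
  proof -
    have "(\<lambda>y. indicator {0<..} y *\<^sub>R f' y) \<in> borel_measurable borel"
      by (intro borel_measurable_continuous_on_indicator continuous_at_imp_continuous_on ballI cont) auto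
    then show ?thesis by (simp add: set_borel_measurable_def)
  qed
  have fm: "set_borel_measurable lborel {0<..} f"
    using int by (simp add: set_borel_measurable_def set_integrable_def borel_measurable_integrable)
  have sc: "set_integrable lborel {0<..} (\<lambda>y. sin (t * y) * (t * y) powr (- s - 1))"
  proof -
    have "integrable lborel (\<lambda>y. indicator {0<..} (0 + t * y) *\<^sub>R (sin (0 + t * y) * (0 + t * y) powr (- s - 1)))"
      using set_integrable_sin_powr[OF s] t unfolding set_integrable_def
      by (intro lborel_integrable_real_affine) auto
    also have "(\<lambda>y. indicator {0<..} (0 + t * y)) = (indicator {0<..} :: real \<Rightarrow> real)"
      using t by (auto simp: indicator_def fun_eq_iff zero_less_mult_iff)
    finally show ?thesis
      unfolding set_integrable_def by simp
  qed
  show i': "set_integrable lborel {0<..} (\<lambda>y. sin (t * y) * f' y)"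
  proof (rule set_integrable_bound)
    show "set_integrable lborel {0<..} (\<lambda>y. C * t powr (s + 1) * (sin (t * y) * (t * y) powr (- s - 1)))"
      using sc by simp
    show "set_borel_measurable lborel {0<..} (\<lambda>y. sin (t * y) * f' y)"
    proof -
      have "(\<lambda>y. sin (t * y) * (indicator {0<..} y *\<^sub>R f' y)) \<in> borel_measurable lborel"
        using f'm unfolding set_borel_measurable_def by measurable
      then show ?thesis by (simp add: set_borel_measurable_def mult_ac)
    qed
    show "AE y in lborel. y \<in> {0<..} \<longrightarrow> norm (sin (t * y) * f' y) \<le>
       norm (C * t powr (s + 1) * (sin (t * y) * (t * y) powr (- s - 1)))"
    proof (intro AE_I2 impI)
      fix y :: real assume "y \<in> {0<..}"
      then have y: "y > 0" by simp
      have "t powr (s + 1) * (t * y) powr (- s - 1) = y powr (- s - 1)"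
        using t y by (simp add: powr_mult powr_add[symmetric])
      moreover have "norm (C * t powr (s + 1) * (sin (t * y) * (t * y) powr (- s - 1))) =
         \<bar>C\<bar> * \<bar>sin (t * y)\<bar> * (t powr (s + 1) * (t * y) powr (- s - 1))"
        by (simp add: abs_mult mult_ac)
      ultimately have nb: "norm (C * t powr (s + 1) * (sin (t * y) * (t * y) powr (- s - 1))) =
         \<bar>C\<bar> * \<bar>sin (t * y)\<bar> * y powr (- s - 1)"
        by (simp only:)
      have "\<bar>f' y\<bar> \<le> \<bar>C\<bar> * y powr (- s - 1)"
        by (rule order_trans[OF bf'[OF y]]) (simp add: mult_right_mono)
      then have "\<bar>sin (t * y)\<bar> * \<bar>f' y\<bar> \<le> \<bar>sin (t * y)\<bar> * (\<bar>C\<bar> * y powr (- s - 1))"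
        by (intro mult_left_mono) auto
      then show "norm (sin (t * y) * f' y) \<le>
         norm (C * t powr (s + 1) * (sin (t * y) * (t * y) powr (- s - 1)))"
        unfolding nb by (simp add: abs_mult mult_ac)
    qed
  qed
  have i: "set_integrable lborel {0<..} (\<lambda>y. cos (t * y) * f y)"
  proof (rule set_integrable_bound[OF int])
    have "(\<lambda>y. cos (t * y) * (indicator {0<..} y *\<^sub>R f y)) \<in> borel_measurable lborel"
      using fm unfolding set_borel_measurable_def by measurable
    then show "set_borel_measurable lborel {0<..} (\<lambda>y. cos (t * y) * f y)"
      by (simp add: set_borel_measurable_def mult_ac)
  qed (auto simp: abs_mult mult_left_le_one_le)
  let ?G = "\<lambda>y. t * (cos (t * y) * f y) + sin (t * y) * f' y"
  have iG: "set_integrable lborel {0<..} ?G"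
    using i i' by (intro set_integral_add set_integrable_mult_right) auto
  have fc: "isCont f y" if "y > 0" for y using der[OF that] by (rule DERIV_isCont)
  have "(LBINT y=ereal 0..\<infinity>. ?G y) = 0 - 0"
  proof (rule interval_integral_FTC_integrable[where F = "\<lambda>y. sin (t * y) * f y"])
    fix x assume "ereal 0 < ereal x" "ereal x < \<infinity>"
    then have x: "x > 0" by simp
    have "((\<lambda>y. sin (t * y) * f y) has_real_derivative ?G x) (at x)"
      by (auto intro!: derivative_eq_intros der x)
    then show "((\<lambda>y. sin (t * y) * f y) has_vector_derivative ?G x) (at x)"
      by (simp add: has_real_derivative_iff_has_vector_derivative)
    show "isCont ?G x"
      using fc[OF x] cont[OF x] by (intro continuous_intros) auto
  next
    show "set_integrable lborel (einterval (ereal 0) \<infinity>) ?G" using iG by simp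
    show "(((\<lambda>y. sin (t * y) * f y) \<circ> real_of_ereal) \<longlongrightarrow> 0) (at_right (ereal 0))"
      unfolding ereal_tendsto_simps
    proof (rule Lim_null_comparison)
      have "((\<lambda>y. t * \<bar>C\<bar> * y powr (1 - s)) \<longlongrightarrow> t * \<bar>C\<bar> * 0) (at_right 0)"
        using s by (intro tendsto_mult tendsto_const tendsto_zero_powrI[where b = "1 - s"] tendsto_ident_at)
          (auto intro: eventually_at_right_less[THEN eventually_mono])
      then show "((\<lambda>y. t * \<bar>C\<bar> * y powr (1 - s)) \<longlongrightarrow> 0) (at_right 0)" by simp
      show "\<forall>\<^sub>F y in at_right 0. norm (sin (t * y) * f y) \<le> t * \<bar>C\<bar> * y powr (1 - s)"
        using eventually_at_right_less
      proof eventually_elim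
        case (elim y)
        have "\<bar>f y\<bar> \<le> \<bar>C\<bar> * y powr (- s)"
          by (rule order_trans[OF bf[OF elim]]) (simp add: mult_right_mono)
        moreover have "\<bar>sin (t * y)\<bar> \<le> t * y"
          using abs_sin_x_le_abs_x[of "t * y"] t elim by (simp add: abs_mult)
        ultimately have "\<bar>sin (t * y)\<bar> * \<bar>f y\<bar> \<le> (t * y) * (\<bar>C\<bar> * y powr (- s))"
          using t elim by (intro mult_mono) auto
        also have "\<dots> = t * \<bar>C\<bar> * y powr (1 - s)" using elim by (simp add: powr_diff powr_minus field_simps)
        finally show ?case by (simp add: abs_mult)
      qed
    qed
    show "(((\<lambda>y. sin (t * y) * f y) \<circ> real_of_ereal) \<longlongrightarrow> 0) (at_left \<infinity>)"
      unfolding ereal_tendsto_simps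
    proof (rule Lim_null_comparison)
      have "((\<lambda>y. \<bar>C\<bar> * y powr (- s)) \<longlongrightarrow> \<bar>C\<bar> * 0) at_top"
        using s by (intro tendsto_mult tendsto_const tendsto_neg_powr filterlim_ident) auto
      then show "((\<lambda>y. \<bar>C\<bar> * y powr (- s)) \<longlongrightarrow> 0) at_top" by simp
      show "\<forall>\<^sub>F y in at_top. norm (sin (t * y) * f y) \<le> \<bar>C\<bar> * y powr (- s)"
        using eventually_gt_at_top[of 0]
      proof eventually_elim
        case (elim y)
        have "\<bar>f y\<bar> \<le> \<bar>C\<bar> * y powr (- s)"
          by (rule order_trans[OF bf[OF elim]]) (simp add: mult_right_mono)
        then have "\<bar>sin (t * y)\<bar> * \<bar>f y\<bar> \<le> 1 * (\<bar>C\<bar> * y powr (- s))"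
          by (intro mult_mono) auto
        then show ?case by (simp add: abs_mult)
      qed
    qed
  qed simp
  then have "(LBINT y:{0<..}. ?G y) = 0"
    by (simp add: interval_lebesgue_integral_0_infty flip: zero_ereal_def)
  also have "(LBINT y:{0<..}. ?G y) = t * (LBINT y:{0<..}. cos (t * y) * f y) + (LBINT y:{0<..}. sin (t * y) * f' y)"
    using i i' by (subst set_integral_add) auto
  finally show "t * (LBINT y:{0<..}. cos (t * y) * f y) = - (LBINT y:{0<..}. sin (t * y) * f' y)"
    by linarith
qed

text \<open>
  After integration by parts and the substitution \<open>y = x/t\<close> the parameter enters only through
  \<open>(x/t)\<^bsup>s+1\<^esup> f'(x/t)\<close>, which is bounded by \<open>C\<close> and tends to \<open>l\<close>; dominated convergence with majorant
  \<open>\<bar>C\<bar> \<bar>sin x\<bar> x\<^bsup>-s-1\<^esup>\<close> finishes the proof.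
\<close>

lemma cos_transform_asymptotics:
  fixes f f' :: "real \<Rightarrow> real" and s :: real
  assumes s: "0 < s" "s < 1"
    and int: "set_integrable lborel {0<..} f"
    and der: "\<And>y. y > 0 \<Longrightarrow> (f has_real_derivative f' y) (at y)"
    and cont: "\<And>y. y > 0 \<Longrightarrow> isCont f' y"
    and bf: "\<And>y. y > 0 \<Longrightarrow> \<bar>f y\<bar> \<le> C * y powr (- s)"
    and bf': "\<And>y. y > 0 \<Longrightarrow> \<bar>f' y\<bar> \<le> C * y powr (- s - 1)"
    and lim: "((\<lambda>y. y powr (s + 1) * f' y) \<longlongrightarrow> l) (at_right 0)"
  shows "((\<lambda>t. t powr (1 - s) * (LBINT y:{0<..}. cos (t * y) * f y)) \<longlongrightarrow>
     - l * (LBINT x:{0<..}. sin x * x powr (- s - 1))) at_top"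
proof -
  let ?h = "\<lambda>t x. indicator {0<..} x *\<^sub>R ((sin x * x powr (- s - 1)) * ((x / t) powr (s + 1) * f' (x / t)))"
  have eq: "t powr (1 - s) * (LBINT y:{0<..}. cos (t * y) * f y) = - (LBINT x. ?h t x)" if t: "t > 0" for t
  proof -
    have "(LBINT y:{0<..}. sin (t * y) * f' y) =
      \<bar>1 / t\<bar> *\<^sub>R (LBINT x. indicator {0<..} (0 + 1 / t * x) *\<^sub>R (sin (t * (0 + 1 / t * x)) * f' (0 + 1 / t * x)))"
      unfolding set_lebesgue_integral_def using t by (intro lborel_integral_real_affine) auto
    also have "(LBINT x. indicator {0<..} (0 + 1 / t * x) *\<^sub>R (sin (t * (0 + 1 / t * x)) * f' (0 + 1 / t * x))) =
      (LBINT x. t powr (1 + s) * ?h t x)"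
    proof (rule Bochner_Integration.integral_cong)
      fix x
      show "indicator {0<..} (0 + 1 / t * x) *\<^sub>R (sin (t * (0 + 1 / t * x)) * f' (0 + 1 / t * x)) =
        t powr (1 + s) * ?h t x"
      proof (cases "x > 0")
        case True
        have "t powr (1 + s) * x powr (- s - 1) * (x / t) powr (s + 1) = 1"
          using True t by (simp add: powr_divide powr_add powr_diff powr_minus field_simps)
        then show ?thesis using True t by (simp add: mult_ac)
      qed (use t in \<open>simp add: indicator_def field_simps\<close>)
    qed simp
    finally have "(LBINT y:{0<..}. sin (t * y) * f' y) = 1 / t * t powr (1 + s) * (LBINT x. ?h t x)"
      using t by simp
    then have "t * (LBINT y:{0<..}. cos (t * y) * f y) = - (1 / t * t powr (1 + s) * (LBINT x. ?h t x))"
      using cos_integral_by_parts(2)[OF s t int der cont bf bf'] by simp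
    then have "t powr (1 - s) / t * (t * (LBINT y:{0<..}. cos (t * y) * f y)) =
      t powr (1 - s) / t * - (1 / t * t powr (1 + s) * (LBINT x. ?h t x))" by (simp only:)
    then have "t powr (1 - s) * (LBINT y:{0<..}. cos (t * y) * f y) =
       - (t powr (1 - s) * (1 / t * 1 / t * t powr (1 + s)) * (LBINT x. ?h t x))"
      using t by simp
    also have "t powr (1 - s) * (1 / t * 1 / t * t powr (1 + s)) = 1"
      using t by (simp add: powr_add powr_diff field_simps)
    finally show ?thesis by simp
  qed
  have hm: "?h t \<in> borel_measurable lborel" if "t > 0" for t
  proof -
    have "continuous_on {0<..} (\<lambda>x. (sin x * x powr (- s - 1)) * ((x / t) powr (s + 1) * f' (x / t)))"
    proof (intro continuous_at_imp_continuous_on ballI)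
      fix x :: real assume "x \<in> {0<..}"
      then have x: "x > 0" "x / t > 0" using that by auto
      have "isCont (\<lambda>x. f' (x / t)) x"
        using continuous_at_compose[of x "\<lambda>x. x / t" f'] cont[OF x(2)] that by (simp add: o_def)
      then show "isCont (\<lambda>x. (sin x * x powr (- s - 1)) * ((x / t) powr (s + 1) * f' (x / t))) x"
        using x that by (intro continuous_intros) auto
    qed
    then have "?h t \<in> borel_measurable borel"
      by (intro borel_measurable_continuous_on_indicator) auto
    then show ?thesis by simp
  qed
  \<comment> \<open>Replacing \<open>t\<close> by \<open>max t 1\<close> makes the integrand measurable and dominated for every \<open>t\<close>, not only eventually.\<close>
  have "((\<lambda>t. LBINT x. ?h (max t 1) x) \<longlongrightarrow> (LBINT x. indicator {0<..} x *\<^sub>R ((sin x * x powr (- s - 1)) * l))) at_top"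
  proof (rule integral_dominated_convergence_at_top
      [where w = "\<lambda>x. \<bar>C\<bar> * \<bar>indicator {0<..} x *\<^sub>R (sin x * x powr (- s - 1))\<bar>"])
    show "integrable lborel (\<lambda>x. \<bar>C\<bar> * \<bar>indicator {0<..} x *\<^sub>R (sin x * x powr (- s - 1))\<bar>)"
      using set_integrable_sin_powr[OF s] unfolding set_integrable_def by simp
    show "AE x in lborel. ((\<lambda>t. ?h (max t 1) x) \<longlongrightarrow> indicator {0<..} x *\<^sub>R ((sin x * x powr (- s - 1)) * l)) at_top"
    proof (rule AE_I2)
      fix x :: real
      show "((\<lambda>t. ?h (max t 1) x) \<longlongrightarrow> indicator {0<..} x *\<^sub>R ((sin x * x powr (- s - 1)) * l)) at_top"
      proof (cases "x > 0")
        case True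
        have "((\<lambda>t. x / t) \<longlongrightarrow> 0) at_top"
          by (intro tendsto_divide_0[OF tendsto_const] filterlim_at_top_imp_at_infinity filterlim_ident)
        then have "filterlim (\<lambda>t. x / t) (at_right 0) at_top"
          unfolding filterlim_at using True
          by (auto intro: eventually_mono[OF eventually_gt_at_top[of 0]])
        from filterlim_compose[OF lim this]
        have "((\<lambda>t. (x / t) powr (s + 1) * f' (x / t)) \<longlongrightarrow> l) at_top" .
        then have "((\<lambda>t. (x / max t 1) powr (s + 1) * f' (x / max t 1)) \<longlongrightarrow> l) at_top"
          by (rule Lim_transform_eventually)
            (auto intro: eventually_mono[OF eventually_ge_at_top[of 1]] simp: max_def)
        then show ?thesis by (intro tendsto_intros)
      qed simp
    qed
    have "norm (?h t x) \<le> \<bar>C\<bar> * \<bar>indicator {0<..} x *\<^sub>R (sin x * x powr (- s - 1))\<bar>" if t: "t > 0" for t x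
    proof (cases "x > 0")
      case True
      then have xt: "x / t > 0" using t by simp
      have "\<bar>f' (x / t)\<bar> \<le> \<bar>C\<bar> * (x / t) powr (- s - 1)"
        by (rule order_trans[OF bf'[OF xt]]) (simp add: mult_right_mono)
      then have "(x / t) powr (s + 1) * \<bar>f' (x / t)\<bar> \<le> (x / t) powr (s + 1) * (\<bar>C\<bar> * (x / t) powr (- s - 1))"
        by (intro mult_left_mono) auto
      also have "\<dots> = \<bar>C\<bar> * ((x / t) powr (s + 1) * (x / t) powr (- s - 1))" by (simp only: mult_ac)
      also have "(x / t) powr (s + 1) * (x / t) powr (- s - 1) = 1"
        using xt True t by (simp add: powr_add[symmetric])
      finally have "\<bar>(x / t) powr (s + 1) * f' (x / t)\<bar> \<le> \<bar>C\<bar>" by (simp add: abs_mult)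
      then have "\<bar>sin x * x powr (- s - 1)\<bar> * \<bar>(x / t) powr (s + 1) * f' (x / t)\<bar> \<le> \<bar>sin x * x powr (- s - 1)\<bar> * \<bar>C\<bar>"
        by (intro mult_left_mono) auto
      then show ?thesis using True by (simp add: abs_mult mult_ac)
    qed simp
    then show "\<forall>\<^sub>F t in at_top. AE x in lborel. norm (?h (max t 1) x) \<le> \<bar>C\<bar> * \<bar>indicator {0<..} x *\<^sub>R (sin x * x powr (- s - 1))\<bar>"
      by (intro always_eventually allI AE_I2) simp
    show "?h (max t 1) \<in> borel_measurable lborel" for t by (rule hm) simp
  qed measurable
  moreover have "(LBINT x. indicator {0<..} x *\<^sub>R ((sin x * x powr (- s - 1)) * l)) = l * (LBINT x:{0<..}. sin x * x powr (- s - 1))"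
  proof -
    have "(LBINT x. indicator {0<..} x *\<^sub>R ((sin x * x powr (- s - 1)) * l)) =
      (LBINT x. (indicator {0<..} x *\<^sub>R (sin x * x powr (- s - 1))) * l)"
      by (intro Bochner_Integration.integral_cong) (simp_all only: mult_scaleR_left)
    then show ?thesis
      by (simp only: set_lebesgue_integral_def integral_mult_left_zero mult.commute[of l])
  qed
  ultimately have "((\<lambda>t. - (LBINT x. ?h (max t 1) x)) \<longlongrightarrow> - (l * (LBINT x:{0<..}. sin x * x powr (- s - 1)))) at_top"
    by (intro tendsto_minus) simp
  moreover have "\<forall>\<^sub>F t in at_top. - (LBINT x. ?h (max t 1) x) = t powr (1 - s) * (LBINT y:{0<..}. cos (t * y) * f y)"
    using eventually_ge_at_top[of 1]
  proof eventually_elim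
    case (elim t)
    then have "max t 1 = t" by simp
    then show ?case using eq[of t] elim by simp
  qed
  ultimately show ?thesis
    by (simp add: Lim_transform_eventually)
qed

section \<open>Evaluation of a singular sine integral\<close>

lemma sin_exp_integral:
  fixes w :: real
  assumes w: "w > 0"
  shows "set_integrable lborel {0<..} (\<lambda>x. sin x * exp (- (x * w)))"
    and "(LBINT x:{0<..}. sin x * exp (- (x * w))) = 1 / (1 + w\<^sup>2)"
proof -
  have "1 + w\<^sup>2 > 0" by (simp add: add_pos_nonneg)
  show i: "set_integrable lborel {0<..} (\<lambda>x. sin x * exp (- (x * w)))"
  proof (rule set_integrable_bound[OF integrable_I0i_exp_mscale[OF w]])
    show "set_borel_measurable lborel {0<..} (\<lambda>x. sin x * exp (- (x * w)))"
      unfolding set_borel_measurable_def by measurable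
  qed (auto simp: abs_mult mult_left_le_one_le)
  let ?F = "\<lambda>x. - (exp (- (x * w)) * (w * sin x + cos x)) / (1 + w\<^sup>2)"
  have "(LBINT x=ereal 0..\<infinity>. sin x * exp (- (x * w))) = 0 - (- 1 / (1 + w\<^sup>2))"
  proof (rule interval_integral_FTC_integrable[where F = ?F])
    fix x :: real
    have "((\<lambda>x. exp (- (x * w)) * (w * sin x + cos x)) has_real_derivative - (sin x * exp (- (x * w)) * (1 + w\<^sup>2))) (at x)"
      by (auto intro!: derivative_eq_intros simp: algebra_simps power2_eq_square)
    from DERIV_cdivide[OF DERIV_minus[OF this], of "1 + w\<^sup>2"]
    have "(?F has_real_derivative sin x * exp (- (x * w))) (at x)"
      using \<open>1 + w\<^sup>2 > 0\<close> by simp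
    then show "(?F has_vector_derivative sin x * exp (- (x * w))) (at x)"
      by (simp add: has_real_derivative_iff_has_vector_derivative)
    show "isCont (\<lambda>x. sin x * exp (- (x * w))) x" by (intro continuous_intros)
  next
    show "set_integrable lborel (einterval (ereal 0) \<infinity>) (\<lambda>x. sin x * exp (- (x * w)))" using i by simp
    have "(?F \<longlongrightarrow> - (exp (- (0 * w)) * (w * sin 0 + cos 0)) / (1 + w\<^sup>2)) (at_right 0)"
      by (intro tendsto_intros) (use \<open>1 + w\<^sup>2 > 0\<close> in auto)
    then show "((?F \<circ> real_of_ereal) \<longlongrightarrow> - 1 / (1 + w\<^sup>2)) (at_right (ereal 0))"
      unfolding ereal_tendsto_simps by simp
    show "((?F \<circ> real_of_ereal) \<longlongrightarrow> 0) (at_left \<infinity>)"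
      unfolding ereal_tendsto_simps
    proof (rule Lim_null_comparison)
      have "filterlim (\<lambda>x. x * w) at_top at_top"
        by (rule filterlim_tendsto_pos_mult_at_top[OF tendsto_const w filterlim_ident, THEN filterlim_cong[THEN iffD1, rotated -1]])
          (auto simp: mult.commute)
      then have "((\<lambda>x. exp (- (x * w)) * ((w + 1) / (1 + w\<^sup>2))) \<longlongrightarrow> 0 * ((w + 1) / (1 + w\<^sup>2))) at_top"
        by (intro tendsto_mult tendsto_const filterlim_compose[OF exp_at_bot] filterlim_uminus_at_bot_at_top[THEN filterlim_compose])
      then show "((\<lambda>x. exp (- (x * w)) * ((w + 1) / (1 + w\<^sup>2))) \<longlongrightarrow> 0) at_top" by simp
      have "norm (?F x) \<le> exp (- (x * w)) * ((w + 1) / (1 + w\<^sup>2))" for x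
      proof -
        have "\<bar>w * sin x + cos x\<bar> \<le> \<bar>w * sin x\<bar> + \<bar>cos x\<bar>" by (rule abs_triangle_ineq)
        also have "\<dots> \<le> w * 1 + 1"
          using w by (intro add_mono) (auto simp: abs_mult)
        finally have "exp (- (x * w)) * (\<bar>w * sin x + cos x\<bar> / (1 + w\<^sup>2)) \<le> exp (- (x * w)) * ((w + 1) / (1 + w\<^sup>2))"
          using \<open>1 + w\<^sup>2 > 0\<close> by (intro mult_left_mono divide_right_mono) auto
        then show ?thesis using \<open>1 + w\<^sup>2 > 0\<close> by (simp add: abs_mult)
      qed
      then show "\<forall>\<^sub>F x in at_top. norm (?F x) \<le> exp (- (x * w)) * ((w + 1) / (1 + w\<^sup>2))" by simp
    qed
  qed simp
  then show "(LBINT x:{0<..}. sin x * exp (- (x * w))) = 1 / (1 + w\<^sup>2)"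
    by (simp add: interval_lebesgue_integral_0_infty flip: zero_ereal_def)
qed

text \<open>
  The representation of \<open>x\<^bsup>-p\<^esup>\<close> as a mixture of exponentials, used to trade the power in
  \<open>sin x x\<^bsup>-s-1\<^esup>\<close> for a factor whose integral against the sine is elementary.
\<close>

lemma Gamma_kernel_integral:
  fixes p x :: real
  assumes p: "p > 0" and x: "x > 0"
  shows "has_bochner_integral lborel (\<lambda>w. indicator {0<..} w * (w powr (p - 1) * exp (- (x * w)))) (Gamma p * x powr (- p))"
proof -
  let ?G = "\<lambda>t::real. indicator {0..} t * t powr (p - 1) / exp t"
  have "(\<integral>\<^sup>+t. ennreal (?G t) \<partial>lborel) = ennreal (Gamma p)"
    using Gamma_conv_nn_integral_real[OF p] by simp
  then have G: "has_bochner_integral lborel ?G (Gamma p)"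
    using p by (intro has_bochner_integral_nn_integral) (auto intro: Gamma_real_nonneg)
  have "integrable lborel (\<lambda>w. ?G (0 + x * w))"
    using x by (intro lborel_integrable_real_affine[OF integrable.intros[OF G]]) auto
  then have i: "integrable lborel (\<lambda>w. x powr (1 - p) * ?G (x * w))"
    by (intro integrable_mult_right) simp
  have "Gamma p = \<bar>x\<bar> *\<^sub>R (LBINT w. ?G (0 + x * w))"
    unfolding has_bochner_integral_integral_eq[OF G, symmetric]
    using x by (intro lborel_integral_real_affine) auto
  then have "(LBINT w. x powr (1 - p) * ?G (x * w)) = Gamma p * x powr (- p)"
  proof -
    assume "Gamma p = \<bar>x\<bar> *\<^sub>R (LBINT w. ?G (0 + x * w))"
    then have 1: "Gamma p = x * (LBINT w. ?G (x * w))" using x by (simp only: abs_of_pos real_scaleR_def add_0)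
    have 2: "(LBINT w. x powr (1 - p) * ?G (x * w)) = x powr (1 - p) * (LBINT w. ?G (x * w))"
      by (rule integral_mult_right_zero)
    have 3: "x powr (1 - p) = x * x powr (- p)" using x by (simp add: powr_diff powr_minus divide_inverse)
    show ?thesis unfolding 2 unfolding 1 3 by (simp only: mult_ac)
  qed
  moreover have "(\<lambda>w. x powr (1 - p) * ?G (x * w)) = (\<lambda>w. indicator {0<..} w * (w powr (p - 1) * exp (- (x * w))))"
  proof
    fix w
    show "x powr (1 - p) * ?G (x * w) = indicator {0<..} w * (w powr (p - 1) * exp (- (x * w)))"
    proof (cases "w > 0")
      case True
      have "x powr (1 - p) * (x * w) powr (p - 1) = w powr (p - 1)"
        using x True by (simp add: powr_mult powr_add[symmetric])
      then show ?thesis using x True by (simp add: exp_minus field_simps)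
    next
      case False
      then consider "w < 0" | "w = 0" by linarith
      then show ?thesis
      proof cases
        case 1
        then have "x * w < 0" using x by (simp add: mult_pos_neg)
        then show ?thesis using 1 by simp
      qed simp
    qed
  qed
  ultimately show ?thesis
    using i by (simp add: has_bochner_integral_iff)
qed

text \<open>
  Insert the exponential mixture for \<open>x\<^bsup>-s-1\<^esup>\<close> and exchange the integrations. Fubini's theorem applies
  because integrating the absolute value over \<open>w\<close> first returns \<open>\<bar>sin x\<bar> x\<^bsup>-s-1\<^esup>\<close> up to a
  constant, and this is integrable.
\<close>

lemma sin_powr_integral_conv_rational:
  fixes s :: real
  assumes s: "0 < s" "s < 1"
  shows "Gamma (1 + s) * (LBINT x:{0<..}. sin x * x powr (- s - 1)) = (LBINT w:{0<..}. w powr s / (1 + w\<^sup>2))"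
proof -
  let ?H = "\<lambda>(x, w). indicator {0<..} x * sin x * (indicator {0<..} w * (w powr s * exp (- (x * w)))) :: real"
  have K: "has_bochner_integral lborel (\<lambda>w. indicator {0<..} w * (w powr s * exp (- (x * w)))) (Gamma (1 + s) * x powr (- s - 1))"
    if "x > 0" for x :: real
  proof -
    have "- (1 + s) = - s - 1" "1 + s - 1 = s" by simp_all
    then show ?thesis using Gamma_kernel_integral[of "1 + s" x] s that by (simp only:)
  qed
  have H1: "(LBINT w. ?H (x, w)) = Gamma (1 + s) * (indicator {0<..} x *\<^sub>R (sin x * x powr (- s - 1)))" for x
    by (cases "x > 0") (use has_bochner_integral_integral_eq[OF K] in auto)
  have "integrable (lborel \<Otimes>\<^sub>M lborel) ?H"
  proof (rule lborel_pair.Fubini_integrable)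
    show "?H \<in> borel_measurable (lborel \<Otimes>\<^sub>M lborel)" by measurable
    have "(LBINT w. norm (?H (x, w))) = Gamma (1 + s) * \<bar>indicator {0<..} x *\<^sub>R (sin x * x powr (- s - 1))\<bar>" for x
    proof (cases "x > 0")
      case True
      have "(LBINT w. norm (?H (x, w))) = (LBINT w. \<bar>sin x\<bar> * (indicator {0<..} w * (w powr s * exp (- (x * w)))))"
        using True by (intro Bochner_Integration.integral_cong) (auto simp: abs_mult)
      then show ?thesis using has_bochner_integral_integral_eq[OF K[OF True]] True by (simp add: abs_mult)
    qed simp
    then show "integrable lborel (\<lambda>x. LBINT w. norm (?H (x, w)))"
      using set_integrable_sin_powr[OF s] unfolding set_integrable_def by simp
    show "AE x in lborel. integrable lborel (\<lambda>w. ?H (x, w))"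
    proof (rule AE_I2)
      fix x
      show "integrable lborel (\<lambda>w. ?H (x, w))"
        by (cases "x > 0") (use integrable.intros[OF K] in auto)
    qed
  qed
  then have "(LBINT x. LBINT w. ?H (x, w)) = (LBINT w. LBINT x. ?H (x, w))"
    by (intro lborel_pair.Fubini_integral[symmetric]) (simp add: case_prod_unfold)
  also have "(LBINT x. LBINT w. ?H (x, w)) = Gamma (1 + s) * (LBINT x:{0<..}. sin x * x powr (- s - 1))"
    unfolding H1 set_lebesgue_integral_def by simp
  also have "(LBINT w. LBINT x. ?H (x, w)) = (LBINT w:{0<..}. w powr s / (1 + w\<^sup>2))"
    unfolding set_lebesgue_integral_def
  proof (rule Bochner_Integration.integral_cong)
    fix w
    show "(LBINT x. ?H (x, w)) = indicator {0<..} w *\<^sub>R (w powr s / (1 + w\<^sup>2))"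
    proof (cases "w > 0")
      case True
      have "(LBINT x. ?H (x, w)) = (LBINT x. w powr s * (indicator {0<..} x *\<^sub>R (sin x * exp (- (x * w)))))"
        using True by (intro Bochner_Integration.integral_cong) (auto simp: mult_ac)
      also have "\<dots> = w powr s * (1 / (1 + w\<^sup>2))"
        using sin_exp_integral(2)[OF True] by (simp add: set_lebesgue_integral_def)
      finally show ?thesis using True by simp
    qed simp
  qed simp
  finally show ?thesis .
qed

text \<open>
  The substitution \<open>w\<^sup>2 = v / (1 - v)\<close> maps the integral to Euler's Beta integral.
\<close>

lemma powr_rational_integral:
  fixes s :: real
  assumes s: "0 < s" "s < 1"
  shows "(LBINT w:{0<..}. w powr s / (1 + w\<^sup>2)) = Beta ((1 + s) / 2) ((1 - s) / 2) / 2"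
proof -
  let ?a = "(1 + s) / 2" and ?b = "(1 - s) / 2"
  let ?g = "\<lambda>v::real. (v / (1 - v)) powr (1 / 2)"
  let ?g' = "\<lambda>v::real. 1 / 2 * (v / (1 - v)) powr (- 1 / 2) * (1 / (1 - v)\<^sup>2)"
  let ?f = "\<lambda>w::real. w powr s / (1 + w\<^sup>2)"
  have fg: "?f (?g v) * ?g' v = 1 / 2 * (v powr (?a - 1) * (1 - v) powr (?b - 1))" if v: "0 < v" "v < 1" for v
  proof -
    \<comment> \<open>In logarithmic coordinates the identity of products of powers is linear in the exponents.\<close>
    define p q where "p = ln v" and "q = ln (1 - v)"
    have vp: "v = exp p" and vq: "1 - v = exp q" using v by (auto simp: p_def q_def)
    have "(?g v)\<^sup>2 = v / (1 - v)"
      using v by (simp add: powr_half_sqrt)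
    then have "1 + (?g v)\<^sup>2 = 1 / (1 - v)" using v by (simp add: field_simps)
    then have "?f (?g v) * ?g' v = 1 / 2 * ((v / (1 - v)) powr (1 / 2)) powr s * (1 - v) * (v / (1 - v)) powr (- 1 / 2) * (1 / (1 - v)\<^sup>2)"
      by simp
    also have "\<dots> = 1 / 2 * exp ((p - q) * (1 / 2) * s + q + (p - q) * (- 1 / 2) + - (2 * q))"
    proof -
      have vv: "v / (1 - v) = exp (p - q)" unfolding exp_diff vp[symmetric] vq[symmetric] ..
      have 1: "((v / (1 - v)) powr (1 / 2)) powr s = exp ((p - q) * (1 / 2) * s)"
        unfolding vv by (simp add: powr_def)
      have 2: "(v / (1 - v)) powr (- 1 / 2) = exp ((p - q) * (- 1 / 2))"
        unfolding vv by (simp add: powr_def)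
      have 3: "1 / (1 - v)\<^sup>2 = exp (- (2 * q))"
        unfolding vq by (simp add: exp_minus exp_double divide_inverse)
      show ?thesis unfolding 1 2 3 unfolding vq by (simp only: exp_add mult.assoc)
    qed
    also have "(p - q) * (1 / 2) * s + q + (p - q) * (- 1 / 2) + - (2 * q) = p * (?a - 1) + q * (?b - 1)"
      by (simp add: field_simps)
    also have "exp (p * (?a - 1) + q * (?b - 1)) = v powr (?a - 1) * (1 - v) powr (?b - 1)"
      using v by (simp add: powr_def p_def q_def exp_add mult.commute)
    finally show ?thesis .
  qed
  have B: "set_integrable lborel {0..1} (\<lambda>v. 1 / 2 * (v powr (?a - 1) * (1 - v) powr (?b - 1)))"
    using integrable_Beta[of ?a ?b] s by (intro set_integrable_mult_right) auto
  have B1: "set_integrable lborel {0<..<1} (\<lambda>v. 1 / 2 * (v powr (?a - 1) * (1 - v) powr (?b - 1)))"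
    by (rule set_integrable_subset[OF B]) auto
  have B2: "set_integrable lborel {0<..<1} (\<lambda>v. ?f (?g v) * ?g' v)"
    by (rule set_integrable_cong[THEN iffD2, OF refl refl _ B1]) (use fg in auto)
  have "(LBINT w=ereal 0..\<infinity>. ?f w) = (LBINT v=ereal 0..ereal 1. ?f (?g v) * ?g' v)"
  proof (rule interval_integral_substitution_nonneg(2))
    fix v assume "ereal 0 < ereal v" "ereal v < ereal 1"
    then have v: "0 < v" "v < 1" by auto
    have "((\<lambda>v. v / (1 - v)) has_real_derivative 1 / (1 - v)\<^sup>2) (at v)"
      using v by (auto intro!: derivative_eq_intros simp: power2_eq_square field_simps)
    from DERIV_fun_powr[OF this, of "1 / 2"] show "(?g has_real_derivative ?g' v) (at v)"
      using v by simp
    show "isCont ?f (?g v)" using v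
      by (intro continuous_intros) (auto simp: add_nonneg_eq_0_iff)
    show "isCont ?g' v" using v by (intro continuous_intros) auto
    show "0 \<le> ?f (?g v)" by simp
  next
    fix v :: real show "0 \<le> ?g' v" by simp
  next
    have "((\<lambda>v::real. v / (1 - v)) \<longlongrightarrow> 0 / (1 - 0)) (at_right 0)" by (intro tendsto_intros) auto
    then have "(?g \<longlongrightarrow> 0) (at_right 0)"
      by (intro tendsto_zero_powrI[where b = "1 / 2"] tendsto_const)
        (auto simp: eventually_at_right_field intro!: exI[of _ "1::real"])
    then show "((ereal \<circ> ?g \<circ> real_of_ereal) \<longlongrightarrow> ereal 0) (at_right (ereal 0))"
      unfolding ereal_tendsto_simps by (simp add: o_def)
    have "filterlim (\<lambda>v::real. v * inverse (1 - v)) at_top (at_left 1)"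
    proof (rule filterlim_tendsto_pos_mult_at_top[where c = 1])
      show "((\<lambda>v::real. v) \<longlongrightarrow> 1) (at_left 1)" by (rule tendsto_ident_at)
      have "((\<lambda>v::real. 1 - v) \<longlongrightarrow> 1 - 1) (at_left 1)" by (intro tendsto_intros)
      then have "filterlim (\<lambda>v::real. 1 - v) (at_right 0) (at_left 1)"
        unfolding filterlim_at by (auto simp: eventually_at_filter)
      then show "filterlim (\<lambda>v::real. inverse (1 - v)) at_top (at_left 1)"
        by (rule filterlim_compose[OF filterlim_inverse_at_top_right])
    qed simp
    then have "filterlim (\<lambda>v::real. v / (1 - v)) at_top (at_left 1)" by (simp add: divide_inverse)
    then have "filterlim (\<lambda>v::real. sqrt (v / (1 - v))) at_top (at_left 1)"
      by (rule filterlim_compose[OF sqrt_at_top])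
    then have "filterlim ?g at_top (at_left 1)"
      by (rule filterlim_mono_eventually)
        (auto simp: eventually_at_left_field powr_half_sqrt intro!: exI[of _ "0::real"])
    then show "((ereal \<circ> ?g \<circ> real_of_ereal) \<longlongrightarrow> \<infinity>) (at_left (ereal 1))"
      unfolding ereal_tendsto_simps by (simp add: o_def)
  next
    show "set_integrable lborel (einterval (ereal 0) (ereal 1)) (\<lambda>v. ?f (?g v) * ?g' v)"
      using B2 by simp
  qed simp
  moreover have "(LBINT w=ereal 0..\<infinity>. ?f w) = (LBINT w:{0<..}. ?f w)"
    unfolding interval_lebesgue_integral_def einterval_eq by simp
  moreover have "(LBINT v=ereal 0..ereal 1. ?f (?g v) * ?g' v) = (LBINT v:{0<..<1}. ?f (?g v) * ?g' v)"
    unfolding interval_lebesgue_integral_def einterval_eq by simp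
  ultimately have "(LBINT w:{0<..}. ?f w) = (LBINT v:{0<..<1}. ?f (?g v) * ?g' v)"
    by (simp only:)
  also have "\<dots> = (LBINT v:{0<..<1}. 1 / 2 * (v powr (?a - 1) * (1 - v) powr (?b - 1)))"
    by (rule set_lebesgue_integral_cong) (use fg in auto)
  also have "\<dots> = integral {0<..<1} (\<lambda>v. 1 / 2 * (v powr (?a - 1) * (1 - v) powr (?b - 1)))"
    by (rule set_borel_integral_eq_integral[OF B1])
  also have "\<dots> = Beta ?a ?b / 2"
  proof (rule integral_unique)
    have "((\<lambda>v. 1 / 2 * (v powr (?a - 1) * (1 - v) powr (?b - 1))) has_integral 1 / 2 * Beta ?a ?b) {0..1}"
      using has_integral_Beta_real[of ?a ?b] s by (intro has_integral_mult_right) auto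
    then show "((\<lambda>v. 1 / 2 * (v powr (?a - 1) * (1 - v) powr (?b - 1))) has_integral Beta ?a ?b / 2) {0<..<1}"
      by (simp add: has_integral_Icc_iff_Ioo)
  qed
  finally show ?thesis .
qed

lemma Gamma_reflection_real:
  fixes x :: real
  shows "Gamma x * Gamma (1 - x) = pi / sin (pi * x)"
proof -
  have "complex_of_real (Gamma x * Gamma (1 - x)) = Gamma (of_real x) * Gamma (1 - of_real x)"
    by (simp add: Gamma_complex_of_real[symmetric])
  also have "\<dots> = of_real pi / sin (of_real pi * of_real x)"
    by (rule Gamma_reflection_complex)
  also have "\<dots> = complex_of_real (pi / sin (pi * x))"
    by (simp add: sin_of_real[symmetric] del: sin_of_real)
  finally show ?thesis by (simp only: of_real_eq_iff)
qed

text \<open>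
  By the two evaluations above, \<open>\<Gamma>(1 + 2\<beta>)\<close> times the integral is \<open>\<Gamma>(1/2 + \<beta>) \<Gamma>(1/2 - \<beta>) / 2\<close>, which
  equals \<open>\<pi> / (2 cos \<pi>\<beta>)\<close> by reflection. Two further uses of the reflection formula, at \<open>2\<beta>\<close> and at
  \<open>\<beta>\<close>, bring the result into the stated form.
\<close>

lemma sin_powr_integral:
  fixes \<beta> :: real
  assumes \<beta>: "0 < \<beta>" "\<beta> < 1 / 2"
  shows "2 * \<beta> * (LBINT x:{0<..}. sin x * x powr (- (2 * \<beta>) - 1)) / pi = Gamma (1 - 2 * \<beta>) / (Gamma \<beta> * Gamma (1 - \<beta>))"
proof -
  let ?J = "LBINT x:{0<..}. sin x * x powr (- (2 * \<beta>) - 1)"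
  have sc: "sin (pi * \<beta>) > 0" "cos (pi * \<beta>) > 0"
    using \<beta> by (auto intro!: sin_gt_zero cos_gt_zero simp: field_simps)
  have G: "Gamma (2 * \<beta>) > 0" using \<beta> by (intro Gamma_real_pos) auto
  have "Gamma (1 + 2 * \<beta>) * ?J = Beta ((1 + 2 * \<beta>) / 2) ((1 - 2 * \<beta>) / 2) / 2"
    using sin_powr_integral_conv_rational[of "2 * \<beta>"] powr_rational_integral[of "2 * \<beta>"] \<beta> by simp
  also have "Beta ((1 + 2 * \<beta>) / 2) ((1 - 2 * \<beta>) / 2) = Gamma (1 / 2 + \<beta>) * Gamma (1 - (1 / 2 + \<beta>))"
    by (simp add: Beta_def add_divide_distrib diff_divide_distrib)
  also have "\<dots> = pi / cos (pi * \<beta>)"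
    unfolding Gamma_reflection_real by (simp add: algebra_simps sin_add)
  also have "Gamma (1 + 2 * \<beta>) = 2 * \<beta> * Gamma (2 * \<beta>)"
  proof -
    have "2 * \<beta> \<notin> \<int>\<^sub>\<le>\<^sub>0" using \<beta> by (auto elim!: nonpos_Ints_cases)
    from Gamma_plus1[OF this] show ?thesis by (simp only: add.commute)
  qed
  finally have "2 * \<beta> * Gamma (2 * \<beta>) * ?J = pi / cos (pi * \<beta>) / 2" .
  moreover have "2 * \<beta> * J / pi = 1 / (2 * C * G)"
    if "2 * \<beta> * G * J = pi / C / 2" "G > 0" "C > 0" for G J C :: real
    using that by (simp add: field_simps)
  ultimately have "2 * \<beta> * ?J / pi = 1 / (2 * cos (pi * \<beta>) * Gamma (2 * \<beta>))"
    using sc G by blast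
  also have "\<dots> = Gamma (1 - 2 * \<beta>) * sin (pi * \<beta>) / pi"
  proof -
    have "Gamma (2 * \<beta>) * Gamma (1 - 2 * \<beta>) = pi / (2 * sin (pi * \<beta>) * cos (pi * \<beta>))"
    proof -
      have "sin (pi * (2 * \<beta>)) = 2 * sin (pi * \<beta>) * cos (pi * \<beta>)"
        using sin_double[of "pi * \<beta>"] by (simp only: mult.left_commute)
      then show ?thesis unfolding Gamma_reflection_real by (simp only:)
    qed
    moreover have "1 / (2 * C * G) = H * S / pi"
      if "G * H = pi / (2 * S * C)" "G > 0" "C > 0" "S > 0" for G H C S :: real
      using that by (simp add: field_simps)
    ultimately show ?thesis using sc G by blast
  qed
  also have "\<dots> = Gamma (1 - 2 * \<beta>) / (Gamma \<beta> * Gamma (1 - \<beta>))"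
    unfolding Gamma_reflection_real using sc by simp
  finally show ?thesis .
qed

section \<open>Translation is continuous in \<open>L\<^sup>1\<close>\<close>

lemma Cauchy_Schwarz_integral:
  fixes a b :: "'a \<Rightarrow> real"
  assumes [measurable]: "a \<in> borel_measurable M" "b \<in> borel_measurable M"
    and a2: "integrable M (\<lambda>x. (a x)\<^sup>2)" and b2: "integrable M (\<lambda>x. (b x)\<^sup>2)"
  shows "integrable M (\<lambda>x. a x * b x)"
    and "\<bar>\<integral>x. a x * b x \<partial>M\<bar> \<le> sqrt (\<integral>x. (a x)\<^sup>2 \<partial>M) * sqrt (\<integral>x. (b x)\<^sup>2 \<partial>M)"
proof -
  show ab: "integrable M (\<lambda>x. a x * b x)"
  proof (rule Bochner_Integration.integrable_bound[OF Bochner_Integration.integrable_add[OF a2 b2]])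
    have "\<bar>p * q\<bar> \<le> \<bar>p\<^sup>2 + q\<^sup>2\<bar>" for p q :: real
    proof -
      have "0 \<le> (\<bar>p\<bar> - \<bar>q\<bar>)\<^sup>2" by simp
      then have "2 * (\<bar>p\<bar> * \<bar>q\<bar>) \<le> p\<^sup>2 + q\<^sup>2" by (simp add: power2_diff)
      moreover have "0 \<le> \<bar>p\<bar> * \<bar>q\<bar>" by simp
      ultimately show ?thesis unfolding abs_mult by linarith
    qed
    then show "AE x in M. norm (a x * b x) \<le> norm ((a x)\<^sup>2 + (b x)\<^sup>2)" by simp
  qed simp
  define A B C where "A = (\<integral>x. (a x)\<^sup>2 \<partial>M)" and "B = (\<integral>x. (b x)\<^sup>2 \<partial>M)"
    and "C = (\<integral>x. a x * b x \<partial>M)"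
  \<comment> \<open>A nonnegative quadratic in \<open>s\<close> has nonpositive discriminant.\<close>
  have quad: "0 \<le> A * s\<^sup>2 - 2 * s * C + B" for s
  proof -
    have "0 \<le> (\<integral>x. (s * a x - b x)\<^sup>2 \<partial>M)" by simp
    also have "(\<lambda>x. (s * a x - b x)\<^sup>2) = (\<lambda>x. s\<^sup>2 * (a x)\<^sup>2 - 2 * s * (a x * b x) + (b x)\<^sup>2)"
      by (simp add: power2_eq_square algebra_simps)
    also have "(\<integral>x. s\<^sup>2 * (a x)\<^sup>2 - 2 * s * (a x * b x) + (b x)\<^sup>2 \<partial>M) = A * s\<^sup>2 - 2 * s * C + B"
      using a2 b2 ab by (simp add: A_def B_def C_def)
    finally show ?thesis .
  qed
  have "A \<ge> 0" by (simp add: A_def)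
  have "C\<^sup>2 \<le> A * B"
  proof (cases "A = 0")
    case True
    have "C = 0"
    proof (rule ccontr)
      assume "C \<noteq> 0"
      then show False using quad[of "(B + 1) / (2 * C)"] True by simp
    qed
    then show ?thesis using True by simp
  next
    case False
    with \<open>A \<ge> 0\<close> have "A > 0" by simp
    then show ?thesis using quad[of "C / A"] by (simp add: field_simps power2_eq_square)
  qed
  then have "sqrt (C\<^sup>2) \<le> sqrt (A * B)" by (rule real_sqrt_le_mono)
  then show "\<bar>C\<bar> \<le> sqrt A * sqrt B" by (simp add: real_sqrt_mult)
qed

lemma integrable_translation:
  fixes f :: "real \<Rightarrow> 'a :: {banach, second_countable_topology}"
  assumes "integrable lborel f"
  shows "integrable lborel (\<lambda>x. f (t + x))"
  using lborel_integrable_real_affine[OF assms, of 1 t] by simp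

lemma integral_translation:
  fixes f :: "real \<Rightarrow> 'a :: {banach, second_countable_topology}"
  shows "(LBINT x. f (t + x)) = (LBINT x. f x)"
  using lborel_integral_real_affine[of 1 f t] by simp

lemma L1_translation_approx:
  fixes f s :: "real \<Rightarrow> real"
  assumes f: "integrable lborel f" and s: "integrable lborel s"
  shows "(LBINT x. \<bar>f (t + x) - f x\<bar>) \<le>
    2 * (LBINT x. \<bar>f x - s x\<bar>) + (LBINT x. \<bar>s (t + x) - s x\<bar>)"
proof -
  note ft = integrable_translation[OF f, of t] and st = integrable_translation[OF s, of t]
  have fs: "integrable lborel (\<lambda>x. \<bar>f x - s x\<bar>)" using f s by simp
  have fst: "integrable lborel (\<lambda>x. \<bar>f (t + x) - s (t + x)\<bar>)" using ft st by simp
  have ss: "integrable lborel (\<lambda>x. \<bar>s (t + x) - s x\<bar>)" using s st by simp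
  have "(LBINT x. \<bar>f (t + x) - f x\<bar>) \<le>
     (LBINT x. \<bar>f (t + x) - s (t + x)\<bar> + \<bar>f x - s x\<bar> + \<bar>s (t + x) - s x\<bar>)"
    using f ft fs fst ss by (intro integral_mono) auto
  also have "\<dots> = (LBINT x. \<bar>f (t + x) - s (t + x)\<bar>) + (LBINT x. \<bar>f x - s x\<bar>)
      + (LBINT x. \<bar>s (t + x) - s x\<bar>)"
    using fs ss fst by simp
  also have "(LBINT x. \<bar>f (t + x) - s (t + x)\<bar>) = (LBINT x. \<bar>f x - s x\<bar>)"
    by (rule integral_translation[where f = "\<lambda>x. \<bar>f x - s x\<bar>"])
  finally show ?thesis by simp
qed

text \<open>
  The functions on which translation acts continuously are closed in \<open>L\<^sup>1\<close>: translating the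
  approximation error costs no more than the error itself.
\<close>

lemma L1_translation_limit:
  fixes f :: "real \<Rightarrow> real"
  assumes f: "integrable lborel f"
    and approx: "\<And>e. e > 0 \<Longrightarrow> \<exists>s. integrable lborel s \<and> (LBINT x. \<bar>f x - s x\<bar>) < e \<and>
      ((\<lambda>t. LBINT x. \<bar>s (t + x) - s x\<bar>) \<longlongrightarrow> 0) (at 0)"
  shows "((\<lambda>t. LBINT x. \<bar>f (t + x) - f x\<bar>) \<longlongrightarrow> 0) (at 0)"
proof (rule tendstoI)
  fix e :: real assume "e > 0"
  then obtain s where s: "integrable lborel s" "(LBINT x. \<bar>f x - s x\<bar>) < e / 4"
    "((\<lambda>t. LBINT x. \<bar>s (t + x) - s x\<bar>) \<longlongrightarrow> 0) (at 0)"
    using approx[of "e / 4"] by auto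
  have "\<forall>\<^sub>F t in at 0. dist (LBINT x. \<bar>s (t + x) - s x\<bar>) 0 < e / 2"
    using s(3) \<open>e > 0\<close> by (intro tendstoD) auto
  then show "\<forall>\<^sub>F t in at 0. dist (LBINT x. \<bar>f (t + x) - f x\<bar>) 0 < e"
  proof eventually_elim
    case (elim t)
    then show ?case
      using L1_translation_approx[OF f s(1), of t] s(2) by simp
  qed
qed

text \<open>
  The set and its translate have equal measure, so the integral is twice the measure of \<open>U\<close> minus
  twice the measure of the intersection with the translate. Each point of an open set stays in the
  set under small translations, hence the latter measure tends to that of \<open>U\<close>.
\<close>

lemma L1_translation_open:
  fixes U :: "real set"
  assumes U: "open U" "emeasure lborel U < \<infinity>"
  shows "((\<lambda>t. LBINT x. \<bar>indicator U (t + x) - indicator U x :: real\<bar>) \<longlongrightarrow> 0) (at 0)"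
proof -
  have [measurable]: "U \<in> sets borel" using U by simp
  have iU: "integrable lborel (indicator U :: real \<Rightarrow> real)"
    using U by simp
  have iUt: "integrable lborel (\<lambda>x. indicator U (t + x) :: real)" for t
    by (rule integrable_translation[OF iU])
  have iUU: "integrable lborel (\<lambda>x. indicator U (t + x) * indicator U x :: real)" for t
    by (rule Bochner_Integration.integrable_bound[OF iU]) (auto simp: indicator_def)
  have eq: "(LBINT x. \<bar>indicator U (t + x) - indicator U x :: real\<bar>) =
     2 * measure lborel U - 2 * (LBINT x. indicator U (t + x) * indicator U x)" for t
  proof -
    have "(LBINT x. \<bar>indicator U (t + x) - indicator U x :: real\<bar>) =
      (LBINT x. indicator U (t + x) + indicator U x - 2 * (indicator U (t + x) * indicator U x))"
      by (intro Bochner_Integration.integral_cong) (auto simp: indicator_def)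
    also have "\<dots> = (LBINT x. indicator U (t + x)) + (LBINT x. indicator U x)
       - 2 * (LBINT x. indicator U (t + x) * indicator U x)"
      using iU iUt iUU by simp
    also have "(LBINT x. indicator U (t + x) :: real) = (LBINT x. indicator U x)"
      by (rule integral_translation)
    finally show ?thesis by simp
  qed
  have "((\<lambda>t. LBINT x. indicator U (t + x) * indicator U x) \<longlongrightarrow> measure lborel U) (at 0)"
    unfolding tendsto_at_iff_sequentially comp_def
  proof safe
    fix X :: "nat \<Rightarrow> real" assume X: "\<forall>i. X i \<in> UNIV - {0}" "X \<longlonglongrightarrow> 0"
    have "(\<lambda>n. LBINT x. indicator U (X n + x) * indicator U x :: real)
       \<longlonglongrightarrow> (LBINT x. indicator U x)"
    proof (rule integral_dominated_convergence[where w = "indicator U"])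
      show "AE x in lborel. (\<lambda>n. indicator U (X n + x) * indicator U x :: real)
        \<longlonglongrightarrow> indicator U x"
      proof (rule AE_I2)
        fix x
        show "(\<lambda>n. indicator U (X n + x) * indicator U x :: real) \<longlonglongrightarrow> indicator U x"
        proof (cases "x \<in> U")
          case True
          have "(\<lambda>n. X n + x) \<longlonglongrightarrow> 0 + x" by (intro tendsto_intros X)
          then have "\<forall>\<^sub>F n in sequentially. X n + x \<in> U"
            using U(1) True by (intro topological_tendstoD) auto
          then show ?thesis using True
            by (intro tendsto_eventually) (auto elim: eventually_mono)
        qed simp
      qed
    qed (use iU in \<open>auto simp: indicator_def\<close>)
    then show "(\<lambda>n. LBINT x. indicator U (X n + x) * indicator U x) \<longlonglongrightarrow> measure lborel U"
      by simp
  qed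
  then have "((\<lambda>t. 2 * measure lborel U - 2 * (LBINT x. indicator U (t + x) * indicator U x))
     \<longlongrightarrow> 2 * measure lborel U - 2 * measure lborel U) (at 0)"
    by (intro tendsto_intros)
  then show ?thesis unfolding eq by simp
qed

text \<open>
  Open sets are dense among the sets of finite measure by outer regularity; sums and dominated
  limits then reach all integrable functions.
\<close>

lemma L1_translation_continuous:
  fixes f :: "real \<Rightarrow> real"
  assumes "integrable lborel f"
  shows "((\<lambda>t. LBINT x. \<bar>f (t + x) - f x\<bar>) \<longlongrightarrow> 0) (at 0)"
  using assms
proof (induction rule: integrable_induct)
  case (base A c)
  have A: "A \<in> sets borel" using base by simp
  have iA: "integrable lborel (indicator A :: real \<Rightarrow> real)" using base by simp
  have "((\<lambda>t. LBINT x. \<bar>indicator A (t + x) - indicator A x :: real\<bar>) \<longlongrightarrow> 0) (at 0)"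
  proof (rule L1_translation_limit[OF iA])
    fix e :: real assume "e > 0"
    obtain U where U: "open U" "A \<subseteq> U" "emeasure lborel (U - A) < e"
      using outer_regular_lborel[OF A \<open>e > 0\<close>] by blast
    have [measurable]: "A \<in> sets borel" "U \<in> sets borel" using U A by auto
    have Ufin: "emeasure lborel U < \<infinity>"
    proof -
      have "emeasure lborel U \<le> emeasure lborel (U - A) + emeasure lborel A"
        using U(2) by (subst plus_emeasure) (auto intro!: emeasure_mono)
      also have "\<dots> < \<infinity>" using U(3) base(2)
        by (auto simp: ennreal_add_eq_top less_top[symmetric])
      finally show ?thesis .
    qed
    have "(LBINT x. \<bar>indicator A x - indicator U x :: real\<bar>) = (LBINT x. indicator (U - A) x)"
      using U(2) by (intro Bochner_Integration.integral_cong) (auto simp: indicator_def)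
    also have "\<dots> < e"
    proof -
      have "emeasure lborel (U - A) = ennreal (measure lborel (U - A))"
        using U(3) by (intro emeasure_eq_ennreal_measure) auto
      then have "measure lborel (U - A) < e"
        using U(3) \<open>e > 0\<close> by (simp add: ennreal_less_iff)
      then show ?thesis by simp
    qed
    finally show "\<exists>s. integrable lborel s \<and> (LBINT x. \<bar>indicator A x - s x\<bar>) < e \<and>
         ((\<lambda>t. LBINT x. \<bar>s (t + x) - s x\<bar>) \<longlongrightarrow> 0) (at 0)"
      using Ufin L1_translation_open[OF U(1) Ufin] by (intro exI[of _ "indicator U"]) auto
  qed
  then have "((\<lambda>t. \<bar>c\<bar> * (LBINT x. \<bar>indicator A (t + x) - indicator A x :: real\<bar>)) \<longlongrightarrow> \<bar>c\<bar> * 0) (at 0)"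
    by (intro tendsto_intros)
  moreover have "(LBINT x. \<bar>indicator A (t + x) *\<^sub>R c - indicator A x *\<^sub>R c\<bar>) =
     \<bar>c\<bar> * (LBINT x. \<bar>indicator A (t + x) - indicator A x :: real\<bar>)" for t
  proof -
    have "(LBINT x. \<bar>indicator A (t + x) *\<^sub>R c - indicator A x *\<^sub>R c\<bar>) =
      (LBINT x. \<bar>c\<bar> * \<bar>indicator A (t + x) - indicator A x\<bar>)"
      by (intro Bochner_Integration.integral_cong) (auto simp: indicator_def)
    then show ?thesis by simp
  qed
  ultimately show ?case by simp
next
  case (add f g)
  show ?case
  proof (rule tendsto_sandwich[where f = "\<lambda>_. 0"])
    show "((\<lambda>t. (LBINT x. \<bar>f (t + x) - f x\<bar>) + (LBINT x. \<bar>g (t + x) - g x\<bar>)) \<longlongrightarrow> 0) (at 0)"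
      using add by (auto intro!: tendsto_eq_intros)
    have "(LBINT x. \<bar>f (t + x) + g (t + x) - (f x + g x)\<bar>)
      \<le> (LBINT x. \<bar>f (t + x) - f x\<bar>) + (LBINT x. \<bar>g (t + x) - g x\<bar>)" for t
    proof -
      have i: "integrable lborel (\<lambda>x. f (t + x) - f x)" "integrable lborel (\<lambda>x. g (t + x) - g x)"
        using add(1,2) by (auto intro: integrable_translation)
      have "(LBINT x. \<bar>f (t + x) + g (t + x) - (f x + g x)\<bar>) =
        (LBINT x. \<bar>(f (t + x) - f x) + (g (t + x) - g x)\<bar>)"
        by (intro Bochner_Integration.integral_cong) auto
      also have "\<dots> \<le> (LBINT x. \<bar>f (t + x) - f x\<bar> + \<bar>g (t + x) - g x\<bar>)"
        using i by (intro integral_mono) auto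
      finally show ?thesis using i by simp
    qed
    then show "\<forall>\<^sub>F t in at 0. (LBINT x. \<bar>f (t + x) + g (t + x) - (f x + g x)\<bar>)
      \<le> (LBINT x. \<bar>f (t + x) - f x\<bar>) + (LBINT x. \<bar>g (t + x) - g x\<bar>)" by simp
  qed auto
next
  case (lim f s)
  show ?case
  proof (rule L1_translation_limit[OF lim(4)])
    fix e :: real assume "e > 0"
    have "(\<lambda>i. LBINT x. \<bar>f x - s i x\<bar>) \<longlonglongrightarrow> (LBINT x. \<bar>f x - f x\<bar>)"
    proof (rule integral_dominated_convergence[where w = "\<lambda>x. 3 * \<bar>f x\<bar>"])
      show "AE x in lborel. (\<lambda>i. \<bar>f x - s i x\<bar>) \<longlonglongrightarrow> \<bar>f x - f x\<bar>"
        using lim(2) by (intro AE_I2 tendsto_intros) auto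
      show "AE x in lborel. norm \<bar>f x - s i x\<bar> \<le> 3 * \<bar>f x\<bar>" for i
      proof (rule AE_I2)
        fix x show "norm \<bar>f x - s i x\<bar> \<le> 3 * \<bar>f x\<bar>"
          using lim(3)[of x i] by simp
      qed
      note [measurable] = borel_measurable_integrable[OF lim(4)] borel_measurable_integrable[OF lim(1)]
      show "(\<lambda>x. \<bar>f x - f x\<bar>) \<in> borel_measurable lborel" by measurable
      show "(\<lambda>x. \<bar>f x - s i x\<bar>) \<in> borel_measurable lborel" for i by measurable
      show "integrable lborel (\<lambda>x. 3 * \<bar>f x\<bar>)" using lim(4) by simp
    qed
    then have "\<forall>\<^sub>F i in sequentially. (LBINT x. \<bar>f x - s i x\<bar>) < e"
      using \<open>e > 0\<close> by (intro order_tendstoD) auto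
    then obtain i where "(LBINT x. \<bar>f x - s i x\<bar>) < e"
      by (auto simp: eventually_sequentially)
    then show "\<exists>s. integrable lborel s \<and> (LBINT x. \<bar>f x - s x\<bar>) < e \<and>
         ((\<lambda>t. LBINT x. \<bar>s (t + x) - s x\<bar>) \<longlongrightarrow> 0) (at 0)"
      using lim(1,5) by (intro exI[of _ "s i"]) auto
  qed
qed

section \<open>Autocorrelations and power spectra\<close>

lemma borel_measurable_cnj [measurable]: "cnj \<in> borel_measurable borel"
  by (intro borel_measurable_continuous_onI continuous_intros)

definition autocorr :: "(real \<Rightarrow> complex) \<Rightarrow> real \<Rightarrow> complex" where
  "autocorr f t = (LBINT u. f (t + u) * cnj (f u))"

definition L2_norm_sq :: "(real \<Rightarrow> complex) \<Rightarrow> real" where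
  "L2_norm_sq f = (LBINT u. (cmod (f u))\<^sup>2)"

lemma L2_norm_sq_nonneg [simp]: "0 \<le> L2_norm_sq f"
  by (simp add: L2_norm_sq_def)

lemma square_integrable_measurable [measurable_dest]:
  "square_integrable f \<Longrightarrow> f \<in> borel_measurable borel"
  by (simp add: square_integrable_def)

lemma square_integrableD: "square_integrable f \<Longrightarrow> integrable lborel (\<lambda>x. (norm (f x))\<^sup>2)"
  by (simp add: square_integrable_def)

lemma L2_correlation:
  fixes f g :: "real \<Rightarrow> complex"
  assumes f: "square_integrable f" and g: "square_integrable g"
  shows "integrable lborel (\<lambda>u. f (t + u) * cnj (g u))"
    and "cmod (LBINT u. f (t + u) * cnj (g u)) \<le> sqrt (L2_norm_sq f) * sqrt (L2_norm_sq g)"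
proof -
  note [measurable] = square_integrable_measurable[OF f] square_integrable_measurable[OF g]
  note ft = integrable_translation[OF square_integrableD[OF f], of t]
  have eq: "(LBINT u. (cmod (f (t + u)))\<^sup>2) = L2_norm_sq f"
    unfolding L2_norm_sq_def by (rule integral_translation[where f = "\<lambda>u. (cmod (f u))\<^sup>2"])
  note CS = Cauchy_Schwarz_integral[where M = lborel and a = "\<lambda>u. cmod (f (t + u))" and b = "\<lambda>u. cmod (g u)",
      OF _ _ ft square_integrableD[OF g]]
  have "integrable lborel (\<lambda>u. cmod (f (t + u)) * cmod (g u))"
    by (rule CS) auto
  then show int: "integrable lborel (\<lambda>u. f (t + u) * cnj (g u))"
    by (rule Bochner_Integration.integrable_bound) (auto simp: norm_mult)
  have "cmod (LBINT u. f (t + u) * cnj (g u)) \<le> (LBINT u. cmod (f (t + u) * cnj (g u)))"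
    by simp
  also have "\<dots> \<le> \<bar>LBINT u. cmod (f (t + u)) * cmod (g u)\<bar>"
    by (simp add: norm_mult)
  also have "\<dots> \<le> sqrt (L2_norm_sq f) * sqrt (L2_norm_sq g)"
    using CS(2) unfolding eq by (simp add: L2_norm_sq_def)
  finally show "cmod (LBINT u. f (t + u) * cnj (g u)) \<le> sqrt (L2_norm_sq f) * sqrt (L2_norm_sq g)" .
qed

lemma square_integrable_diff:
  fixes f g :: "real \<Rightarrow> complex"
  assumes f: "square_integrable f" and g: "square_integrable g"
  shows "square_integrable (\<lambda>u. f u - g u)"
  unfolding square_integrable_def
proof safe
  note [measurable] = square_integrable_measurable[OF f] square_integrable_measurable[OF g]
  show "(\<lambda>u. f u - g u) \<in> borel_measurable lborel" by simp
  have le: "(cmod (a - b))\<^sup>2 \<le> 2 * (cmod a)\<^sup>2 + 2 * (cmod b)\<^sup>2" for a b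
  proof -
    have "(cmod (a - b))\<^sup>2 \<le> (cmod a + cmod b)\<^sup>2"
      by (intro power_mono norm_triangle_ineq4) simp
    also have "\<dots> \<le> 2 * (cmod a)\<^sup>2 + 2 * (cmod b)\<^sup>2"
      using zero_le_power2[of "cmod a - cmod b"] by (simp add: power2_eq_square algebra_simps)
    finally show ?thesis .
  qed
  show "integrable lborel (\<lambda>u. (cmod (f u - g u))\<^sup>2)"
    by (rule Bochner_Integration.integrable_bound
        [of _ "\<lambda>u. 2 * (cmod (f u))\<^sup>2 + 2 * (cmod (g u))\<^sup>2"])
      (use square_integrableD[OF f] square_integrableD[OF g] le in auto)
qed

lemma autocorr_bound: "square_integrable f \<Longrightarrow> cmod (autocorr f t) \<le> L2_norm_sq f"
  using L2_correlation(2)[of f f t] by (simp add: autocorr_def)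

lemma autocorr_measurable [measurable]:
  assumes [measurable]: "f \<in> borel_measurable borel"
  shows "autocorr f \<in> borel_measurable borel"
  unfolding autocorr_def by measurable

text \<open>
  With \<open>d = F - f\<close>, the difference of the two correlations is the sum of the correlations of \<open>d\<close> with
  \<open>d\<close>, of \<open>d\<close> with \<open>f\<close> and of \<open>f\<close> with \<open>d\<close>. The bound is uniform in \<open>t\<close>, so \<open>L\<^sup>2\<close> convergence of functions
  implies uniform convergence of their autocorrelations.
\<close>

lemma autocorr_perturbation:
  assumes F: "square_integrable F" and f: "square_integrable f"
  shows "cmod (autocorr F t - autocorr f t) \<le>
    L2_norm_sq (\<lambda>u. F u - f u) + 2 * (sqrt (L2_norm_sq (\<lambda>u. F u - f u)) * sqrt (L2_norm_sq f))"
proof -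
  let ?d = "\<lambda>u. F u - f u"
  have d: "square_integrable ?d" by (rule square_integrable_diff[OF F f])
  note i = L2_correlation(1)[OF d d, of t] L2_correlation(1)[OF d f, of t]
    L2_correlation(1)[OF f d, of t] 
  have "autocorr F t - autocorr f t = (LBINT u. F (t + u) * cnj (F u) - f (t + u) * cnj (f u))"
    unfolding autocorr_def
    by (rule Bochner_Integration.integral_diff[symmetric]) (intro L2_correlation F f)+
  also have "\<dots> = (LBINT u. ?d (t + u) * cnj (?d u) + ?d (t + u) * cnj (f u) + f (t + u) * cnj (?d u))"
    by (intro Bochner_Integration.integral_cong) (auto simp: algebra_simps)
  also have "\<dots> = (LBINT u. ?d (t + u) * cnj (?d u)) + (LBINT u. ?d (t + u) * cnj (f u))
      + (LBINT u. f (t + u) * cnj (?d u))"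
    by (subst Bochner_Integration.integral_add, intro i Bochner_Integration.integrable_add, rule i,
        subst Bochner_Integration.integral_add, rule i, rule i, rule refl)
  finally have "cmod (autocorr F t - autocorr f t) \<le> cmod (LBINT u. ?d (t + u) * cnj (?d u)) +
     cmod (LBINT u. ?d (t + u) * cnj (f u)) + cmod (LBINT u. f (t + u) * cnj (?d u))"
    by (auto intro: order_trans[OF norm_triangle_ineq] add_mono)
  then show ?thesis
    using L2_correlation(2)[OF d d, of t] L2_correlation(2)[OF d f, of t]
      L2_correlation(2)[OF f d, of t] by (simp add: mult.commute)
qed

text \<open>
  The companion on the Fourier side: \<open>L\<^sup>2\<close> convergence of transforms implies \<open>L\<^sup>1\<close> convergence of
  their squared moduli.
\<close>

lemma power_spectrum_perturbation:
  assumes F: "square_integrable F" and f: "square_integrable f"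
  shows "(LBINT u. \<bar>(cmod (F u))\<^sup>2 - (cmod (f u))\<^sup>2\<bar>) \<le>
    L2_norm_sq (\<lambda>u. F u - f u) + 2 * (sqrt (L2_norm_sq (\<lambda>u. F u - f u)) * sqrt (L2_norm_sq f))"
proof -
  let ?d = "\<lambda>u. F u - f u"
  have d: "square_integrable ?d" by (rule square_integrable_diff[OF F f])
  note [measurable] = square_integrable_measurable[OF f] square_integrable_measurable[OF F]
  note CS = Cauchy_Schwarz_integral[where M = lborel and a = "\<lambda>u. cmod (?d u)" and b = "\<lambda>u. cmod (f u)",
      OF _ _ square_integrableD[OF d] square_integrableD[OF f]]
  have i: "integrable lborel (\<lambda>u. cmod (?d u) * cmod (f u))" by (rule CS) auto
  have le: "\<bar>(cmod a)\<^sup>2 - (cmod b)\<^sup>2\<bar> \<le> (cmod (a - b))\<^sup>2 + 2 * (cmod (a - b) * cmod b)" for a b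
  proof -
    have "\<bar>(cmod a)\<^sup>2 - (cmod b)\<^sup>2\<bar> = \<bar>cmod a - cmod b\<bar> * (cmod a + cmod b)"
      by (simp add: power2_eq_square square_diff_square_factored abs_mult)
    also have "\<dots> \<le> cmod (a - b) * (cmod (a - b) + 2 * cmod b)"
      using norm_triangle_ineq3[of a b] norm_triangle_ineq2[of a b] by (intro mult_mono) auto
    finally show ?thesis by (simp add: power2_eq_square algebra_simps)
  qed
  have "(LBINT u. \<bar>(cmod (F u))\<^sup>2 - (cmod (f u))\<^sup>2\<bar>) \<le>
     (LBINT u. (cmod (?d u))\<^sup>2 + 2 * (cmod (?d u) * cmod (f u)))"
    using square_integrableD[OF d] square_integrableD[OF F] square_integrableD[OF f] i
    by (intro integral_mono le) auto
  also have "\<dots> = L2_norm_sq ?d + 2 * (LBINT u. cmod (?d u) * cmod (f u))"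
    using square_integrableD[OF d] i by (simp add: L2_norm_sq_def)
  finally show ?thesis using CS(2) by (simp add: L2_norm_sq_def)
qed

text \<open>
  For the Fourier transforms of approximating functions square integrability is not known
  beforehand; closeness to a square integrable limit supplies it.
\<close>

lemma L2_tendsto_norm_sq:
  assumes F: "\<And>n. F n \<in> borel_measurable borel" and f: "square_integrable f"
    and lim: "L2_tendsto F f"
  shows "\<forall>\<^sub>F n in sequentially. square_integrable (F n)"
    and "(\<lambda>n. L2_norm_sq (\<lambda>u. F n u - f u)) \<longlonglongrightarrow> 0"
proof -
  note [measurable] = F square_integrable_measurable[OF f]
  have "\<forall>\<^sub>F n in sequentially. (\<integral>\<^sup>+x. ennreal ((norm (F n x - f x))\<^sup>2) \<partial>lborel) < 1"
    using lim unfolding L2_tendsto_def by (rule order_tendstoD) simp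
  then show ev: "\<forall>\<^sub>F n in sequentially. square_integrable (F n)"
  proof eventually_elim
    case (elim n)
    have d: "square_integrable (\<lambda>u. F n u - f u)"
      unfolding square_integrable_def
    proof safe
      show "integrable lborel (\<lambda>u. (cmod (F n u - f u))\<^sup>2)"
        using less_trans[OF elim ennreal_one_less_top] by (intro integrableI_bounded) auto
    qed simp
    have "square_integrable (\<lambda>u. - f u)" using f by (simp add: square_integrable_def)
    from square_integrable_diff[OF d this] show ?case by simp
  qed
  have "(\<lambda>n. enn2real (\<integral>\<^sup>+x. ennreal ((norm (F n x - f x))\<^sup>2) \<partial>lborel)) \<longlonglongrightarrow> enn2real 0"
    using lim unfolding L2_tendsto_def by (intro tendsto_enn2real) auto
  moreover have "L2_norm_sq (\<lambda>u. F n u - f u) = enn2real (\<integral>\<^sup>+x. ennreal ((norm (F n x - f x))\<^sup>2) \<partial>lborel)" for n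
    unfolding L2_norm_sq_def by (rule integral_eq_nn_integral) auto
  ultimately show "(\<lambda>n. L2_norm_sq (\<lambda>u. F n u - f u)) \<longlonglongrightarrow> 0" by simp
qed

lemma perturbation_bound_tendsto:
  assumes "D \<longlonglongrightarrow> (0 :: real)"
  shows "(\<lambda>n. D n + 2 * (sqrt (D n) * sqrt c)) \<longlonglongrightarrow> 0"
proof -
  have "(\<lambda>n. D n + 2 * (sqrt (D n) * sqrt c)) \<longlonglongrightarrow> 0 + 2 * (sqrt 0 * sqrt c)"
    by (intro tendsto_intros assms)
  then show ?thesis by simp
qed

lemma fourier_measurable [measurable]:
  assumes [measurable]: "f \<in> borel_measurable borel"
  shows "fourier f \<in> borel_measurable borel"
  unfolding fourier_def by measurable

lemma fourier_autocorr:
  assumes F: "integrable lborel F"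
  shows "integrable lborel (autocorr F)" and "fourier (autocorr F) y = of_real ((cmod (fourier F y))\<^sup>2)"
proof -
  note [measurable] = borel_measurable_integrable[OF F]
  have m [measurable]: "F \<in> borel_measurable borel" by measurable
  let ?H = "\<lambda>z (u, t). exp (\<i> * of_real (z * t)) * (F (t + u) * cnj (F u))"
  have tr: "integrable lborel (\<lambda>t. F (t + u))" "(LBINT t. cmod (F (t + u))) = (LBINT t. cmod (F t))" for u
    using integrable_translation[OF F, of u] integral_translation[of "\<lambda>t. cmod (F t)" u]
    by (simp_all add: add.commute)
  have H: "integrable (lborel \<Otimes>\<^sub>M lborel) (?H z)" for z
  proof (rule lborel_pair.Fubini_integrable)
    have "(\<lambda>u. LBINT t. cmod (?H z (u, t))) = (\<lambda>u. cmod (F u) * (LBINT t. cmod (F t)))"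
      by (simp add: norm_mult tr mult.commute)
    then show "integrable lborel (\<lambda>u. LBINT t. cmod (?H z (u, t)))"
      using F by simp
    show "AE u in lborel. integrable lborel (\<lambda>t. ?H z (u, t))"
    proof (rule AE_I2)
      fix u
      have "integrable lborel (\<lambda>t. F (t + u) * cnj (F u))" using tr(1) by simp
      then show "integrable lborel (\<lambda>t. ?H z (u, t))"
        by (rule Bochner_Integration.integrable_bound) (auto simp: norm_mult)
    qed
  qed measurable
  from lborel_pair.integrable_snd[of "\<lambda>u t. ?H 0 (u, t)"] H[of 0]
  have "integrable lborel (\<lambda>t. LBINT u. ?H 0 (u, t))" by (simp add: case_prod_unfold)
  then show "integrable lborel (autocorr F)" by (simp add: autocorr_def[abs_def])
  have "fourier (autocorr F) y = (LBINT t. LBINT u. ?H y (u, t))"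
    unfolding fourier_def autocorr_def by simp
  also have "\<dots> = (LBINT u. LBINT t. ?H y (u, t))"
    by (rule lborel_pair.Fubini_integral) (use H[of y] in \<open>simp add: case_prod_unfold\<close>)
  also have "\<dots> = (LBINT u. fourier F y * cnj (exp (\<i> * of_real (y * u)) * F u))"
  proof (rule Bochner_Integration.integral_cong)
    fix u
    have "(LBINT t. ?H y (u, t)) =
      (LBINT t. (\<lambda>t. exp (\<i> * of_real (y * t)) * F t) (u + t) * cnj (exp (\<i> * of_real (y * u)) * F u))"
      by (intro Bochner_Integration.integral_cong)
        (auto simp: exp_cnj exp_add algebra_simps exp_minus)
    also have "\<dots> = (LBINT t. (\<lambda>t. exp (\<i> * of_real (y * t)) * F t) (u + t)) * cnj (exp (\<i> * of_real (y * u)) * F u)"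
      by simp
    also have "(LBINT t. (\<lambda>t. exp (\<i> * of_real (y * t)) * F t) (u + t)) = fourier F y"
      unfolding fourier_def by (rule integral_translation)
    finally show "(LBINT t. ?H y (u, t)) = fourier F y * cnj (exp (\<i> * of_real (y * u)) * F u)" .
  qed simp
  also have "\<dots> = fourier F y * cnj (fourier F y)"
    unfolding fourier_def by (simp del: complex_cnj_mult)
  also have "\<dots> = of_real ((cmod (fourier F y))\<^sup>2)"
    by (simp add: complex_norm_square[symmetric])
  finally show "fourier (autocorr F) y = of_real ((cmod (fourier F y))\<^sup>2)" .
qed

lemma fourier_multiplication:
  assumes A: "integrable lborel A" and K: "integrable lborel K"
  shows "(LBINT y. K y * fourier A y) = (LBINT s. A s * fourier K s)"
proof -
  note [measurable] = borel_measurable_integrable[OF A] borel_measurable_integrable[OF K]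
  let ?H = "\<lambda>(y, s). K y * (exp (\<i> * of_real (y * s)) * A s)"
  have H: "integrable (lborel \<Otimes>\<^sub>M lborel) ?H"
  proof (rule lborel_pair.Fubini_integrable)
    show "integrable lborel (\<lambda>y. LBINT s. cmod (?H (y, s)))"
      using K by (simp add: norm_mult)
    show "AE y in lborel. integrable lborel (\<lambda>s. ?H (y, s))"
    proof (rule AE_I2)
      fix y
      have "integrable lborel (\<lambda>s. K y * A s)" using A by simp
      then show "integrable lborel (\<lambda>s. ?H (y, s))"
        by (rule Bochner_Integration.integrable_bound) (auto simp: norm_mult)
    qed
  qed measurable
  have "(LBINT y. K y * fourier A y) = (LBINT y. LBINT s. ?H (y, s))"
    unfolding fourier_def by simp
  also have "\<dots> = (LBINT s. LBINT y. ?H (y, s))"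
    by (rule lborel_pair.Fubini_integral[symmetric]) (use H in \<open>simp add: case_prod_unfold\<close>)
  also have "\<dots> = (LBINT s. A s * fourier K s)"
  proof (rule Bochner_Integration.integral_cong)
    fix s
    have "(LBINT y. ?H (y, s)) = (LBINT y. A s * (exp (\<i> * of_real (s * y)) * K y))"
      by (intro Bochner_Integration.integral_cong) (auto simp: mult_ac)
    then show "(LBINT y. ?H (y, s)) = A s * fourier K s"
      by (simp add: fourier_def)
  qed simp
  finally show ?thesis .
qed

text \<open>
  For bounded \<open>g\<close> the increments of the autocovariance are controlled by the \<open>L\<^sup>1\<close> modulus of
  continuity of \<open>g\<close>.
\<close>

lemma autocov_continuous_bounded:
  assumes [measurable]: "g \<in> borel_measurable borel" and g: "integrable lborel g"
    and bd: "\<And>u. \<bar>g u\<bar> \<le> B"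
  shows "continuous_on UNIV (autocov g)"
proof -
  have int: "integrable lborel (\<lambda>u. g (t + u) * g u)" for t
  proof (rule Bochner_Integration.integrable_bound)
    show "integrable lborel (\<lambda>u. B * g u)" using g by simp
    show "AE u in lborel. norm (g (t + u) * g u) \<le> norm (B * g u)"
    proof (rule AE_I2)
      fix u
      have "\<bar>g (t + u)\<bar> \<le> \<bar>B\<bar>" using bd[of "t + u"] by linarith
      then show "norm (g (t + u) * g u) \<le> norm (B * g u)"
        by (simp add: abs_mult mult_right_mono)
    qed
  qed simp
  have "((\<lambda>s. autocov g (t + s)) \<longlongrightarrow> autocov g t) (at 0)" for t
  proof (rule Lim_null[THEN iffD2], rule tendsto_0_le)
    show "((\<lambda>s. LBINT x. \<bar>g (s + x) - g x\<bar>) \<longlongrightarrow> 0) (at 0)"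
      by (rule L1_translation_continuous[OF g])
    have "\<bar>autocov g (t + s) - autocov g t\<bar> \<le> (LBINT x. \<bar>g (s + x) - g x\<bar>) * B" for s
    proof -
      have i: "integrable lborel (\<lambda>x. \<bar>g (s + x) - g x\<bar>)"
        using g integrable_translation[OF g, of s] by simp
      have it: "integrable lborel (\<lambda>x. \<bar>g (s + (t + x)) - g (t + x)\<bar>)"
        by (rule integrable_translation[OF i])
      have "\<bar>autocov g (t + s) - autocov g t\<bar> = \<bar>LBINT u. g (t + s + u) * g u - g (t + u) * g u\<bar>"
        using int[of t] int[of "t + s"] by (simp add: autocov_def)
      also have "\<dots> \<le> (LBINT u. \<bar>g (t + s + u) * g u - g (t + u) * g u\<bar>)"
        by (rule integral_abs_bound)
      also have "\<dots> \<le> (LBINT u. \<bar>g (s + (t + u)) - g (t + u)\<bar> * B)"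
      proof (intro integral_mono)
        fix u
        have "g (t + s + u) * g u - g (t + u) * g u = (g (s + (t + u)) - g (t + u)) * g u"
          by (simp add: algebra_simps)
        then show "\<bar>g (t + s + u) * g u - g (t + u) * g u\<bar> \<le> \<bar>g (s + (t + u)) - g (t + u)\<bar> * B"
          by (simp add: abs_mult mult_left_mono bd)
      qed (use int[of t] int[of "t + s"] it in auto)
      also have "\<dots> = (LBINT u. \<bar>g (s + (t + u)) - g (t + u)\<bar>) * B" by simp
      also have "(LBINT u. \<bar>g (s + (t + u)) - g (t + u)\<bar>) = (LBINT x. \<bar>g (s + x) - g x\<bar>)"
        by (rule integral_translation[where f = "\<lambda>x. \<bar>g (s + x) - g x\<bar>"])
      finally show ?thesis .
    qed
    then show "\<forall>\<^sub>F s in at 0. norm (autocov g (t + s) - autocov g t) \<le>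
       norm (LBINT x. \<bar>g (s + x) - g x\<bar>) * B"
      by simp
  qed
  then show ?thesis by (simp add: continuous_on_eq_continuous_at isCont_iff)
qed

lemma autocorr_of_real: "autocorr (\<lambda>u. of_real (g u)) t = of_real (autocov g t)"
proof -
  have "autocorr (\<lambda>u. of_real (g u)) t = (LBINT u. complex_of_real (g (t + u) * g u))"
    unfolding autocorr_def by (intro Bochner_Integration.integral_cong) auto
  also have "\<dots> = of_real (autocov g t)"
    unfolding autocov_def by (rule integral_complex_of_real)
  finally show ?thesis .
qed

lemma square_integrable_of_real:
  "square_integrable (\<lambda>u. complex_of_real (g u)) \<longleftrightarrow> square_integrable g"
proof -
  have "g \<in> borel_measurable borel" if [measurable]: "(\<lambda>u. complex_of_real (g u)) \<in> borel_measurable borel"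
  proof -
    have "(\<lambda>u. Re (complex_of_real (g u))) \<in> borel_measurable borel" by measurable
    then show ?thesis by simp
  qed
  moreover have "(\<lambda>u. complex_of_real (g u)) \<in> borel_measurable borel" if [measurable]: "g \<in> borel_measurable borel"
    by measurable
  ultimately have "(\<lambda>u. complex_of_real (g u)) \<in> borel_measurable borel \<longleftrightarrow> g \<in> borel_measurable borel"
    by blast
  then show ?thesis by (simp add: square_integrable_def)
qed

text \<open>
  Truncating \<open>g\<close> in space and in height gives bounded integrable functions that converge in \<open>L\<^sup>2\<close>;
  their continuous autocovariances converge uniformly.
\<close>

lemma autocov_continuous:
  fixes g :: "real \<Rightarrow> real"
  assumes g: "square_integrable g"
  shows "continuous_on UNIV (autocov g)"
proof -
  note [measurable] = square_integrable_measurable[OF g]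
  note g2 = g[unfolded square_integrable_def, THEN conjunct2]
  \<comment> \<open>The bound on \<open>u\<close> makes the truncation integrable, the bound on \<open>g u\<close> makes it bounded.\<close>
  define S where "S n = {u. \<bar>u\<bar> \<le> real n \<and> \<bar>g u\<bar> \<le> real n}" for n
  define G where "G n u = indicator (S n) u * g u" for n u
  have [measurable]: "S n \<in> sets borel" for n unfolding S_def by measurable
  have Gm [measurable]: "G n \<in> borel_measurable borel" for n unfolding G_def by measurable
  have Gle: "\<bar>G n u\<bar> \<le> \<bar>g u\<bar>" for n u by (auto simp: G_def indicator_def)
  have Gbd: "\<bar>G n u\<bar> \<le> real n" for n u by (auto simp: G_def S_def indicator_def)
  have Gint: "integrable lborel (G n)" for n
  proof (rule Bochner_Integration.integrable_bound)
    show "integrable lborel (\<lambda>u. real n * indicator {- real n..real n} u)"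
      by simp
    show "AE u in lborel. norm (G n u) \<le> norm (real n * indicator {- real n..real n} u)"
      using Gbd[of n] by (intro AE_I2) (auto simp: G_def S_def indicator_def)
  qed simp
  have Gsq: "square_integrable (G n)" for n
    unfolding square_integrable_def
  proof safe
    show "integrable lborel (\<lambda>x. (norm (G n x))\<^sup>2)"
      by (rule Bochner_Integration.integrable_bound[OF g2])
        (use Gle[of n] in \<open>auto simp: abs_le_square_iff\<close>)
  qed simp
  let ?c = "\<lambda>g u. complex_of_real (g u)"
  have "L2_tendsto (\<lambda>n. ?c (G n)) (?c g)"
    unfolding L2_tendsto_def
  proof -
    have "(\<lambda>n. \<integral>\<^sup>+x. ennreal ((norm (?c (G n) x - ?c g x))\<^sup>2) \<partial>lborel)
      \<longlonglongrightarrow> nn_integral lborel (\<lambda>x::real. 0)"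
    proof (rule nn_integral_dominated_convergence[where w = "\<lambda>x. ennreal ((norm (g x))\<^sup>2)"])
      show "(\<integral>\<^sup>+x. ennreal ((norm (g x))\<^sup>2) \<partial>lborel) < \<infinity>"
        using g2 by (simp add: integrable_iff_bounded)
      have "norm (?c (G n) x - ?c g x) \<le> norm (g x)" for n x
        by (auto simp: G_def indicator_def)
      then show "AE x in lborel. ennreal ((norm (?c (G n) x - ?c g x))\<^sup>2) \<le> ennreal ((norm (g x))\<^sup>2)" for n
        by (intro AE_I2 ennreal_leI power_mono) auto
      show "AE x in lborel. (\<lambda>n. ennreal ((norm (?c (G n) x - ?c g x))\<^sup>2)) \<longlonglongrightarrow> 0"
      proof (rule AE_I2)
        fix x
        obtain N where N: "max \<bar>x\<bar> \<bar>g x\<bar> \<le> real N" using real_arch_simple by blast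
        have "G n x = g x" if "n \<ge> N" for n
        proof -
          have "x \<in> S n" using N that by (auto simp: S_def)
          then show ?thesis by (simp add: G_def)
        qed
        then have "\<forall>\<^sub>F n in sequentially. ennreal ((norm (?c (G n) x - ?c g x))\<^sup>2) = 0"
          by (auto simp: eventually_sequentially intro!: exI[of _ N])
        then show "(\<lambda>n. ennreal ((norm (?c (G n) x - ?c g x))\<^sup>2)) \<longlonglongrightarrow> 0"
          by (rule tendsto_eventually)
      qed
    qed auto
    then show "(\<lambda>n. \<integral>\<^sup>+x. ennreal ((norm (?c (G n) x - ?c g x))\<^sup>2) \<partial>lborel) \<longlonglongrightarrow> 0"
      by simp
  qed
  note D = L2_tendsto_norm_sq(2)[OF _ square_integrable_of_real[THEN iffD2, OF g] this]
  have ul: "uniform_limit UNIV (\<lambda>n. autocov (G n)) (autocov g) sequentially"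
  proof (rule uniform_limitI)
    fix e :: real assume "e > 0"
    let ?D = "\<lambda>n. L2_norm_sq (\<lambda>u. ?c (G n) u - ?c g u)"
    have "\<forall>\<^sub>F n in sequentially. ?D n + 2 * (sqrt (?D n) * sqrt (L2_norm_sq (?c g))) < e"
      using perturbation_bound_tendsto[OF D] \<open>e > 0\<close> by (intro order_tendstoD) auto
    then show "\<forall>\<^sub>F n in sequentially. \<forall>t\<in>UNIV. dist (autocov (G n) t) (autocov g t) < e"
    proof eventually_elim
      case (elim n)
      show ?case
      proof
        fix t
        have "cmod (autocorr (?c (G n)) t - autocorr (?c g) t) < e"
          using elim autocorr_perturbation[OF square_integrable_of_real[THEN iffD2, OF Gsq[of n]]
              square_integrable_of_real[THEN iffD2, OF g], of t] by linarith
        then show "dist (autocov (G n) t) (autocov g t) < e"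
          by (simp add: autocorr_of_real dist_real_def flip: of_real_diff)
      qed
    qed
  qed
  have "\<forall>\<^sub>F n in sequentially. continuous_on UNIV (autocov (G n))"
    by (rule always_eventually, rule allI, rule autocov_continuous_bounded[OF Gm Gint Gbd])
  from this ul show ?thesis
    by (rule uniform_limit_theorem) simp
qed

text \<open>
  The Gaussian is its own Fourier transform, here read off from the characteristic function of
  the standard normal distribution.
\<close>

lemma fourier_gaussian:
  fixes \<sigma> t s :: real
  assumes \<sigma>: "\<sigma> > 0"
  defines "K \<equiv> \<lambda>y. complex_of_real (exp (- (\<sigma> * y)\<^sup>2 / 2)) * exp (- (\<i> * of_real (y * t)))"
  shows "integrable lborel K"
    and "fourier K s = of_real (sqrt (2 * pi) / \<sigma> * exp (- ((s - t) / \<sigma>)\<^sup>2 / 2))"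
proof -
  let ?n = "normal_density 0 1"
  have "integrable lborel (\<lambda>y. ?n (0 + \<sigma> * y))"
    using \<sigma> by (intro lborel_integrable_real_affine) auto
  then have "integrable lborel (\<lambda>y. sqrt (2 * pi) * ?n (\<sigma> * y))" by simp
  also have "(\<lambda>y. sqrt (2 * pi) * ?n (\<sigma> * y)) = (\<lambda>y. exp (- (\<sigma> * y)\<^sup>2 / 2))"
    by (simp add: normal_density_def)
  finally have i: "integrable lborel (\<lambda>y. exp (- (\<sigma> * y)\<^sup>2 / 2))" .
  then show "integrable lborel K"
    unfolding K_def by (rule Bochner_Integration.integrable_bound) (auto simp: norm_mult)
  let ?a = "(s - t) / \<sigma>"
  have "complex_of_real (exp (- ?a\<^sup>2 / 2)) = char std_normal_distribution ?a"
    by (simp add: char_std_normal_distribution)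
  also have "\<dots> = (LBINT z. ?n z *\<^sub>R iexp (?a * z))"
    unfolding char_def by (subst integral_density) (auto simp: normal_density_nonneg)
  also have "\<dots> = \<bar>\<sigma>\<bar> *\<^sub>R (LBINT y. ?n (0 + \<sigma> * y) *\<^sub>R iexp (?a * (0 + \<sigma> * y)))"
    using \<sigma> by (intro lborel_integral_real_affine) auto
  also have "(LBINT y. ?n (0 + \<sigma> * y) *\<^sub>R iexp (?a * (0 + \<sigma> * y))) =
     (LBINT y. of_real (1 / sqrt (2 * pi)) * (exp (\<i> * of_real (s * y)) * K y))"
  proof (rule Bochner_Integration.integral_cong)
    fix y
    have "iexp (?a * (0 + \<sigma> * y)) = exp (\<i> * of_real (s * y)) * exp (- (\<i> * of_real (y * t)))"
      using \<sigma> by (simp add: exp_add[symmetric] algebra_simps diff_divide_distrib)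
    then show "?n (0 + \<sigma> * y) *\<^sub>R iexp (?a * (0 + \<sigma> * y)) =
       of_real (1 / sqrt (2 * pi)) * (exp (\<i> * of_real (s * y)) * K y)"
      by (simp add: K_def normal_density_def scaleR_conv_of_real)
  qed simp
  also have "\<dots> = of_real (1 / sqrt (2 * pi)) * fourier K s"
    by (simp add: fourier_def)
  finally have "complex_of_real (exp (- ?a\<^sup>2 / 2)) = of_real (\<sigma> / sqrt (2 * pi)) * fourier K s"
    using \<sigma> by (simp add: scaleR_conv_of_real)
  then have "fourier K s = of_real (exp (- ?a\<^sup>2 / 2)) / of_real (\<sigma> / sqrt (2 * pi))"
    using \<sigma> by (simp add: field_simps del: of_real_mult)
  then show "fourier K s = of_real (sqrt (2 * pi) / \<sigma> * exp (- ?a\<^sup>2 / 2))"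
    by (simp add: field_simps)
qed

text \<open>
  By Fubini's theorem the power spectrum is the transform of the autocorrelation, and a Fourier
  transform may be moved from one factor of an integral to the other. Moving it onto the Gaussian
  weight produces an average of the autocorrelation around \<open>t\<close>, whereas inverting directly would
  require an integrable spectrum.
\<close>

lemma smoothed_parseval_L1:
  fixes \<sigma> t :: real
  assumes \<sigma>: "\<sigma> > 0" and F: "integrable lborel F"
  shows "(LBINT y. of_real (exp (- (\<sigma> * y)\<^sup>2 / 2)) * exp (- (\<i> * of_real (y * t))) *
            of_real ((cmod (fourier F y))\<^sup>2)) =
    2 * of_real pi * (LBINT z. normal_density 0 1 z *\<^sub>R autocorr F (t + \<sigma> * z))"
proof -
  define K where "K = (\<lambda>y. complex_of_real (exp (- (\<sigma> * y)\<^sup>2 / 2)) * exp (- (\<i> * of_real (y * t))))"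
  note K = fourier_gaussian[OF \<sigma>, where t = t, folded K_def]
  have "(LBINT y. K y * of_real ((cmod (fourier F y))\<^sup>2)) = (LBINT y. K y * fourier (autocorr F) y)"
    by (simp add: fourier_autocorr(2)[OF F])
  also have "\<dots> = (LBINT s. autocorr F s * fourier K s)"
    by (rule fourier_multiplication[OF fourier_autocorr(1)[OF F] K(1)])
  also have "\<dots> = \<bar>\<sigma>\<bar> *\<^sub>R (LBINT z. autocorr F (t + \<sigma> * z) * fourier K (t + \<sigma> * z))"
    using \<sigma> by (intro lborel_integral_real_affine) auto
  also have "(LBINT z. autocorr F (t + \<sigma> * z) * fourier K (t + \<sigma> * z)) =
     (LBINT z. of_real (2 * pi / \<sigma>) * (normal_density 0 1 z *\<^sub>R autocorr F (t + \<sigma> * z)))"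
  proof (rule Bochner_Integration.integral_cong)
    fix z
    have "sqrt (2 * pi) / \<sigma> * exp (- z\<^sup>2 / 2) = 2 * pi / \<sigma> * normal_density 0 1 z"
      using real_sqrt_pow2[of "2 * pi"] \<sigma>
      by (simp add: normal_density_def field_simps power2_eq_square del: real_sqrt_mult_self real_sqrt_pow2)
    moreover have "(t + \<sigma> * z - t) / \<sigma> = z" using \<sigma> by simp
    ultimately have "fourier K (t + \<sigma> * z) = of_real (2 * pi / \<sigma> * normal_density 0 1 z)"
      unfolding K(2) by (simp only:)
    then show "autocorr F (t + \<sigma> * z) * fourier K (t + \<sigma> * z) =
      of_real (2 * pi / \<sigma>) * (normal_density 0 1 z *\<^sub>R autocorr F (t + \<sigma> * z))"
      by (simp add: scaleR_conv_of_real)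
  qed simp
  also have "\<bar>\<sigma>\<bar> *\<^sub>R \<dots> = 2 * of_real pi * (LBINT z. normal_density 0 1 z *\<^sub>R autocorr F (t + \<sigma> * z))"
    using \<sigma> by (simp add: scaleR_conv_of_real)
  finally show ?thesis by (simp add: K_def)
qed

text \<open>
  Both sides are continuous along the approximating sequence of \<open>L\<^sup>1\<close> functions: the right side
  because autocorrelations converge uniformly, the left side because the power spectra converge
  in \<open>L\<^sup>1\<close>.
\<close>

lemma smoothed_parseval_L2:
  fixes \<sigma> t :: real
  assumes \<sigma>: "\<sigma> > 0" and f: "has_L2_fourier f \<phi>"
  shows "(LBINT y. of_real (exp (- (\<sigma> * y)\<^sup>2 / 2)) * exp (- (\<i> * of_real (y * t))) *
            of_real ((cmod (\<phi> y))\<^sup>2)) =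
    2 * of_real pi * (LBINT z. normal_density 0 1 z *\<^sub>R autocorr f (t + \<sigma> * z))"
    (is "?I \<phi> = 2 * of_real pi * ?J f")
proof -
  have fs: "square_integrable f" and \<phi>s: "square_integrable \<phi>"
    using f by (auto simp: has_L2_fourier_def)
  obtain F where F1: "\<And>n. integrable lborel (F n)" and F2: "\<And>n. square_integrable (F n)"
    and lim: "L2_tendsto F f" "L2_tendsto (\<lambda>n. fourier (F n)) \<phi>"
    using f unfolding has_L2_fourier_def by blast
  note [measurable] = square_integrable_measurable[OF fs] square_integrable_measurable[OF \<phi>s]
    square_integrable_measurable[OF F2]
  have n_int: "integrable lborel (normal_density 0 1)" by simp
  have ac_int: "integrable lborel (\<lambda>z. normal_density 0 1 z *\<^sub>R autocorr h (t + \<sigma> * z))"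
    if h: "square_integrable h" for h
  proof (rule Bochner_Integration.integrable_bound)
    note [measurable] = square_integrable_measurable[OF h]
    show "(\<lambda>z. normal_density 0 1 z *\<^sub>R autocorr h (t + \<sigma> * z)) \<in> borel_measurable lborel" by simp
    show "integrable lborel (\<lambda>z. normal_density 0 1 z * L2_norm_sq h)" using n_int by simp
    show "AE z in lborel. norm (normal_density 0 1 z *\<^sub>R autocorr h (t + \<sigma> * z)) \<le>
       norm (normal_density 0 1 z * L2_norm_sq h)"
      using autocorr_bound[OF h] by (intro AE_I2) (auto simp: abs_mult intro!: mult_left_mono)
  qed
  have J: "(\<lambda>n. ?J (F n)) \<longlonglongrightarrow> ?J f"
  proof (rule Lim_null[THEN iffD2], rule Lim_null_comparison)
    let ?B = "\<lambda>n. L2_norm_sq (\<lambda>u. F n u - f u) + 2 * (sqrt (L2_norm_sq (\<lambda>u. F n u - f u)) * sqrt (L2_norm_sq f))"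
    show "?B \<longlonglongrightarrow> 0"
      by (intro perturbation_bound_tendsto L2_tendsto_norm_sq(2)[OF _ fs lim(1)]) simp
    have "norm (?J (F n) - ?J f) \<le> ?B n" for n
    proof -
      have "?J (F n) - ?J f = (LBINT z. normal_density 0 1 z *\<^sub>R (autocorr (F n) (t + \<sigma> * z) - autocorr f (t + \<sigma> * z)))"
        unfolding scaleR_diff_right
        by (rule Bochner_Integration.integral_diff[symmetric]) (intro ac_int F2 fs)+
      then have "norm (?J (F n) - ?J f) \<le>
        (LBINT z. norm (normal_density 0 1 z *\<^sub>R (autocorr (F n) (t + \<sigma> * z) - autocorr f (t + \<sigma> * z))))"
        by (simp only: integral_norm_bound)
      also have "\<dots> \<le> (LBINT z. normal_density 0 1 z * ?B n)"
      proof (intro integral_mono)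
        show "integrable lborel (\<lambda>z. norm (normal_density 0 1 z *\<^sub>R (autocorr (F n) (t + \<sigma> * z) - autocorr f (t + \<sigma> * z))))"
          unfolding scaleR_diff_right
          by (intro integrable_norm Bochner_Integration.integrable_diff ac_int F2 fs)
        show "integrable lborel (\<lambda>z. normal_density 0 1 z * ?B n)" using n_int by simp
        fix z
        show "norm (normal_density 0 1 z *\<^sub>R (autocorr (F n) (t + \<sigma> * z) - autocorr f (t + \<sigma> * z)))
          \<le> normal_density 0 1 z * ?B n"
          using autocorr_perturbation[OF F2[of n] fs] by (simp add: mult_left_mono)
      qed
      also have "\<dots> = ?B n" by simp
      finally show ?thesis .
    qed
    then show "\<forall>\<^sub>F n in sequentially. norm (?J (F n) - ?J f) \<le> ?B n" by simp
  qed
  have I: "(\<lambda>n. ?I (fourier (F n))) \<longlonglongrightarrow> ?I \<phi>"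
  proof (rule Lim_null[THEN iffD2], rule Lim_null_comparison)
    let ?B = "\<lambda>n. L2_norm_sq (\<lambda>u. fourier (F n) u - \<phi> u) +
      2 * (sqrt (L2_norm_sq (\<lambda>u. fourier (F n) u - \<phi> u)) * sqrt (L2_norm_sq \<phi>))"
    let ?K = "\<lambda>y. complex_of_real (exp (- (\<sigma> * y)\<^sup>2 / 2)) * exp (- (\<i> * of_real (y * t)))"
    show "?B \<longlonglongrightarrow> 0"
      by (intro perturbation_bound_tendsto L2_tendsto_norm_sq(2)[OF _ \<phi>s lim(2)]) simp
    have K1: "cmod (?K y) \<le> 1" for y by (simp add: norm_mult)
    have Kint: "integrable lborel (\<lambda>y. ?K y * of_real ((cmod (h y))\<^sup>2))"
      if h: "square_integrable h" for h :: "real \<Rightarrow> complex"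
    proof (rule Bochner_Integration.integrable_bound[OF square_integrableD[OF h]])
      note [measurable] = square_integrable_measurable[OF h]
      show "(\<lambda>y. ?K y * of_real ((cmod (h y))\<^sup>2)) \<in> borel_measurable lborel" by measurable
      show "AE y in lborel. norm (?K y * of_real ((cmod (h y))\<^sup>2)) \<le> norm ((cmod (h y))\<^sup>2)"
      proof (rule AE_I2)
        fix y
        have "norm (?K y * of_real ((cmod (h y))\<^sup>2)) = norm (?K y) * (cmod (h y))\<^sup>2"
          by (simp only: norm_mult norm_of_real abs_power2)
        also have "\<dots> \<le> 1 * (cmod (h y))\<^sup>2" by (intro mult_right_mono K1) simp
        finally show "norm (?K y * of_real ((cmod (h y))\<^sup>2)) \<le> norm ((cmod (h y))\<^sup>2)" by simp
      qed
    qed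
    have "\<forall>\<^sub>F n in sequentially. square_integrable (fourier (F n))"
      by (rule L2_tendsto_norm_sq(1)[OF _ \<phi>s lim(2)]) simp
    then show "\<forall>\<^sub>F n in sequentially. norm (?I (fourier (F n)) - ?I \<phi>) \<le> ?B n"
    proof eventually_elim
      case (elim n)
      note i = Kint[OF elim] Kint[OF \<phi>s]
      let ?d = "\<lambda>y. (cmod (fourier (F n) y))\<^sup>2 - (cmod (\<phi> y))\<^sup>2"
      have "?I (fourier (F n)) - ?I \<phi> = (LBINT y. ?K y * of_real ((cmod (fourier (F n) y))\<^sup>2) - ?K y * of_real ((cmod (\<phi> y))\<^sup>2))"
        by (rule Bochner_Integration.integral_diff[symmetric]) (fact i)+
      then have "norm (?I (fourier (F n)) - ?I \<phi>) \<le>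
        (LBINT y. norm (?K y * of_real ((cmod (fourier (F n) y))\<^sup>2) - ?K y * of_real ((cmod (\<phi> y))\<^sup>2)))"
        by (simp only: integral_norm_bound)
      also have "\<dots> \<le> (LBINT y. \<bar>?d y\<bar>)"
      proof (intro integral_mono)
        show "integrable lborel (\<lambda>y. norm (?K y * of_real ((cmod (fourier (F n) y))\<^sup>2) - ?K y * of_real ((cmod (\<phi> y))\<^sup>2)))"
          by (intro integrable_norm Bochner_Integration.integrable_diff i)
        show "integrable lborel (\<lambda>y. \<bar>?d y\<bar>)"
          using square_integrableD[OF elim] square_integrableD[OF \<phi>s] by simp
        fix y
        have "norm (?K y * of_real ((cmod (fourier (F n) y))\<^sup>2) - ?K y * of_real ((cmod (\<phi> y))\<^sup>2)) =
          norm (?K y * of_real (?d y))" by (simp add: right_diff_distrib)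
        also have "\<dots> = norm (?K y) * \<bar>?d y\<bar>" by (simp only: norm_mult norm_of_real)
        also have "\<dots> \<le> 1 * \<bar>?d y\<bar>" by (intro mult_right_mono K1) simp
        finally show "norm (?K y * of_real ((cmod (fourier (F n) y))\<^sup>2) - ?K y * of_real ((cmod (\<phi> y))\<^sup>2))
          \<le> \<bar>?d y\<bar>" by simp
      qed
      also have "\<dots> \<le> ?B n" by (rule power_spectrum_perturbation[OF elim \<phi>s])
      finally show ?case .
    qed
  qed
  have "(\<lambda>n. ?I (fourier (F n))) \<longlonglongrightarrow> 2 * of_real pi * ?J f"
    unfolding smoothed_parseval_L1[OF \<sigma> F1] by (intro tendsto_intros J)
  with I show ?thesis by (rule LIMSEQ_unique)
qed

text \<open>
  Let the width \<open>\<sigma>\<close> of the smoothing tend to \<open>0\<close> along \<open>1/(n+1)\<close>. On the spectral side the Gaussian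
  weight tends to \<open>1\<close>; on the other side the average concentrates at \<open>t\<close>, where the autocovariance is
  continuous. Continuity is what makes the formula valid for every \<open>t\<close> instead of almost every \<open>t\<close>.
\<close>

theorem autocov_spectral_representation:
  fixes g :: "real \<Rightarrow> real"
  assumes f: "has_L2_fourier (\<lambda>u. complex_of_real (g u)) \<phi>"
  shows "complex_of_real (2 * pi * autocov g t) =
    (LBINT y. exp (- (\<i> * of_real (y * t))) * of_real ((cmod (\<phi> y))\<^sup>2))"
proof -
  let ?g = "\<lambda>u. complex_of_real (g u)"
  have gs': "square_integrable ?g" and \<phi>s: "square_integrable \<phi>"
    using f by (auto simp: has_L2_fourier_def)
  then have gs: "square_integrable g" by (simp add: square_integrable_of_real)
  note [measurable] = square_integrable_measurable[OF gs] square_integrable_measurable[OF \<phi>s]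
  have n_int: "integrable lborel (normal_density 0 1)" by simp
  have \<sigma>0: "(\<lambda>n. inverse (real (Suc n))) \<longlonglongrightarrow> 0" by (rule LIMSEQ_inverse_real_of_nat)
  have L: "(\<lambda>n. LBINT y. of_real (exp (- (inverse (real (Suc n)) * y)\<^sup>2 / 2)) *
      exp (- (\<i> * of_real (y * t))) * of_real ((cmod (\<phi> y))\<^sup>2))
    \<longlonglongrightarrow> (LBINT y. exp (- (\<i> * of_real (y * t))) * of_real ((cmod (\<phi> y))\<^sup>2))"
  proof (rule integral_dominated_convergence[where w = "\<lambda>y. (cmod (\<phi> y))\<^sup>2"])
    show "AE y in lborel. (\<lambda>n. of_real (exp (- (inverse (real (Suc n)) * y)\<^sup>2 / 2)) *
      exp (- (\<i> * of_real (y * t))) * of_real ((cmod (\<phi> y))\<^sup>2))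
      \<longlonglongrightarrow> exp (- (\<i> * of_real (y * t))) * of_real ((cmod (\<phi> y))\<^sup>2)"
    proof (rule AE_I2)
      fix y
      have "(\<lambda>n. complex_of_real (exp (- (inverse (real (Suc n)) * y)\<^sup>2 / 2)) *
        exp (- (\<i> * of_real (y * t))) * of_real ((cmod (\<phi> y))\<^sup>2))
        \<longlonglongrightarrow> of_real (exp (- (0 * y)\<^sup>2 / 2)) * exp (- (\<i> * of_real (y * t))) * of_real ((cmod (\<phi> y))\<^sup>2)"
        by (intro tendsto_intros \<sigma>0) auto
      then show "(\<lambda>n. of_real (exp (- (inverse (real (Suc n)) * y)\<^sup>2 / 2)) *
        exp (- (\<i> * of_real (y * t))) * of_real ((cmod (\<phi> y))\<^sup>2))
        \<longlonglongrightarrow> exp (- (\<i> * of_real (y * t))) * of_real ((cmod (\<phi> y))\<^sup>2)" by simp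
    qed
    show "AE y in lborel. norm (of_real (exp (- (inverse (real (Suc n)) * y)\<^sup>2 / 2)) *
      exp (- (\<i> * of_real (y * t))) * of_real ((cmod (\<phi> y))\<^sup>2)) \<le> (cmod (\<phi> y))\<^sup>2" for n
    proof (rule AE_I2)
      fix y
      have "norm (of_real (exp (- (inverse (real (Suc n)) * y)\<^sup>2 / 2)) *
        exp (- (\<i> * of_real (y * t))) * of_real ((cmod (\<phi> y))\<^sup>2)) =
        exp (- (inverse (real (Suc n)) * y)\<^sup>2 / 2) * (cmod (\<phi> y))\<^sup>2"
        unfolding norm_mult norm_of_real by simp
      also have "\<dots> \<le> 1 * (cmod (\<phi> y))\<^sup>2" by (intro mult_right_mono) auto
      finally show "norm (of_real (exp (- (inverse (real (Suc n)) * y)\<^sup>2 / 2)) *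
        exp (- (\<i> * of_real (y * t))) * of_real ((cmod (\<phi> y))\<^sup>2)) \<le> (cmod (\<phi> y))\<^sup>2" by simp
    qed
    show "integrable lborel (\<lambda>y. (cmod (\<phi> y))\<^sup>2)" by (rule square_integrableD[OF \<phi>s])
  qed measurable
  have cont: "isCont (autocov g) x" for x
    using autocov_continuous[OF gs] by (simp add: continuous_on_eq_continuous_at)
  have R: "(\<lambda>n. LBINT z. normal_density 0 1 z *\<^sub>R autocorr ?g (t + inverse (real (Suc n)) * z))
    \<longlonglongrightarrow> (LBINT z. normal_density 0 1 z *\<^sub>R autocorr ?g t)"
  proof (rule integral_dominated_convergence[where w = "\<lambda>z. normal_density 0 1 z * L2_norm_sq ?g"])
    show "AE z in lborel. (\<lambda>n. normal_density 0 1 z *\<^sub>R autocorr ?g (t + inverse (real (Suc n)) * z))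
       \<longlonglongrightarrow> normal_density 0 1 z *\<^sub>R autocorr ?g t"
    proof (rule AE_I2)
      fix z
      have "(\<lambda>n. t + inverse (real (Suc n)) * z) \<longlonglongrightarrow> t + 0 * z"
        by (intro tendsto_intros \<sigma>0)
      then have "(\<lambda>n. autocov g (t + inverse (real (Suc n)) * z)) \<longlonglongrightarrow> autocov g t"
        by (intro isCont_tendsto_compose[OF cont]) simp
      then show "(\<lambda>n. normal_density 0 1 z *\<^sub>R autocorr ?g (t + inverse (real (Suc n)) * z))
       \<longlonglongrightarrow> normal_density 0 1 z *\<^sub>R autocorr ?g t"
        unfolding autocorr_of_real by (intro tendsto_intros)
    qed
    show "AE z in lborel. norm (normal_density 0 1 z *\<^sub>R autocorr ?g (t + inverse (real (Suc n)) * z))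
        \<le> normal_density 0 1 z * L2_norm_sq ?g" for n
      using autocorr_bound[OF gs'] by (intro AE_I2) (auto intro!: mult_left_mono)
  qed (use n_int in auto)
  have "(LBINT z. normal_density 0 1 z *\<^sub>R autocorr ?g t) = autocorr ?g t"
    using n_int by simp
  with R have R': "(\<lambda>n. 2 * of_real pi * (LBINT z. normal_density 0 1 z *\<^sub>R autocorr ?g (t + inverse (real (Suc n)) * z)))
    \<longlonglongrightarrow> 2 * of_real pi * autocorr ?g t"
    by (intro tendsto_intros) simp
  show ?thesis
    using LIMSEQ_unique[OF R' L[unfolded smoothed_parseval_L2[OF positive_imp_inverse_positive[OF of_nat_0_less_iff[THEN iffD2, OF zero_less_Suc]] f]]]
    by (simp add: autocorr_of_real)
qed

section \<open>Long memory\<close>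

lemma even_integral_half_line:
  fixes G :: "real \<Rightarrow> real"
  assumes i: "integrable lborel G" and even: "\<And>x. G (- x) = G x"
  shows "(LBINT x. G x) = 2 * (LBINT x:{0<..}. G x)"
proof -
  have "integrable lborel (\<lambda>x. indicator {0..} x *\<^sub>R G x)"
    using i by (intro integrable_mult_indicator) auto
  then have "has_bochner_integral lborel (\<lambda>x. indicator {0..} x *\<^sub>R G x) (LBINT x. indicator {0..} x *\<^sub>R G x)"
    by (rule has_bochner_integral_integrable)
  from has_bochner_integral_even_function[OF this even]
  have "(LBINT x. G x) = 2 * (LBINT x. indicator {0..} x *\<^sub>R G x)"
    by (simp add: has_bochner_integral_iff)
  also have "(LBINT x. indicator {0..} x *\<^sub>R G x) = (LBINT x:{0<..}. G x)"
    unfolding set_lebesgue_integral_def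
  proof (rule integral_cong_AE)
    show "AE x in lborel. indicator {0..} x *\<^sub>R G x = indicator {0<..} x *\<^sub>R G x"
      using AE_lborel_singleton[of "0::real"] by eventually_elim (auto simp: indicator_def)
  qed (use borel_measurable_integrable[OF i] in measurable)
  finally show ?thesis .
qed

text \<open>
  Over \<open>[x, 2x]\<close> the integral is at least a constant times \<open>x\<^bsup>p+1\<^esup>\<close>, which is unbounded as \<open>p > -1\<close>.
\<close>

lemma slow_decay_not_integrable:
  fixes f :: "real \<Rightarrow> real" and c p :: real
  assumes c: "c > 0" and p: "-1 < p" "p \<le> 0" and f: "f \<sim>[at_top] (\<lambda>t. c * t powr p)"
  shows "(\<integral>\<^sup>+t. ennreal \<bar>f t\<bar> \<partial>lborel) = \<infinity>"
proof (rule ccontr)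
  assume fin: "\<not> ?thesis"
  then obtain B where B: "(\<integral>\<^sup>+t. ennreal \<bar>f t\<bar> \<partial>lborel) = ennreal B" "B \<ge> 0"
    by (cases "\<integral>\<^sup>+t. ennreal \<bar>f t\<bar> \<partial>lborel") auto
  let ?g = "\<lambda>t. c * t powr p"
  have "((\<lambda>t. f t / ?g t) \<longlongrightarrow> 1) at_top"
    using asymp_equivD_strong[OF f] c by (auto intro: eventually_mono[OF eventually_gt_at_top[of 0]])
  then have "\<forall>\<^sub>F t in at_top. 1 / 2 < f t / ?g t" by (rule order_tendstoD) simp
  then have "\<forall>\<^sub>F t in at_top. 1 / 2 * ?g t \<le> \<bar>f t\<bar>"
    using eventually_gt_at_top[of 0]
  proof eventually_elim
    case (elim t)
    have "?g t > 0" using c elim by simp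
    then have "1 / 2 * ?g t < f t" using elim(1) by (simp only: pos_less_divide_eq)
    then show ?case by linarith
  qed
  then obtain T where T: "\<And>t. t \<ge> T \<Longrightarrow> 1 / 2 * ?g t \<le> \<bar>f t\<bar>"
    by (auto simp: eventually_at_top_linorder)
  let ?k = "1 / 2 * c * 2 powr p"
  have bound: "?k * x powr (p + 1) \<le> B" if x: "x \<ge> T" "x > 0" for x
  proof -
    have "ennreal (?k * x powr (p + 1)) = ennreal (1 / 2 * c * (2 * x) powr p) * emeasure lborel {x..2 * x}"
      using x c by (simp add: powr_mult powr_add ennreal_mult[symmetric] mult_ac)
    also have "\<dots> = (\<integral>\<^sup>+t. ennreal (1 / 2 * c * (2 * x) powr p) * indicator {x..2 * x} t \<partial>lborel)"
      by (simp add: nn_integral_cmult_indicator)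
    also have "\<dots> \<le> (\<integral>\<^sup>+t. ennreal \<bar>f t\<bar> \<partial>lborel)"
    proof (rule nn_integral_mono)
      fix t
      show "ennreal (1 / 2 * c * (2 * x) powr p) * indicator {x..2 * x} t \<le> ennreal \<bar>f t\<bar>"
      proof (cases "t \<in> {x..2 * x}")
        case True
        have "1 / 2 * c * (2 * x) powr p \<le> 1 / 2 * c * t powr p"
          using True x c p by (intro mult_left_mono powr_mono2') auto
        also have "\<dots> \<le> \<bar>f t\<bar>" using T[of t] True x by simp
        finally show ?thesis using True by (simp add: ennreal_leI)
      qed simp
    qed
    finally show ?thesis using B by (simp add: ennreal_le_iff)
  qed
  have "filterlim (\<lambda>x. exp ((p + 1) * ln x)) at_top at_top"
    using p by (intro filterlim_compose[OF exp_at_top] filterlim_tendsto_pos_mult_at_top[OF tendsto_const] ln_at_top) auto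
  then have "filterlim (\<lambda>x. x powr (p + 1)) at_top at_top"
    by (rule filterlim_mono_eventually)
      (auto simp: powr_def intro!: eventually_mono[OF eventually_gt_at_top[of 0]])
  then have "filterlim (\<lambda>x. ?k * x powr (p + 1)) at_top at_top"
    using c by (intro filterlim_tendsto_pos_mult_at_top[OF tendsto_const]) auto
  then have "\<forall>\<^sub>F x in at_top. B + 1 \<le> ?k * x powr (p + 1)"
    unfolding filterlim_at_top by blast
  then have "\<forall>\<^sub>F x in at_top. B + 1 \<le> ?k * x powr (p + 1) \<and> x \<ge> T \<and> x > 0"
    by (intro eventually_conj eventually_ge_at_top eventually_gt_at_top)
  then obtain x where "B + 1 \<le> ?k * x powr (p + 1)" "x \<ge> T" "x > 0"
    using eventually_happens'[OF trivial_limit_at_top_linorder] by blast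
  then show False using bound[of x] by linarith
qed

theorem proposition3p7:
  fixes \<beta> :: real and \<eta> :: "real set \<Rightarrow> real"
    and g :: "real \<Rightarrow> real" and g_hat :: "real \<Rightarrow> complex"
  assumes beta: "0 < \<beta>" "\<beta> < 1 / 2"
    and eta: "finite_signed_measure nonneg_borel \<eta>"
    and eta_moment: "(\<integral>\<^sup>+u. ennreal u \<partial>total_variation nonneg_borel \<eta>) < \<infinity>"
    and h_nonzero: "\<And>z. Re z \<le> 0 \<Longrightarrow> h_fun \<beta> \<eta> z \<noteq> 0"
    and g_L2: "square_integrable g"
    and g_causal: "\<And>u. u < 0 \<Longrightarrow> g u = 0"
    and g_fourier: "has_L2_fourier (\<lambda>u. complex_of_real (g u)) g_hat"
    and g_hat: "\<And>y. y \<noteq> 0 \<Longrightarrow>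
      g_hat y = (- (\<i> * complex_of_real y)) powr complex_of_real (- \<beta>)
                  / h_fun \<beta> \<eta> (\<i> * complex_of_real y)"
  shows "(\<forall>y. y \<noteq> 0 \<longrightarrow> spectral_density g_hat y =
            1 / (cmod (h_fun \<beta> \<eta> (\<i> * complex_of_real y)))\<^sup>2 * \<bar>y\<bar> powr (- 2 * \<beta>))
    \<and> autocov g \<sim>[at_top]
          (\<lambda>t. Gamma (1 - 2 * \<beta>) / (Gamma \<beta> * Gamma (1 - \<beta>) * (\<eta> {0..})\<^sup>2)
                * t powr (2 * \<beta> - 1))
    \<and> spectral_density g_hat \<sim>[at 0]
          (\<lambda>y. 1 / (\<eta> {0..})\<^sup>2 * \<bar>y\<bar> powr (- 2 * \<beta>))
    \<and> (\<integral>\<^sup>+t. ennreal \<bar>autocov g t\<bar> \<partial>lborel) = \<infinity>"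
proof -
  let ?F = "spectral_density g_hat"
  define P where "P y = signed_integral nonneg_borel \<eta> (\<lambda>u. cos (y * u))" for y
  define Q where "Q y = signed_integral nonneg_borel \<eta> (\<lambda>u. sin (y * u))" for y
  define k1 k2 where "k1 = cos ((1 - \<beta>) * pi / 2)" and "k2 = - sin ((1 - \<beta>) * pi / 2)"
  define N where "N y = (k1 * y powr (1 - \<beta>) - P y)\<^sup>2 + (k2 * y powr (1 - \<beta>) - Q y)\<^sup>2" for y
  have h: "(cmod (h_fun \<beta> \<eta> (\<i> * complex_of_real y)))\<^sup>2 = N \<bar>y\<bar>" for y
    unfolding h_fun_imaginary_cmod[OF eta] N_def P_def Q_def k1_def k2_def ..
  have nz: "N y \<noteq> 0" if "y \<ge> 0" for y
  proof -
    have "(cmod (h_fun \<beta> \<eta> (\<i> * complex_of_real y)))\<^sup>2 \<noteq> 0" using h_nonzero by simp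
    then show ?thesis using that unfolding h by simp
  qed
  have spec: "?F y = 1 / (cmod (h_fun \<beta> \<eta> (\<i> * complex_of_real y)))\<^sup>2 * \<bar>y\<bar> powr (- 2 * \<beta>)"
    if y: "y \<noteq> 0" for y
  proof -
    have "cmod ((- (\<i> * complex_of_real y)) powr complex_of_real (- \<beta>)) = \<bar>y\<bar> powr (- \<beta>)"
      unfolding neg_imaginary_powr by (simp add: norm_mult)
    then have "?F y = (\<bar>y\<bar> powr (- \<beta>))\<^sup>2 / (cmod (h_fun \<beta> \<eta> (\<i> * complex_of_real y)))\<^sup>2"
      unfolding spectral_density_def g_hat[OF y] by (simp add: norm_divide power_divide)
    also have "(\<bar>y\<bar> powr (- \<beta>))\<^sup>2 = \<bar>y\<bar> powr (- 2 * \<beta>)"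
      by (simp add: power2_eq_square powr_add[symmetric])
    finally show ?thesis by simp
  qed
  have F_N: "?F y = \<bar>y\<bar> powr (- (2 * \<beta>)) / N \<bar>y\<bar>" if "y \<noteq> 0" for y
    using spec[OF that] unfolding h by simp
  have F_even: "?F (- y) = ?F y" for y by (cases "y = 0") (simp_all add: F_N)
  have F_int: "integrable lborel ?F"
    using g_fourier unfolding has_L2_fourier_def square_integrable_def spectral_density_def by simp

  have "k1\<^sup>2 + k2\<^sup>2 = 1" by (simp add: k1_def k2_def)
  have cos: "\<And>x::real. (cos has_real_derivative - sin x) (at x)" "\<And>x::real. isCont (\<lambda>x. - sin x) x"
      "\<And>x::real. \<bar>cos x\<bar> \<le> 1" "\<And>x::real. \<bar>- sin x\<bar> \<le> 1"
    and sin: "\<And>x::real. (sin has_real_derivative cos x) (at x)" "\<And>x::real. isCont cos x"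
      "\<And>x::real. \<bar>sin x\<bar> \<le> 1" "\<And>x::real. \<bar>cos x\<bar> \<le> 1"
    by (auto intro: DERIV_cos DERIV_sin)
  note cosI = signed_oscillatory_integral[OF eta eta_moment cos, folded P_def]
  note sinI = signed_oscillatory_integral[OF eta eta_moment sin, folded Q_def]
  have "\<eta> {0..} = P 0" "Q 0 = 0"
    unfolding P_def Q_def by (simp_all add: signed_integral_const[OF eta] space_restrict_space)
  then have PQ0: "(P 0)\<^sup>2 + (Q 0)\<^sup>2 = (\<eta> {0..})\<^sup>2" by simp
  have \<eta>0: "\<eta> {0..} \<noteq> 0" using nz[of 0] PQ0 beta by (simp add: N_def)
  have core: "\<exists>f' C. (\<forall>y>0. ((\<lambda>y. y powr (- (2 * \<beta>)) / N y) has_real_derivative f' y) (at y) \<and> isCont f' y \<and>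
      \<bar>y powr (- (2 * \<beta>)) / N y\<bar> \<le> C * y powr (- (2 * \<beta>)) \<and> \<bar>f' y\<bar> \<le> C * y powr (- (2 * \<beta>) - 1)) \<and>
      ((\<lambda>y. y powr (2 * \<beta> + 1) * f' y) \<longlongrightarrow> - (2 * \<beta>) / ((P 0)\<^sup>2 + (Q 0)\<^sup>2)) (at_right 0)"
    and N0: "(N \<longlongrightarrow> (P 0)\<^sup>2 + (Q 0)\<^sup>2) (at_right 0)"
    using singular_spectrum_derivative[OF beta \<open>k1\<^sup>2 + k2\<^sup>2 = 1\<close> cosI sinI, folded N_def, OF nz]
    by (simp_all only: N_def[abs_def])
  then obtain f' C where f': "\<And>y. y > 0 \<Longrightarrow> ((\<lambda>y. y powr (- (2 * \<beta>)) / N y) has_real_derivative f' y) (at y)"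
    "\<And>y. y > 0 \<Longrightarrow> isCont f' y"
    "\<And>y. y > 0 \<Longrightarrow> \<bar>y powr (- (2 * \<beta>)) / N y\<bar> \<le> C * y powr (- (2 * \<beta>))"
    "\<And>y. y > 0 \<Longrightarrow> \<bar>f' y\<bar> \<le> C * y powr (- (2 * \<beta>) - 1)"
    "((\<lambda>y. y powr (2 * \<beta> + 1) * f' y) \<longlongrightarrow> - (2 * \<beta>) / (\<eta> {0..})\<^sup>2) (at_right 0)"
    unfolding PQ0 by blast

  have asym0: "?F \<sim>[at 0] (\<lambda>y. 1 / (\<eta> {0..})\<^sup>2 * \<bar>y\<bar> powr (- 2 * \<beta>))"
  proof (rule asymp_equivI')
    have "filterlim (\<lambda>y::real. \<bar>y\<bar>) (at_right 0) (at 0)"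
      unfolding filterlim_at by (auto intro!: tendsto_eq_intros simp: eventually_at_filter)
    from filterlim_compose[OF N0 this]
    have "((\<lambda>y. (\<eta> {0..})\<^sup>2 / N \<bar>y\<bar>) \<longlongrightarrow> (\<eta> {0..})\<^sup>2 / (\<eta> {0..})\<^sup>2) (at 0)"
      unfolding PQ0 using \<eta>0 by (intro tendsto_intros) auto
    then have "((\<lambda>y. (\<eta> {0..})\<^sup>2 / N \<bar>y\<bar>) \<longlongrightarrow> 1) (at 0)" using \<eta>0 by simp
    moreover have "\<forall>\<^sub>F y in at 0. (\<eta> {0..})\<^sup>2 / N \<bar>y\<bar> = ?F y / (1 / (\<eta> {0..})\<^sup>2 * \<bar>y\<bar> powr (- 2 * \<beta>))"
      unfolding eventually_at_filter by (intro always_eventually) (auto simp: F_N)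
    ultimately show "((\<lambda>y. ?F y / (1 / (\<eta> {0..})\<^sup>2 * \<bar>y\<bar> powr (- 2 * \<beta>))) \<longlongrightarrow> 1) (at 0)"
      by (rule Lim_transform_eventually)
  qed

  let ?I = "\<lambda>t. LBINT y:{0<..}. cos (t * y) * (y powr (- (2 * \<beta>)) / N y)"
  let ?J = "LBINT x:{0<..}. sin x * x powr (- (2 * \<beta>) - 1)"
  have acov: "autocov g t = ?I t / pi" for t
  proof -
    have i: "integrable lborel (\<lambda>y. exp (- (\<i> * of_real (y * t))) * complex_of_real (?F y))"
      by (rule Bochner_Integration.integrable_bound[OF F_int])
        (use borel_measurable_integrable[OF F_int] in \<open>auto simp: norm_mult\<close>)
    have "2 * pi * autocov g t = Re (complex_of_real (2 * pi * autocov g t))" by simp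
    also have "\<dots> = (LBINT y. Re (exp (- (\<i> * of_real (y * t))) * complex_of_real (?F y)))"
      unfolding autocov_spectral_representation[OF g_fourier] spectral_density_def[symmetric]
      using i by (rule integral_Re[symmetric])
    also have "\<dots> = (LBINT y. cos (t * y) * ?F y)"
      by (intro Bochner_Integration.integral_cong) (simp_all add: Re_exp mult.commute)
    also have "\<dots> = 2 * (LBINT y:{0<..}. cos (t * y) * ?F y)"
    proof (rule even_integral_half_line)
      show "integrable lborel (\<lambda>y. cos (t * y) * ?F y)"
        by (rule Bochner_Integration.integrable_bound[OF F_int])
          (use borel_measurable_integrable[OF F_int] in \<open>auto simp: abs_mult mult_left_le_one_le\<close>)
    qed (simp add: F_even)
    also have "(LBINT y:{0<..}. cos (t * y) * ?F y) = ?I t"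
      by (rule set_lebesgue_integral_cong) (auto simp: F_N)
    finally show ?thesis by (simp add: field_simps)
  qed
  have f_int: "set_integrable lborel {0<..} (\<lambda>y. y powr (- (2 * \<beta>)) / N y)"
  proof -
    have "set_integrable lborel {0<..} ?F"
      unfolding set_integrable_def using F_int by (intro integrable_mult_indicator) auto
    then show ?thesis
      by (rule set_integrable_cong[THEN iffD1, OF refl refl, rotated]) (auto simp: F_N)
  qed
  define K where "K = Gamma (1 - 2 * \<beta>) / (Gamma \<beta> * Gamma (1 - \<beta>))"
  have K: "K > 0" unfolding K_def using beta by (intro divide_pos_pos mult_pos_pos Gamma_real_pos) auto
  \<comment> \<open>Two minus signs cancel: the limit of \<open>y\<^bsup>2\<beta>+1\<^esup> f' y\<close> is negative, and integration by parts reverses the sign.\<close>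
  have "((\<lambda>t. t powr (1 - 2 * \<beta>) * ?I t) \<longlongrightarrow> - (- (2 * \<beta>) / (\<eta> {0..})\<^sup>2) * ?J) at_top"
    by (rule cos_transform_asymptotics[where f' = f' and C = C]) (use beta f_int f' in auto)
  then have "((\<lambda>t. t powr (1 - 2 * \<beta>) * ?I t / pi) \<longlongrightarrow> - (- (2 * \<beta>) / (\<eta> {0..})\<^sup>2) * ?J / pi) at_top"
    by (rule tendsto_divide[OF _ tendsto_const pi_neq_zero])
  also have "- (- (2 * \<beta>) / (\<eta> {0..})\<^sup>2) * ?J / pi = (2 * \<beta> * ?J / pi) / (\<eta> {0..})\<^sup>2"
    by simp
  also have "2 * \<beta> * ?J / pi = K"
    unfolding K_def by (rule sin_powr_integral[OF beta])
  finally have lim: "((\<lambda>t. t powr (1 - 2 * \<beta>) * autocov g t) \<longlongrightarrow> K / (\<eta> {0..})\<^sup>2) at_top"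
    unfolding acov by simp
  let ?c = "K / (\<eta> {0..})\<^sup>2"
  have c: "?c > 0" using K \<eta>0 by simp
  have asymT: "autocov g \<sim>[at_top] (\<lambda>t. ?c * t powr (2 * \<beta> - 1))"
  proof (rule asymp_equivI')
    have "((\<lambda>t. t powr (1 - 2 * \<beta>) * autocov g t / ?c) \<longlongrightarrow> ?c / ?c) at_top"
      using c by (intro tendsto_divide lim tendsto_const) auto
    then have "((\<lambda>t. t powr (1 - 2 * \<beta>) * autocov g t / ?c) \<longlongrightarrow> 1) at_top"
      using c by (simp only: divide_self_if less_imp_neq[OF c, symmetric] if_False)
    moreover have "\<forall>\<^sub>F t in at_top. t powr (1 - 2 * \<beta>) * autocov g t / ?c = autocov g t / (?c * t powr (2 * \<beta> - 1))"
      using eventually_gt_at_top[of 0]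
    proof eventually_elim
      case (elim t)
      have e: "t powr (2 * \<beta> - 1) = 1 / t powr (1 - 2 * \<beta>)"
        using elim by (simp add: powr_minus_divide[symmetric])
      show ?case unfolding e by simp
    qed
    ultimately show "((\<lambda>t. autocov g t / (?c * t powr (2 * \<beta> - 1))) \<longlongrightarrow> 1) at_top"
      by (rule Lim_transform_eventually)
  qed
  have "(\<integral>\<^sup>+t. ennreal \<bar>autocov g t\<bar> \<partial>lborel) = \<infinity>"
    by (rule slow_decay_not_integrable[OF c _ _ asymT]) (use beta in auto)
  moreover have "?c = Gamma (1 - 2 * \<beta>) / (Gamma \<beta> * Gamma (1 - \<beta>) * (\<eta> {0..})\<^sup>2)"
    by (simp add: K_def)
  ultimately show ?thesis using spec asym0 asymT by simp
qed

end
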